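(* Let $n\ge 2$, $\alpha\in(-1,\infty)$, let $\omega$ be a majorant, and let $p\in[1,\infty]$. Consider the following two statements. $(\mathcal{C}_1)$ If $\varphi\in\Lambda_{\omega,p}(\mathbb{S}^{n-1})$ and $\varphi$ is continuous on $\mathbb{S}^{n-1}$, then $P_\alpha[\varphi]\in\Lambda_{\omega,p}(\overline{\mathbb{B}^n})$. $(\mathcal{C}_2)$ There exists a positive constant $C$ such that for all $\delta\in(0,\pi]$, $$\delta^{1+\alpha}\int_\delta^\pi\frac{\omega(t)}{t^{2+\alpha}}\,dt\le C\,\omega(\delta).$$ Then $(\mathcal{C}_2)\Rightarrow(\mathcal{C}_1)$ for every $p\in[1,\infty]$, and $(\mathcal{C}_2)\Leftrightarrow(\mathcal{C}_1)$ for $p=\infty$.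
   Context: $\mathbb{B}^n$ and $\mathbb{S}^{n-1}$ are the open unit ball and unit sphere of $\mathbb{R}^n$; $\sigma$ is the normalized surface measure on $\mathbb{S}^{n-1}$ ($\sigma(\mathbb{S}^{n-1})=1$). A majorant is a continuous increasing function $\omega:[0,\infty)\to[0,\infty)$ with $\omega(0)=0$ such that $\omega(t)/t$ is non-increasing for $t>0$. For continuous $\varphi:\mathbb{S}^{n-1}\to\mathbb{R}$ and $x\in\mathbb{B}^n$, $$P_\alpha[\varphi](x)=\int_{\mathbb{S}^{n-1}}P_\alpha(x,\zeta)\varphi(\zeta)\,d\sigma(\zeta),\quad P_\alpha(x,\zeta)=C_{n,\alpha}\frac{(1-|x|^2)^{1+\alpha}}{|x-\zeta|^{n+\alpha}},\quad C_{n,\alpha}=\frac{\Gamma(\frac{n+\alpha}{2})\Gamma(1+\frac{\alpha}{2})}{\Gamma(\frac n2)\Gamma(1+\alpha)}.$$ For $\alpha>-1$ and continuous $\varphi$, $P_\alpha[\varphi]$ is the solution of a Dirichlet problem with boundary values $\varphi$: it extends continuously to $\overline{\mathbb{B}^n}$ with $P_\alpha[\varphi]=\varphi$ on $\mathbb{S}^{n-1}$, and on $\overline{\mathbb{B}^n}$ it denotes this extension. $\mu$ is the invariant (Haar) measure on the rotation group $SO(n)$, with total mass $\frac12 2^{n(n+3)/4}\prod_{k=1}^n\frac{\pi^{k/2}}{\Gamma(k/2)}$. For a real-valued function $f$ on $E$, where $E$ is $\mathbb{B}^n$, $\overline{\mathbb{B}^n}$ or $\mathbb{S}^{n-1}$,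 and $x_1,x_2\in E$, set $$\mathcal{L}_p[f](x_1,x_2)=\left(\int_{SO(n)}|f(Rx_1)-f(Rx_2)|^p\,d\mu(R)\right)^{1/p}\ (0<p<\infty),\qquad \mathcal{L}_\infty[f](x_1,x_2)=|f(x_1)-f(x_2)|.$$ $\Lambda_{\omega,p}(E)$ is the class of real-valued functions $f$ on $E$ (Borel if $E$ is $\mathbb{B}^n$ or $\overline{\mathbb{B}^n}$, in $L^p(\mathbb{S}^{n-1})$ if $E=\mathbb{S}^{n-1}$) for which there is a constant $C>0$ with $\mathcal{L}_p[f](x_1,x_2)\le C\omega(|x_1-x_2|)$ for all $x_1,x_2\in E$. *)

theory Defs
  imports "HOL-Analysis.Analysis"
begin

(* Dimension: R^n is real^'n with n = CARD('n). *)

(* "Increasing" is read in the weak sense. The zero function must then be excluded: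
   on [0, infinity) a majorant that is not identically zero is positive for t > 0. *)
definition majorant :: "(real \<Rightarrow> real) \<Rightarrow> bool" where
  "majorant \<omega> \<longleftrightarrow>
     continuous_on {0..} \<omega> \<and> mono_on {0..} \<omega> \<and> (\<forall>t\<ge>0. 0 \<le> \<omega> t) \<and> \<omega> 0 = 0 \<and>
     antimono_on {0<..} (\<lambda>t. \<omega> t / t) \<and> (\<exists>t\<ge>0. \<omega> t \<noteq> 0)"

(* Normalized surface measure, by polar coordinates: the image of the uniform distribution
   on the unit ball under radial projection, so that the measure of a Borel subset A of the
   sphere is vol {t x | 0 < t < 1, x in A} / vol (ball 0 1).
   (sgn x = x / norm x; the value sgn 0 = 0 only affects a null set.) *)
definition sphere_measure :: "(real^'n) measure" where
  "sphere_measure =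
     restrict_space (distr (uniform_measure lborel (ball 0 1)) borel sgn) (sphere 0 1)"

definition poisson_const :: "nat \<Rightarrow> real \<Rightarrow> real" where
  "poisson_const n \<alpha> =
     Gamma ((real n + \<alpha>) / 2) * Gamma (1 + \<alpha> / 2) / (Gamma (real n / 2) * Gamma (1 + \<alpha>))"

definition poisson_kernel :: "real \<Rightarrow> real^'n \<Rightarrow> real^'n \<Rightarrow> real" where
  "poisson_kernel \<alpha> x \<zeta> =
     poisson_const CARD('n) \<alpha> *
       ((1 - (norm x)\<^sup>2) powr (1 + \<alpha>) / norm (x - \<zeta>) powr (real CARD('n) + \<alpha>))"

(* The Poisson integral in the open ball, together with its continuous extension to the
   closed ball, which is \<phi> on the unit sphere. Values outside the closed ball are irrelevant. *)
definition poisson_ext :: "real \<Rightarrow> (real^'n \<Rightarrow> real) \<Rightarrow> real^'n \<Rightarrow> real" where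
  "poisson_ext \<alpha> \<phi> x =
     (if x \<in> ball 0 1 then LINT \<zeta>|sphere_measure. poisson_kernel \<alpha> x \<zeta> * \<phi> \<zeta> else \<phi> x)"

definition SO :: "(real^'n^'n) set" where
  "SO = {Q. rotation_matrix Q}"

(* The invariant measure on the Borel sets of SO(n), with the normalization by which its
   total mass is that of the Hausdorff measure of SO(n) in the space of n x n matrices. *)
definition haar_measure_SO :: "(real^'n^'n) measure \<Rightarrow> bool" where
  "haar_measure_SO \<mu> \<longleftrightarrow>
     sets \<mu> = sets (restrict_space borel SO) \<and>
     (\<forall>Q\<in>SO. distr \<mu> \<mu> (\<lambda>R. Q ** R) = \<mu> \<and> distr \<mu> \<mu> (\<lambda>R. R ** Q) = \<mu>) \<and>
     emeasure \<mu> SO =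
       ennreal (1/2 * 2 powr (real CARD('n) * (real CARD('n) + 3) / 4) *
         (\<Prod>k=1..CARD('n). pi powr (real k / 2) / Gamma (real k / 2)))"

definition ennreal_root :: "real \<Rightarrow> ennreal \<Rightarrow> ennreal" where
  "ennreal_root q a = (if a = \<infinity> then \<infinity> else ennreal (enn2real a powr (1 / q)))"

definition rot_diff ::
  "(real^'n^'n) measure \<Rightarrow> ennreal \<Rightarrow> (real^'n \<Rightarrow> real) \<Rightarrow> real^'n \<Rightarrow> real^'n \<Rightarrow> ennreal" where
  "rot_diff \<mu> p f x1 x2 =
     (if p = \<infinity> then ennreal \<bar>f x1 - f x2\<bar>
      else ennreal_root (enn2real p)
             (\<integral>\<^sup>+ R. ennreal (\<bar>f (R *v x1) - f (R *v x2)\<bar> powr enn2real p) \<partial>\<mu>))"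

definition in_Lp :: "'a measure \<Rightarrow> ennreal \<Rightarrow> ('a \<Rightarrow> real) \<Rightarrow> bool" where
  "in_Lp M p f \<longleftrightarrow> f \<in> borel_measurable M \<and>
     (if p = \<infinity> then \<exists>B. AE x in M. \<bar>f x\<bar> \<le> B
      else integrable M (\<lambda>x. \<bar>f x\<bar> powr enn2real p))"

(* To be used for E the open ball, the closed ball or the sphere. *)
definition Lambda_class ::
  "(real^'n^'n) measure \<Rightarrow> (real \<Rightarrow> real) \<Rightarrow> ennreal \<Rightarrow> (real^'n) set \<Rightarrow> (real^'n \<Rightarrow> real) set" where
  "Lambda_class \<mu> \<omega> p E =
     {f. (if E = sphere 0 1 then in_Lp sphere_measure p f
          else f \<in> borel_measurable (restrict_space borel E)) \<and>
         (\<exists>C>0. \<forall>x1\<in>E. \<forall>x2\<in>E. rot_diff \<mu> p f x1 x2 \<le> ennreal (C * \<omega> (norm (x1 - x2))))}"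

definition cond_C1 ::
  "(real^'n^'n) measure \<Rightarrow> real \<Rightarrow> (real \<Rightarrow> real) \<Rightarrow> ennreal \<Rightarrow> bool" where
  "cond_C1 \<mu> \<alpha> \<omega> p \<longleftrightarrow>
     (\<forall>\<phi>. \<phi> \<in> Lambda_class \<mu> \<omega> p (sphere 0 1) \<and> continuous_on (sphere 0 1) \<phi> \<longrightarrow>
          poisson_ext \<alpha> \<phi> \<in> Lambda_class \<mu> \<omega> p (cball 0 1))"

definition cond_C2 :: "real \<Rightarrow> (real \<Rightarrow> real) \<Rightarrow> bool" where
  "cond_C2 \<alpha> \<omega> \<longleftrightarrow>
     (\<exists>C>0. \<forall>\<delta>\<in>{0<..pi}.
        \<delta> powr (1 + \<alpha>) * integral {\<delta>..pi} (\<lambda>t. \<omega> t / t powr (2 + \<alpha>)) \<le> C * \<omega> \<delta>)"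

end

theory Submission
  imports Defs "HOL-Probability.Giry_Monad"
begin

text \<open>
  Write \<open>P\<close> for the Poisson kernel and \<open>t = |\<zeta> - \<xi>|\<close> for the distance to the radial
  projection \<open>\<xi>\<close> of \<open>x\<close>. At \<open>x\<close> with \<open>|x| = 1 - \<delta>\<close> the kernel is comparable to
  \<open>\<delta>^(1+\<alpha>) / (\<delta> + t)^(n+\<alpha>)\<close>, and \<open>t\<close> has a density comparable to \<open>t^(n-2)\<close> near 0. Hence
  \<open>(C2)\<close> says exactly that the integral of \<open>P(x,\<zeta>) \<omega>(t)\<close> is bounded by a multiple of \<open>\<omega>(\<delta>)\<close>.
  Applied to \<open>\<phi>(\<zeta>) = \<omega>(|\<zeta> - \<xi>|)\<close> this gives the necessity of \<open>(C2)\<close>.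

  For sufficiency, rotation covariance turns \<open>P[\<phi>](R x) - \<phi>(R \<xi>)\<close> into the integral of
  \<open>P(x,\<zeta>) (\<phi>(R \<zeta>) - \<phi>(R \<xi>))\<close> plus \<open>\<phi>(R \<xi>) (P[1](x) - 1)\<close>, and Minkowski's inequality bounds
  the first term in \<open>L^p(\<mu>)\<close>. Points that are close relative to \<open>\<delta>\<close> are treated in the same
  way with a difference of kernels.

  Reflection in chords through \<open>x\<close> shows that \<open>P[1](x)\<close> is a constant times the integral of
  \<open>|x - \<zeta>|^(2+\<alpha>-n)\<close>. This has value 1 on the sphere, by a Beta integral and the duplication
  formula, and a modulus of continuity dominated by \<open>h^(1+\<alpha>)\<close> and by \<open>h\<close> times the integral of
  \<open>t^(\<alpha>-1)\<close> over \<open>[h,1]\<close>; both are bounded by a multiple of \<open>\<omega>(h)\<close> because of \<open>(C2)\<close> and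
  \<open>\<omega>(t) \<ge> c t\<close>.
\<close>

section \<open>The normalized surface measure\<close>

text \<open>The obstacle is that the kernel does not reproduce constants in general. Subtracting
  \<open>\<phi> (R *v \<xi>)\<close> under the integral leaves a multiple of the variation of P[1],
  which has to be of order \<omega> for every majorant that satisfies (C2). In its original form
  P[1] is a vanishing power of 1 - |x|^2 times a diverging integral; the chord reflection replaces
  this product by a single integral that still converges on the sphere, and whose variation can be
  estimated directly. For finite p the boundary function has no pointwise modulus \<omega>, only one
  in L^p(\<mu>) over R. Once R sits in \<phi> and not in the kernel, all kernel estimates are free
  of R and of p, so that the exponent \<infinity> needs no second proof. The kernel estimates become
  estimates in one real variable, the chord length. Constants depending on n are left unspecified
  throughout, because only orders of magnitude matter; the one exact value is that of P[1] on the
  sphere, where the precise form of the normalizing constant is decisive.\<close>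

lemma borel_measurable_orthogonal_transformation:
  fixes T :: "real^'n \<Rightarrow> real^'n"
  assumes "orthogonal_transformation T"
  shows "T \<in> borel_measurable borel"
  using orthogonal_transformation_linear[OF assms] by (intro borel_measurable_continuous_onI)
    (simp add: linear_continuous_on linear_conv_bounded_linear)

lemma emeasure_unit_ball_pos_finite:
  "emeasure lborel (ball 0 1 :: (real^'n) set) \<noteq> 0" "emeasure lborel (ball 0 1 :: (real^'n) set) \<noteq> \<infinity>"
  using unit_ball_vol_pos[of "real CARD('n)"] by (simp_all add: emeasure_ball del: unit_ball_vol_pos)

lemma nn_integral_lborel_translate:
  fixes f :: "'a::euclidean_space \<Rightarrow> ennreal"
  assumes [measurable]: "f \<in> borel_measurable borel"
  shows "(\<integral>\<^sup>+x. f (a + x) \<partial>lborel) = (\<integral>\<^sup>+x. f x \<partial>lborel)"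
proof -
  have "(\<integral>\<^sup>+x. f x \<partial>lborel) = (\<integral>\<^sup>+x. f x \<partial>distr lborel borel ((+) a))"
    by (simp add: lborel_distr_plus)
  also have "\<dots> = (\<integral>\<^sup>+x. f (a + x) \<partial>lborel)"
    by (rule nn_integral_distr) auto
  finally show ?thesis by (rule sym)
qed

text \<open>Uniqueness of translation-invariant measures, applied to the image of Lebesgue measure:
  both measures agree on the unit ball. (The linear change of variables of the library is
  restricted to well-ordered index types.)\<close>

lemma lborel_distr_orthogonal:
  fixes T :: "real^'n \<Rightarrow> real^'n"
  assumes T: "orthogonal_transformation T"
  shows "distr lborel borel T = lborel"
proof (rule measure_eqI)
  note [measurable] = borel_measurable_orthogonal_transformation[OF T]
  have lin: "linear T" using T by (rule orthogonal_transformation_linear)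
  have nT: "norm (T x) = norm x" for x
    using T by (rule orthogonal_transformation_norm)
  define S where "S = inv T"
  have TS: "T (S y) = y" for y
    unfolding S_def using orthogonal_transformation_surj[OF T] by (rule surj_f_inv_f)
  define B where "B = (ball 0 1 :: (real^'n) set)"
  have [measurable]: "B \<in> sets borel" by (simp add: B_def)
  fix A assume "A \<in> sets (distr lborel borel T)"
  then have [measurable]: "A \<in> sets borel" by simp
  \<comment> \<open>The product is the measure of the set of pairs (x, y) with T x in A and y - T x
    in B. Integrating in y first gives the left side. In the other order, shifting x by
    \<open>S y\<close> turns T x into y + T x, and the product of the volumes of A and B comes
    out.\<close>
  have "emeasure (distr lborel borel T) A * emeasure lborel B
      = (\<integral>\<^sup>+x. indicator A (T x) * emeasure lborel B \<partial>lborel)"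
    by (simp add: nn_integral_multc nn_integral_distr flip: nn_integral_indicator)
  also have "\<dots> = (\<integral>\<^sup>+x. (\<integral>\<^sup>+y. indicator A (T x) * indicator B (- T x + y) \<partial>lborel) \<partial>lborel)"
  proof (rule nn_integral_cong)
    fix x
    have "(\<integral>\<^sup>+y. indicator B (- T x + y) \<partial>lborel) = (\<integral>\<^sup>+y. indicator B y \<partial>lborel)"
      by (rule nn_integral_lborel_translate) measurable
    then show "indicator A (T x) * emeasure lborel B
       = (\<integral>\<^sup>+y. indicator A (T x) * indicator B (- T x + y) \<partial>lborel)"
      by (subst nn_integral_cmult) (auto simp: )
  qed
  also have "\<dots> = (\<integral>\<^sup>+y. (\<integral>\<^sup>+x. indicator A (T x) * indicator B (- T x + y) \<partial>lborel) \<partial>lborel)"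
    by (rule lborel_pair.Fubini'[symmetric]) measurable
  also have "\<dots> = (\<integral>\<^sup>+y. (\<integral>\<^sup>+x. indicator A (y + T x) * indicator B (- T x) \<partial>lborel) \<partial>lborel)"
  proof (rule nn_integral_cong)
    fix y
    have eq: "T (S y + x) = y + T x" for x
      by (simp add: linear_add[OF lin] TS)
    have "(\<integral>\<^sup>+x. indicator A (T (S y + x)) * indicator B (- T (S y + x) + y) \<partial>lborel)
       = (\<integral>\<^sup>+x. indicator A (T x) * indicator B (- T x + y) \<partial>lborel)"
      by (rule nn_integral_lborel_translate) measurable
    then show "(\<integral>\<^sup>+x. indicator A (T x) * indicator B (- T x + y) \<partial>lborel)
       = (\<integral>\<^sup>+x. indicator A (y + T x) * indicator B (- T x) \<partial>lborel)"
      unfolding eq by simp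
  qed
  also have "\<dots> = (\<integral>\<^sup>+x. (\<integral>\<^sup>+y. indicator A (y + T x) * indicator B (- T x) \<partial>lborel) \<partial>lborel)"
    by (rule lborel_pair.Fubini') measurable
  also have "\<dots> = (\<integral>\<^sup>+x. emeasure lborel A * indicator B x \<partial>lborel)"
  proof (rule nn_integral_cong)
    fix x
    have "(\<integral>\<^sup>+y. indicator A (T x + y) \<partial>lborel) = (\<integral>\<^sup>+y. indicator A y \<partial>lborel)"
      by (rule nn_integral_lborel_translate) measurable
    moreover have "indicator B (- T x) = (indicator B x :: ennreal)"
      by (simp add: B_def indicator_def nT)
    ultimately show "(\<integral>\<^sup>+y. indicator A (y + T x) * indicator B (- T x) \<partial>lborel) = emeasure lborel A * indicator B x"
      by (subst nn_integral_multc) (auto simp: add.commute)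
  qed
  also have "\<dots> = emeasure lborel A * emeasure lborel B"
    by (subst nn_integral_cmult) auto
  finally have eq: "emeasure lborel B * emeasure (distr lborel borel T) A = emeasure lborel B * emeasure lborel A"
    by (simp add: mult.commute)
  show "emeasure (distr lborel borel T) A = emeasure lborel A"
    using eq emeasure_unit_ball_pos_finite[where 'n='n]
    unfolding B_def by (subst (asm) ennreal_mult_cancel_left) auto
qed simp

lemma space_sphere_measure [simp]: "space sphere_measure = sphere (0::real^'n) 1"
  by (simp add: sphere_measure_def space_restrict_space)

lemma sets_sphere_measure: "sets sphere_measure = sets (restrict_space borel (sphere (0::real^'n) 1))"
  by (simp add: sphere_measure_def sets_restrict_space)

lemma measurable_sphere_measure_borel [measurable (raw)]:
  "f \<in> borel_measurable borel \<Longrightarrow> f \<in> borel_measurable (sphere_measure :: (real^'n) measure)"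
  by (subst measurable_cong_sets[OF sets_sphere_measure refl]) (rule measurable_restrict_space1)

lemma sphere_borel [measurable]: "sphere (a::real^'n) r \<in> sets borel"
  by (rule borel_closed[OF closed_sphere])

lemma ball_borel [measurable]: "ball (a::real^'n) r \<in> sets borel"
  by (rule borel_open[OF open_ball])

lemma nn_integral_sphere_measure:
  fixes f :: "real^'n \<Rightarrow> ennreal"
  assumes [measurable]: "f \<in> borel_measurable borel"
  shows "(\<integral>\<^sup>+\<zeta>. f \<zeta> \<partial>sphere_measure) =
    (\<integral>\<^sup>+x. f (sgn x) * indicator (ball 0 1) x \<partial>lborel) / emeasure lborel (ball 0 1 :: (real^'n) set)"
proof -
  have "(\<integral>\<^sup>+\<zeta>. f \<zeta> \<partial>sphere_measure)
      = (\<integral>\<^sup>+x. f (sgn x) * indicator (sphere 0 1) (sgn x) \<partial>uniform_measure lborel (ball 0 1 :: (real^'n) set))"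
    unfolding sphere_measure_def
    by (subst nn_integral_restrict_space) (auto intro!: nn_integral_distr borel_measurable_times_ennreal)
  also have "\<dots> = (\<integral>\<^sup>+x. f (sgn x) * indicator (sphere 0 1) (sgn x) * indicator (ball 0 1) x \<partial>lborel)
      / emeasure lborel (ball 0 1 :: (real^'n) set)"
    by (subst nn_integral_uniform_measure) auto
  also have "(\<integral>\<^sup>+x. f (sgn x) * indicator (sphere 0 1) (sgn x) * indicator (ball 0 1) x \<partial>lborel)
     = (\<integral>\<^sup>+x. f (sgn x) * indicator (ball 0 1) x \<partial>(lborel :: (real^'n) measure))"
  proof (rule nn_integral_cong_AE)
    \<comment> \<open>At the origin \<open>sgn 0 = 0\<close> lies off the sphere, so that the two
      integrands may differ there; everywhere else sgn x has norm 1.\<close>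
    have "AE x in lborel. x \<noteq> (0::real^'n)"
      by (rule AE_lborel_singleton)
    then show "AE x in lborel. f (sgn x) * indicator (sphere 0 1) (sgn x) * indicator (ball 0 1) x
      = f (sgn x) * indicator (ball 0 1) (x::real^'n)"
      by eventually_elim (simp add: norm_sgn indicator_def)
  qed
  finally show ?thesis .
qed

lemma prob_space_sphere_measure: "prob_space (sphere_measure :: (real^'n) measure)"
proof
  have "emeasure (sphere_measure :: (real^'n) measure) (space sphere_measure) = (\<integral>\<^sup>+\<zeta>. 1 \<partial>(sphere_measure :: (real^'n) measure))"
    by simp
  also have "\<dots> = 1"
    using emeasure_unit_ball_pos_finite[where 'n='n]
    by (subst nn_integral_sphere_measure)
      (auto simp: ennreal_divide_self[OF _ less_top[THEN iffD1]])
  finally show "emeasure (sphere_measure :: (real^'n) measure) (space sphere_measure) = 1" .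
qed

text \<open>Orthogonal maps preserve Lebesgue measure and the ball, and they commute with the radial
  projection; hence they preserve the projected measure.\<close>

lemma sphere_measure_distr_orthogonal:
  fixes T :: "real^'n \<Rightarrow> real^'n"
  assumes T: "orthogonal_transformation T"
  shows "T \<in> measurable sphere_measure sphere_measure" 
    and "distr sphere_measure sphere_measure T = sphere_measure"
proof -
  note [measurable] = borel_measurable_orthogonal_transformation[OF T]
  have nT: "norm (T x) = norm x" for x
    using T by (rule orthogonal_transformation_norm)
  have "T \<in> measurable (restrict_space borel (sphere 0 1)) (restrict_space borel (sphere 0 1))"
    by (rule measurable_restrict_space3) (auto simp: nT)
  then show meas: "T \<in> measurable sphere_measure sphere_measure"
    unfolding measurable_cong_sets[OF sets_sphere_measure sets_sphere_measure, symmetric] .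
  show "distr sphere_measure sphere_measure T = sphere_measure"
  proof (rule measure_eqI)
    fix A assume "A \<in> sets (distr sphere_measure sphere_measure T)"
    then have A: "A \<in> sets sphere_measure" by simp
    then have [measurable]: "A \<in> sets borel" and As: "A \<subseteq> sphere 0 1"
      by (auto simp: sets_sphere_measure sets_restrict_space_iff)
    have sgnT: "T (sgn x) = sgn (T x)" for x
      by (simp add: sgn_div_norm nT orthogonal_transformation_scaleR[OF T])
    have bm: "(\<lambda>x. indicator A (sgn x) * indicator (ball 0 1) x :: ennreal) \<in> borel_measurable borel"
      by measurable
    have "emeasure (distr sphere_measure sphere_measure T) A
       = emeasure sphere_measure (T -` A \<inter> space sphere_measure)"
      by (rule emeasure_distr[OF meas A])
    also have "\<dots> = (\<integral>\<^sup>+\<zeta>. indicator (T -` A \<inter> space sphere_measure) \<zeta> \<partial>sphere_measure)"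
      by (rule nn_integral_indicator[symmetric]) (rule measurable_sets[OF meas A])
    also have "\<dots> = (\<integral>\<^sup>+\<zeta>. indicator A (T \<zeta>) \<partial>sphere_measure)"
      by (intro nn_integral_cong) (auto simp: indicator_def)
    also have "\<dots> = (\<integral>\<^sup>+x. indicator A (T (sgn x)) * indicator (ball 0 1) x \<partial>lborel)
        / emeasure lborel (ball 0 1 :: (real^'n) set)"
      by (rule nn_integral_sphere_measure) measurable
    also have "(\<integral>\<^sup>+x. indicator A (T (sgn x)) * indicator (ball 0 1) x \<partial>lborel)
       = (\<integral>\<^sup>+x. indicator A (sgn x) * indicator (ball 0 1) x \<partial>(distr lborel borel T))"
      by (subst nn_integral_distr) (auto simp: sgnT nT indicator_def bm intro!: nn_integral_cong)
    also have "\<dots> / emeasure lborel (ball 0 1 :: (real^'n) set) = (\<integral>\<^sup>+\<zeta>. indicator A \<zeta> \<partial>sphere_measure)"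
      unfolding lborel_distr_orthogonal[OF T] by (rule nn_integral_sphere_measure[symmetric]) measurable
    also have "\<dots> = emeasure sphere_measure A"
      by (rule nn_integral_indicator[OF A])
    finally show "emeasure (distr sphere_measure sphere_measure T) A = emeasure sphere_measure A" .
  qed simp
qed

lemma nn_integral_sphere_measure_orthogonal:
  fixes T :: "real^'n \<Rightarrow> real^'n"
  assumes T: "orthogonal_transformation T" and f: "f \<in> borel_measurable sphere_measure"
  shows "(\<integral>\<^sup>+\<zeta>. f (T \<zeta>) \<partial>sphere_measure) = (\<integral>\<^sup>+\<zeta>. f \<zeta> \<partial>sphere_measure)"
proof -
  have "(\<integral>\<^sup>+\<zeta>. f \<zeta> \<partial>distr sphere_measure sphere_measure T) = (\<integral>\<^sup>+\<zeta>. f (T \<zeta>) \<partial>sphere_measure)"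
    by (rule nn_integral_distr[OF sphere_measure_distr_orthogonal(1)[OF T]]) (use f in simp)
  then show ?thesis
    unfolding sphere_measure_distr_orthogonal(2)[OF T] by (rule sym)
qed

lemma integral_sphere_measure_orthogonal:
  fixes T :: "real^'n \<Rightarrow> real^'n" and f :: "real^'n \<Rightarrow> real"
  assumes T: "orthogonal_transformation T" and f: "f \<in> borel_measurable sphere_measure"
  shows "(LINT \<zeta>|sphere_measure. f (T \<zeta>)) = (LINT \<zeta>|sphere_measure. f \<zeta>)"
proof -
  have "(LINT \<zeta>|distr sphere_measure sphere_measure T. f \<zeta>) = (LINT \<zeta>|sphere_measure. f (T \<zeta>))"
    by (rule integral_distr[OF sphere_measure_distr_orthogonal(1)[OF T]]) (use f in simp)
  then show ?thesis
    unfolding sphere_measure_distr_orthogonal(2)[OF T] by (rule sym)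
qed

section \<open>Integrals of zonal functions\<close>

text \<open>First radial moment of a ball. Writing the radius as the integral of the indicator of
  [0, radius) reduces it, by Fubini, to the volumes of balls. The weight is needed because scaling
  one further coordinate by the radius has the radius as its Jacobian.\<close>

lemma nn_integral_radius_PiM:
  fixes A :: "'i set"
  assumes fin: "finite A" and T: "T > 0" and A: "A \<noteq> {}"
  shows "(\<integral>\<^sup>+F. ennreal (sqrt (\<Sum>i\<in>A. (F i)\<^sup>2)) * indicator {..T} (sqrt (\<Sum>i\<in>A. (F i)\<^sup>2)) \<partial>Pi\<^sub>M A (\<lambda>_. lborel))
    = ennreal (unit_ball_vol (card A) * card A / (card A + 1) * T ^ (card A + 1))"
proof -
  interpret product_sigma_finite "\<lambda>_::'i. lborel :: real measure" by standard
  interpret fp: finite_product_sigma_finite "\<lambda>_::'i. lborel :: real measure" A by standard fact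
  interpret pr: pair_sigma_finite "Pi\<^sub>M A (\<lambda>_. lborel :: real measure)" "lborel :: real measure" ..
  define M where "M = Pi\<^sub>M A (\<lambda>_. lborel :: real measure)"
  define \<rho> where "\<rho> F = sqrt (\<Sum>i\<in>A. (F i)\<^sup>2)" for F :: "'i \<Rightarrow> real"
  define k where "k = unit_ball_vol (card A)"
  define m where "m = card A"
  have m: "m > 0" using fin A by (simp add: m_def card_gt_0_iff)
  have k: "k \<ge> 0" by (simp add: k_def)
  have [measurable]: "\<rho> \<in> borel_measurable M"
    unfolding \<rho>_def M_def by measurable
  have \<rho>0: "\<rho> F \<ge> 0" for F by (simp add: \<rho>_def sum_nonneg)
  have vol: "emeasure M {F\<in>space M. \<rho> F \<le> r} = ennreal (k * r ^ m)" if "r > 0" for r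
  proof -
    have "{F\<in>space M. \<rho> F \<le> r} = {F. sqrt (\<Sum>i\<in>A. (F i)\<^sup>2) \<le> r} \<inter> space M" by (auto simp: \<rho>_def)
    then show ?thesis unfolding M_def k_def m_def using emeasure_cball_aux[OF fin that] by simp
  qed
  have "(\<integral>\<^sup>+F. ennreal (\<rho> F) * indicator {..T} (\<rho> F) \<partial>M)
      = (\<integral>\<^sup>+F. (\<integral>\<^sup>+s. indicator {0..<\<rho> F} s * indicator {..T} (\<rho> F) \<partial>lborel) \<partial>M)"
    by (intro nn_integral_cong) (simp add: nn_integral_multc \<rho>0)
  also have "\<dots> = (\<integral>\<^sup>+F. (\<integral>\<^sup>+s. (if 0 \<le> s \<and> s < \<rho> F \<and> \<rho> F \<le> T then 1 else 0) \<partial>lborel) \<partial>M)"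
    by (intro nn_integral_cong) (auto simp: indicator_def)
  also have "\<dots> = (\<integral>\<^sup>+s. (\<integral>\<^sup>+F. (if 0 \<le> s \<and> s < \<rho> F \<and> \<rho> F \<le> T then 1 else 0) \<partial>M) \<partial>lborel)"
    unfolding M_def by (rule pr.Fubini'[symmetric]) (unfold M_def[symmetric], measurable)
  also have "\<dots> = (\<integral>\<^sup>+s. ennreal (k * (T ^ m - s ^ m)) * indicator {0..T} s \<partial>lborel)"
  proof (rule nn_integral_cong_AE)
    \<comment> \<open>The point s = 0 is set aside because \<open>vol\<close> is available for
      positive radii only.\<close>
    have "AE s in lborel. s \<noteq> (0::real)" by (rule AE_lborel_singleton)
    then show "AE s in lborel. (\<integral>\<^sup>+F. (if 0 \<le> s \<and> s < \<rho> F \<and> \<rho> F \<le> T then 1 else 0) \<partial>M)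
      = ennreal (k * (T ^ m - s ^ m)) * indicator {0..T} s"
    proof eventually_elim
      fix s :: real assume s: "s \<noteq> 0"
      show "(\<integral>\<^sup>+F. (if 0 \<le> s \<and> s < \<rho> F \<and> \<rho> F \<le> T then 1 else 0) \<partial>M)
         = ennreal (k * (T ^ m - s ^ m)) * indicator {0..T} s"
      proof (cases "0 \<le> s \<and> s \<le> T")
        case False
        then have "(if 0 \<le> s \<and> s < \<rho> F \<and> \<rho> F \<le> T then 1 else 0) = (0::ennreal)" for F by auto
        with False show ?thesis by (auto simp: indicator_def)
      next
        case True
        then have s0: "s > 0" using s by simp
        have "(\<integral>\<^sup>+F. (if 0 \<le> s \<and> s < \<rho> F \<and> \<rho> F \<le> T then 1 else 0) \<partial>M)
           = (\<integral>\<^sup>+F. indicator ({F\<in>space M. \<rho> F \<le> T} - {F\<in>space M. \<rho> F \<le> s}) F \<partial>M)"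
          using True by (intro nn_integral_cong) (auto simp: indicator_def)
        also have "\<dots> = emeasure M ({F\<in>space M. \<rho> F \<le> T} - {F\<in>space M. \<rho> F \<le> s})"
          by (rule nn_integral_indicator) measurable
        also have "\<dots> = emeasure M {F\<in>space M. \<rho> F \<le> T} - emeasure M {F\<in>space M. \<rho> F \<le> s}"
          using True by (intro emeasure_Diff) (auto simp: vol[OF s0])
        also have "\<dots> = ennreal (k * (T ^ m - s ^ m))"
          unfolding vol[OF s0] vol[OF T] using s0 k
          by (subst ennreal_minus) (auto simp: algebra_simps)
        finally show ?thesis using True by simp
      qed
    qed
  qed
  also have "\<dots> = ennreal (k * (T ^ m * T - T ^ (m+1) / (m+1)) - 0)"
  proof -
    have "(\<integral>\<^sup>+s. ennreal (k * (T ^ m - s ^ m)) * indicator {0..T} s \<partial>lborel)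
      = ennreal (k * (T ^ m * T - T ^ (m+1) / (m+1)) - k * (T ^ m * 0 - 0 ^ (m+1) / (m+1)))"
    proof (rule nn_integral_FTC_Icc)
      show "((\<lambda>s. k * (T ^ m * s - s ^ (m + 1) / real (m + 1))) has_real_derivative k * (T ^ m - x ^ m)) (at x)"
        if "x \<in> {0..T}" for x
      proof -
        have d: "((\<lambda>s. s ^ (m + 1)) has_real_derivative real (m + 1) * x ^ m) (at x)"
          by (rule DERIV_cong[OF DERIV_pow]) simp
        have "((\<lambda>s. k * (T ^ m * s - s ^ (m + 1) / real (m + 1))) has_real_derivative
            k * (T ^ m * 1 - real (m + 1) * x ^ m / real (m + 1))) (at x)"
          by (intro DERIV_cmult DERIV_diff DERIV_cdivide d DERIV_ident)
        then show ?thesis by simp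
      qed
      show "0 \<le> k * (T ^ m - x ^ m)" if "x \<in> {0..T}" for x
        using k that by (intro mult_nonneg_nonneg) (auto intro: power_mono)
    qed (use T in auto)
    then show ?thesis by simp
  qed
  also have "k * (T ^ m * T - T ^ (m+1) / (m+1)) - 0 = k * m / (m+1) * T ^ (m+1)"
    by (simp add: field_simps)
  finally show ?thesis unfolding M_def \<rho>_def k_def m_def .
qed

text \<open>The map is the passage from a slope y to the cosine s = y / sqrt (1 + y^2) of the
  corresponding angle; its derivative is (1 + y^2)^(-3/2). It maps the line onto the open interval,
  so the substitution rule for compact intervals is applied on [-N, N] and N tends to
  infinity.\<close>

lemma nn_integral_open_interval_substitution:
  fixes h :: "real \<Rightarrow> ennreal"
  assumes [measurable]: "h \<in> borel_measurable borel"
  shows "(\<integral>\<^sup>+y. h (y / sqrt (1 + y\<^sup>2)) * ennreal ((1 + y\<^sup>2) powr (-3/2)) \<partial>lborel)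
    = (\<integral>\<^sup>+s. h s * indicator {-1<..<1} s \<partial>lborel)"
proof -
  define g where "g y = y / sqrt (1 + y\<^sup>2)" for y :: real
  define g' where "g' y = (1 + y\<^sup>2) powr (-3/2)" for y :: real
  have pos: "1 + y\<^sup>2 > 0" for y :: real by (simp add: add_pos_nonneg)
  have [measurable]: "g \<in> borel_measurable borel" "g' \<in> borel_measurable borel"
    unfolding g_def g'_def by measurable
  have deriv: "(g has_real_derivative g' y) (at y)" for y
  proof -
    define w where "w = sqrt (1 + y\<^sup>2)"
    have w: "w > 0" "w\<^sup>2 = 1 + y\<^sup>2" using pos[of y] by (auto simp: w_def)
    have g'w: "g' y = 1 / w ^ 3"
    proof -
      have "g' y = (w powr 2) powr (-3/2)" using w by (simp add: g'_def)
      also have "\<dots> = w powr (-3)" by (simp add: powr_powr)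
      also have "\<dots> = 1 / w ^ 3" using w by (simp add: powr_minus_divide)
      finally show ?thesis .
    qed
    have "(g has_real_derivative (1 * sqrt (1 + y\<^sup>2) - y * (2 * y * (inverse (sqrt (1 + y\<^sup>2)) / 2))) / (sqrt (1 + y\<^sup>2) * sqrt (1 + y\<^sup>2))) (at y)"
      unfolding g_def using pos[of y] by (auto intro!: derivative_eq_intros)
    also have "(1 * sqrt (1 + y\<^sup>2) - y * (2 * y * (inverse (sqrt (1 + y\<^sup>2)) / 2))) / (sqrt (1 + y\<^sup>2) * sqrt (1 + y\<^sup>2)) = 1 / w ^ 3"
      unfolding w_def[symmetric] using w by (simp add: field_simps power2_eq_square power3_eq_cube)
    finally show ?thesis unfolding g'w .
  qed
  have g'0: "g' y \<ge> 0" for y by (simp add: g'_def)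
  have sub: "(\<integral>\<^sup>+s. h s * indicator {g (- real N)..g (real N)} s \<partial>lborel)
      = (\<integral>\<^sup>+y. h (g y) * g' y * indicator {-real N..real N} y \<partial>lborel)" for N
  \<comment> \<open>For N = 0 the interval degenerates to a point, which the substitution rule
    excludes; both sides vanish.\<close>
  proof (cases "N = 0")
    case True
    have "AE s in lborel. s \<noteq> (0::real)" by (rule AE_lborel_singleton)
    then have "AE s in lborel. h s * indicator {0::real} s = 0" 
         "AE s in lborel. h (g s) * g' s * indicator {0::real} s = 0" by (eventually_elim, simp)+
    then show ?thesis using True by (simp add: nn_integral_0_iff_AE g_def)
  next
    case False
    then show ?thesis
      using pos by (intro nn_integral_substitution_aux deriv)
        (auto simp: g'_def intro!: continuous_intros less_imp_neq[OF pos, symmetric])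
  qed
  have mono_g: "g x \<le> g y" if "x \<le> y" for x y
    using DERIV_nonneg_imp_nondecreasing[OF that, of g] deriv g'0 by blast
  have bnd: "\<bar>g y\<bar> < 1" for y
  proof -
    have "\<bar>y\<bar> < sqrt (1 + y\<^sup>2)" by (rule real_less_rsqrt) auto
    then show ?thesis using pos[of y] by (simp add: g_def divide_simps)
  qed
  have ex: "\<exists>N. g (- real N) \<le> s \<and> s \<le> g (real N)" if "-1 < s" "s < 1" for s
  proof -
    define y where "y = s / sqrt (1 - s\<^sup>2)"
    have "s\<^sup>2 < 1" using that by (simp add: abs_square_less_1)
    then have p: "1 - s\<^sup>2 > 0" by simp
    have "1 + y\<^sup>2 = 1 / (1 - s\<^sup>2)" using p by (simp add: y_def power_divide field_simps)
    then have gy: "g y = s" using p by (simp add: g_def y_def real_sqrt_divide)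
    obtain N :: nat where "\<bar>y\<bar> \<le> real N" using real_arch_simple by blast
    then have "g (- real N) \<le> g y" "g y \<le> g (real N)" by (auto intro!: mono_g)
    then show ?thesis using gy by auto
  qed
  have "(\<integral>\<^sup>+s. h s * indicator {-1<..<1} s \<partial>lborel)
      = (\<integral>\<^sup>+s. (SUP N::nat. h s * indicator {g (- real N)..g (real N)} s) \<partial>lborel)"
  proof (rule nn_integral_cong)
    fix s :: real
    show "h s * indicator {-1<..<1} s = (SUP N::nat. h s * indicator {g (- real N)..g (real N)} s)"
    proof (cases "-1 < s \<and> s < 1")
      case True
      then obtain N where N: "g (- real N) \<le> s \<and> s \<le> g (real N)" using ex by blast
      have "(SUP N::nat. h s * indicator {g (- real N)..g (real N)} s) = h s"
      proof (rule antisym)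
        show "(SUP N::nat. h s * indicator {g (- real N)..g (real N)} s) \<le> h s"
          by (rule SUP_least) (auto simp: indicator_def)
        show "h s \<le> (SUP N::nat. h s * indicator {g (- real N)..g (real N)} s)"
          by (rule SUP_upper2[of N]) (use N in auto)
      qed
      then show ?thesis using True by simp
    next
      case False
      then have "indicator {g (- real N)..g (real N)} s = (0::ennreal)" for N
        using bnd[of "- real N"] bnd[of "real N"] by (auto simp: indicator_def)
      then show ?thesis using False by auto
    qed
  qed
  also have "\<dots> = (SUP N::nat. (\<integral>\<^sup>+s. h s * indicator {g (- real N)..g (real N)} s \<partial>lborel))"
  proof (rule nn_integral_monotone_convergence_SUP)
    show "incseq (\<lambda>N s. h s * indicator {g (- real N)..g (real N)} s)"
    proof (intro incseq_SucI le_funI mult_left_mono)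
      fix N s
      have "g (- real (Suc N)) \<le> g (- real N)" "g (real N) \<le> g (real (Suc N))" by (auto intro!: mono_g)
      then show "indicator {g (- real N)..g (real N)} s \<le> (indicator {g (- real (Suc N))..g (real (Suc N))} s :: ennreal)"
        by (auto simp: indicator_def)
    qed simp
  qed measurable
  also have "\<dots> = (SUP N::nat. (\<integral>\<^sup>+y. h (g y) * g' y * indicator {-real N..real N} y \<partial>lborel))"
    unfolding sub ..
  also have "\<dots> = (\<integral>\<^sup>+y. (SUP N::nat. h (g y) * g' y * indicator {-real N..real N} y) \<partial>lborel)"
  proof (rule nn_integral_monotone_convergence_SUP[symmetric])
    show "incseq (\<lambda>N y. h (g y) * g' y * indicator {- real N..real N} y)"
      by (intro incseq_SucI le_funI mult_left_mono) (auto simp: indicator_def)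
  qed measurable
  also have "\<dots> = (\<integral>\<^sup>+y. h (g y) * g' y \<partial>lborel)"
  proof (rule nn_integral_cong)
    fix y :: real
    obtain N :: nat where "\<bar>y\<bar> \<le> real N" using real_arch_simple by blast
    then have N: "y \<in> {-real N..real N}" by auto
    show "(SUP N::nat. h (g y) * g' y * indicator {-real N..real N} y) = h (g y) * g' y"
    proof (rule antisym)
      show "(SUP N::nat. h (g y) * g' y * indicator {-real N..real N} y) \<le> h (g y) * g' y"
        by (rule SUP_least) (auto simp: indicator_def)
      show "h (g y) * g' y \<le> (SUP N::nat. h (g y) * g' y * indicator {-real N..real N} y)"
        by (rule SUP_upper2[of N]) (use N in auto)
    qed
  qed
  finally show ?thesis unfolding g_def g'_def by (rule sym)
qed

text \<open>Let \<rho> be the norm of the coordinates in A and y the coordinate at i. Replacing y by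
  \<rho> y makes the cosine y / sqrt (y^2 + \<rho>^2) independent of \<rho>, with Jacobian \<rho>,
  and turns the condition on the norm into \<rho> \<le> 1 / sqrt (1 + y^2). After exchanging the
  integrals, the inner one is the radial moment, and s = y / sqrt (1 + y^2) finishes.\<close>

lemma nn_integral_zonal_PiM:
  fixes A :: "'i set" and f :: "real \<Rightarrow> ennreal"
  assumes fin: "finite A" and A: "A \<noteq> {}" and i: "i \<notin> A" and [measurable]: "f \<in> borel_measurable borel"
  shows "(\<integral>\<^sup>+F. f (F i / sqrt (\<Sum>j\<in>insert i A. (F j)\<^sup>2)) * indicator {..1} (sqrt (\<Sum>j\<in>insert i A. (F j)\<^sup>2))
      \<partial>Pi\<^sub>M (insert i A) (\<lambda>_. lborel))
    = ennreal (unit_ball_vol (card A) * card A / (card A + 1)) *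
      (\<integral>\<^sup>+s. f s * ennreal ((1 - s\<^sup>2) powr ((real (card A) - 2) / 2)) * indicator {-1<..<1} s \<partial>lborel)"
proof -
  interpret product_sigma_finite "\<lambda>_::'i. lborel :: real measure" by standard
  interpret fp: finite_product_sigma_finite "\<lambda>_::'i. lborel :: real measure" A by standard fact
  interpret pr: pair_sigma_finite "Pi\<^sub>M A (\<lambda>_. lborel :: real measure)" "lborel :: real measure" ..
  define M where "M = Pi\<^sub>M A (\<lambda>_. lborel :: real measure)"
  define \<rho> where "\<rho> F = sqrt (\<Sum>i\<in>A. (F i)\<^sup>2)" for F :: "'i \<Rightarrow> real"
  define c where "c = unit_ball_vol (card A) * card A / (card A + 1)"
  define m where "m = card A"
  have m: "m > 0" using fin A by (simp add: m_def card_gt_0_iff)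
  have c: "c \<ge> 0" by (simp add: c_def)
  have [measurable]: "\<rho> \<in> borel_measurable M"
    unfolding \<rho>_def M_def by measurable
  have \<rho>0: "\<rho> F \<ge> 0" for F by (simp add: \<rho>_def sum_nonneg)
  have \<rho>2: "(\<rho> F)\<^sup>2 = (\<Sum>i\<in>A. (F i)\<^sup>2)" for F by (simp add: \<rho>_def sum_nonneg)
  have vol: "emeasure M {F\<in>space M. \<rho> F \<le> r} = ennreal (unit_ball_vol (card A) * r ^ m)" if "r > 0" for r
  proof -
    have "{F\<in>space M. \<rho> F \<le> r} = {F. sqrt (\<Sum>i\<in>A. (F i)\<^sup>2) \<le> r} \<inter> space M" by (auto simp: \<rho>_def)
    then show ?thesis unfolding M_def m_def using emeasure_cball_aux[OF fin that] by simp
  qed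
  have AE: "AE F in M. \<rho> F \<noteq> 0"
  proof (rule AE_I)
    show "{F\<in>space M. \<not> \<rho> F \<noteq> 0} \<subseteq> {F\<in>space M. \<rho> F \<le> 0}" by auto
    show "{F\<in>space M. \<rho> F \<le> 0} \<in> sets M" by measurable
    have "emeasure M {F\<in>space M. \<rho> F \<le> 0} \<le> ennreal e" if e: "e > 0" for e
    proof -
      \<comment> \<open>The null set is caught in balls of small positive radius: r \<le> 1 and m
        \<ge> 1 give r^m \<le> r, and the second entry of the minimum makes the volume at most
        e.\<close>
      define r where "r = min 1 (e / unit_ball_vol (card A))"
      have kp: "unit_ball_vol (card A) > 0" by simp
      have r: "r > 0" using e kp by (simp add: r_def)
      have "emeasure M {F\<in>space M. \<rho> F \<le> 0} \<le> emeasure M {F\<in>space M. \<rho> F \<le> r}"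
        using r by (intro emeasure_mono) auto
      also have "\<dots> = ennreal (unit_ball_vol (card A) * r ^ m)" by (rule vol[OF r])
      also have "\<dots> \<le> ennreal e"
      proof (rule ennreal_leI)
        have "r ^ m \<le> r ^ 1" using r m by (intro power_decreasing) (auto simp: r_def)
        also have "\<dots> \<le> e / unit_ball_vol (card A)" by (simp add: r_def)
        finally show "unit_ball_vol (card A) * r ^ m \<le> e" using kp by (simp add: field_simps)
      qed
      finally show ?thesis .
    qed
    then show "emeasure M {F\<in>space M. \<rho> F \<le> 0} = 0"
      using ennreal_le_epsilon[of 0 "emeasure M {F\<in>space M. \<rho> F \<le> 0}"] by simp
  qed
  have upd: "(\<Sum>j\<in>insert i A. ((F(i := y)) j)\<^sup>2) = y\<^sup>2 + (\<rho> F)\<^sup>2" for F y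
  proof -
    have "(\<Sum>j\<in>A. ((F(i := y)) j)\<^sup>2) = (\<Sum>j\<in>A. (F j)\<^sup>2)" using i by (intro sum.cong) auto
    then show ?thesis using fin i by (simp add: \<rho>2)
  qed
  have "(\<integral>\<^sup>+F. f (F i / sqrt (\<Sum>j\<in>insert i A. (F j)\<^sup>2)) * indicator {..1} (sqrt (\<Sum>j\<in>insert i A. (F j)\<^sup>2))
      \<partial>Pi\<^sub>M (insert i A) (\<lambda>_. lborel))
    = (\<integral>\<^sup>+F. (\<integral>\<^sup>+y. f (y / sqrt (y\<^sup>2 + (\<rho> F)\<^sup>2)) * indicator {..1} (sqrt (y\<^sup>2 + (\<rho> F)\<^sup>2)) \<partial>lborel) \<partial>M)"
  proof (subst product_nn_integral_insert[OF fin i], goal_cases)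
    case 1
    show ?case by measurable
  next
    case 2
    show ?case unfolding upd M_def by simp
  qed
  also have "\<dots> = (\<integral>\<^sup>+F. (\<integral>\<^sup>+y. f (y / sqrt (1 + y\<^sup>2)) * (ennreal (\<rho> F) * indicator {..1 / sqrt (1 + y\<^sup>2)} (\<rho> F)) \<partial>lborel) \<partial>M)"
  proof (rule nn_integral_cong_AE)
    show "AE F in M. (\<integral>\<^sup>+y. f (y / sqrt (y\<^sup>2 + (\<rho> F)\<^sup>2)) * indicator {..1} (sqrt (y\<^sup>2 + (\<rho> F)\<^sup>2)) \<partial>lborel)
      = (\<integral>\<^sup>+y. f (y / sqrt (1 + y\<^sup>2)) * (ennreal (\<rho> F) * indicator {..1 / sqrt (1 + y\<^sup>2)} (\<rho> F)) \<partial>lborel)"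
      using AE
    proof eventually_elim
      fix F assume "\<rho> F \<noteq> 0"
      then have r: "\<rho> F > 0" using \<rho>0[of F] by simp
      have sq: "sqrt ((\<rho> F * y)\<^sup>2 + (\<rho> F)\<^sup>2) = \<rho> F * sqrt (1 + y\<^sup>2)" for y
      proof -
        have "(\<rho> F * y)\<^sup>2 + (\<rho> F)\<^sup>2 = (\<rho> F)\<^sup>2 * (1 + y\<^sup>2)" by (simp add: algebra_simps)
        then show ?thesis using r by (simp add: real_sqrt_mult)
      qed
      have p: "sqrt (1 + y\<^sup>2) > 0" for y :: real by (simp add: add_pos_nonneg)
      have "(\<integral>\<^sup>+y. f (y / sqrt (y\<^sup>2 + (\<rho> F)\<^sup>2)) * indicator {..1} (sqrt (y\<^sup>2 + (\<rho> F)\<^sup>2)) \<partial>lborel)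
        = \<bar>\<rho> F\<bar> * (\<integral>\<^sup>+y. f ((0 + \<rho> F * y) / sqrt ((0 + \<rho> F * y)\<^sup>2 + (\<rho> F)\<^sup>2)) *
             indicator {..1} (sqrt ((0 + \<rho> F * y)\<^sup>2 + (\<rho> F)\<^sup>2)) \<partial>lborel)"
        by (rule nn_integral_real_affine) (measurable, use r in simp)
      also have "\<dots> = (\<integral>\<^sup>+y. ennreal (\<rho> F) * (f (y / sqrt (1 + y\<^sup>2)) * indicator {..1} (\<rho> F * sqrt (1 + y\<^sup>2))) \<partial>lborel)"
        using r by (simp add: sq nn_integral_cmult)
      also have "\<dots> = (\<integral>\<^sup>+y. f (y / sqrt (1 + y\<^sup>2)) * (ennreal (\<rho> F) * indicator {..1 / sqrt (1 + y\<^sup>2)} (\<rho> F)) \<partial>lborel)"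
        using p by (intro nn_integral_cong) (auto simp: indicator_def field_simps)
      finally show "(\<integral>\<^sup>+y. f (y / sqrt (y\<^sup>2 + (\<rho> F)\<^sup>2)) * indicator {..1} (sqrt (y\<^sup>2 + (\<rho> F)\<^sup>2)) \<partial>lborel)
        = (\<integral>\<^sup>+y. f (y / sqrt (1 + y\<^sup>2)) * (ennreal (\<rho> F) * indicator {..1 / sqrt (1 + y\<^sup>2)} (\<rho> F)) \<partial>lborel)" .
    qed
  qed
  also have "\<dots> = (\<integral>\<^sup>+y. (\<integral>\<^sup>+F. f (y / sqrt (1 + y\<^sup>2)) * (ennreal (\<rho> F) * indicator {..1 / sqrt (1 + y\<^sup>2)} (\<rho> F)) \<partial>M) \<partial>lborel)"
  proof -
    have ind: "indicator {..1 / sqrt (1 + y\<^sup>2)} (\<rho> F) = (if \<rho> F \<le> 1 / sqrt (1 + y\<^sup>2) then 1 else 0 :: ennreal)" for y F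
      by (auto simp: indicator_def)
    show ?thesis
      unfolding M_def ind by (rule pr.Fubini'[symmetric]) (unfold M_def[symmetric], measurable)
  qed
  also have "\<dots> = (\<integral>\<^sup>+y. (ennreal c * (f (y / sqrt (1 + y\<^sup>2)) * ennreal ((1 - (y / sqrt (1 + y\<^sup>2))\<^sup>2) powr ((real m - 2) / 2))))
        * ennreal ((1 + y\<^sup>2) powr (-3/2)) \<partial>lborel)"
  proof (rule nn_integral_cong)
    fix y :: real
    define T where "T = 1 / sqrt (1 + y\<^sup>2)"
    have q: "1 + y\<^sup>2 > 0" by (simp add: add_pos_nonneg)
    then have T: "T > 0" by (simp add: T_def)
    have "(\<integral>\<^sup>+F. f (y / sqrt (1 + y\<^sup>2)) * (ennreal (\<rho> F) * indicator {..T} (\<rho> F)) \<partial>M)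
       = f (y / sqrt (1 + y\<^sup>2)) * (\<integral>\<^sup>+F. ennreal (\<rho> F) * indicator {..T} (\<rho> F) \<partial>M)"
      by (rule nn_integral_cmult) measurable
    also have "(\<integral>\<^sup>+F. ennreal (\<rho> F) * indicator {..T} (\<rho> F) \<partial>M) = ennreal (c * T ^ (m + 1))"
      unfolding M_def \<rho>_def c_def m_def by (rule nn_integral_radius_PiM[OF fin T A])
    \<comment> \<open>With s = y / sqrt (1 + y^2) one has 1 - s^2 = T^2. The power is split as T^(m
      - 2) T^3 so that T^3 = (1 + y^2)^(-3/2) is the derivative of s consumed by the next
      substitution.\<close>
    also have "T ^ (m + 1) = (1 - (y / sqrt (1 + y\<^sup>2))\<^sup>2) powr ((real m - 2) / 2) * (1 + y\<^sup>2) powr (-3/2)"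
    proof -
      have e: "1 - (y / sqrt (1 + y\<^sup>2))\<^sup>2 = (1 + y\<^sup>2) powr (-1)"
        using q by (simp add: power_divide powr_minus_divide field_simps)
      have "T = (1 + y\<^sup>2) powr (-1/2)"
        using q by (simp add: T_def powr_half_sqrt[symmetric] powr_minus_divide)
      then have "T ^ (m + 1) = ((1 + y\<^sup>2) powr (-1/2)) powr real (m + 1)"
        using T by (subst powr_realpow) auto
      also have "\<dots> = (1 + y\<^sup>2) powr (- (real m - 2) / 2 + (-3/2))"
        unfolding powr_powr by (rule arg_cong[where f="(powr) (1 + y\<^sup>2)"]) (simp add: field_simps)
      also have "\<dots> = (1 + y\<^sup>2) powr (- (real m - 2) / 2) * (1 + y\<^sup>2) powr (-3/2)"
        by (rule powr_add)
      also have "(1 + y\<^sup>2) powr (- (real m - 2) / 2) = ((1 + y\<^sup>2) powr (-1)) powr ((real m - 2) / 2)"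
        unfolding powr_powr by (simp add: field_simps)
      finally show ?thesis unfolding e .
    qed
    finally show "(\<integral>\<^sup>+F. f (y / sqrt (1 + y\<^sup>2)) * (ennreal (\<rho> F) * indicator {..1 / sqrt (1 + y\<^sup>2)} (\<rho> F)) \<partial>M)
      = (ennreal c * (f (y / sqrt (1 + y\<^sup>2)) * ennreal ((1 - (y / sqrt (1 + y\<^sup>2))\<^sup>2) powr ((real m - 2) / 2))))
        * ennreal ((1 + y\<^sup>2) powr (-3/2))"
      using c by (simp add: T_def ennreal_mult mult_ac)
  qed
  also have "\<dots> = (\<integral>\<^sup>+s. (ennreal c * (f s * ennreal ((1 - s\<^sup>2) powr ((real m - 2) / 2)))) * indicator {-1<..<1} s \<partial>lborel)"
    by (rule nn_integral_open_interval_substitution) measurable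
  also have "\<dots> = ennreal c * (\<integral>\<^sup>+s. f s * ennreal ((1 - s\<^sup>2) powr ((real m - 2) / 2)) * indicator {-1<..<1} s \<partial>lborel)"
    unfolding mult.assoc by (rule nn_integral_cmult) measurable
  finally show ?thesis unfolding c_def m_def .
qed

text \<open>A rotation takes \<xi> to a basis vector, and the remaining n - 1 coordinates form the
  set A of the product formula, nonempty because n \<ge> 2. The constant is left unspecified; where
  its value matters, it is recovered from the total mass 1.\<close>

lemma nn_integral_sphere_measure_zonal_ex:
  assumes n: "CARD('n) \<ge> 2"
  shows "\<exists>c>0. \<forall>f\<in>borel_measurable borel. \<forall>\<xi>\<in>sphere (0::real^'n) 1.
    (\<integral>\<^sup>+\<zeta>. f (\<zeta> \<bullet> \<xi>) \<partial>sphere_measure) = ennreal c *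
      (\<integral>\<^sup>+s. f s * ennreal ((1 - s\<^sup>2) powr ((real CARD('n) - 3) / 2)) * indicator {-1<..<1} s \<partial>lborel)"
proof -
  obtain e :: "real^'n" where e: "e \<in> Basis" using nonempty_Basis by blast
  define A where "A = Basis - {e}"
  have B: "Basis = insert e A" "e \<notin> A" "finite A" using e by (auto simp: A_def)
  have cardA: "card A = CARD('n) - 1" using e by (simp add: A_def)
  have A0: "A \<noteq> {}" using cardA n by auto
  have cardA': "real (card A) - 2 = real CARD('n) - 3" using n cardA by simp
  define c1 where "c1 = unit_ball_vol (card A) * card A / (card A + 1)"
  define V where "V = unit_ball_vol (real CARD('n))"
  have c1: "c1 > 0" using A0 B(3) by (simp add: c1_def card_gt_0_iff)
  have V: "V > 0" by (simp add: V_def)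
  have main: "(\<integral>\<^sup>+\<zeta>. f (\<zeta> \<bullet> \<xi>) \<partial>sphere_measure) = ennreal (c1 / V) *
      (\<integral>\<^sup>+s. f s * ennreal ((1 - s\<^sup>2) powr ((real CARD('n) - 3) / 2)) * indicator {-1<..<1} s \<partial>lborel)"
    if [measurable]: "f \<in> borel_measurable borel" and \<xi>: "\<xi> \<in> sphere (0::real^'n) 1" for f \<xi>
  proof -
    have "norm e = norm \<xi>" using e \<xi> by simp
    then obtain T where T: "orthogonal_transformation T" and Te: "T e = \<xi>"
      by (rule orthogonal_transformation_exists)
    have Tin: "T \<zeta> \<bullet> \<xi> = \<zeta> \<bullet> e" for \<zeta>
      using T unfolding Te[symmetric] by (simp add: orthogonal_transformation_def)
    have "(\<integral>\<^sup>+\<zeta>. f (\<zeta> \<bullet> \<xi>) \<partial>sphere_measure) = (\<integral>\<^sup>+\<zeta>. f (T \<zeta> \<bullet> \<xi>) \<partial>sphere_measure)"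
      by (rule nn_integral_sphere_measure_orthogonal[OF T, symmetric]) measurable
    also have "\<dots> = (\<integral>\<^sup>+\<zeta>. f (\<zeta> \<bullet> e) \<partial>sphere_measure)" unfolding Tin ..
    also have "\<dots> = (\<integral>\<^sup>+x. f (sgn x \<bullet> e) * indicator (ball 0 1) x \<partial>lborel) / emeasure lborel (ball 0 1 :: (real^'n) set)"
      by (rule nn_integral_sphere_measure) measurable
    also have "emeasure lborel (ball 0 1 :: (real^'n) set) = ennreal V"
      by (simp add: emeasure_ball V_def)
    also have "(\<integral>\<^sup>+x. f (sgn x \<bullet> e) * indicator (ball 0 1) x \<partial>lborel)
       = (\<integral>\<^sup>+x. f ((x \<bullet> e) / norm x) * indicator {..1} (norm x) \<partial>lborel)"
    proof (rule nn_integral_cong_AE)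
      have "sphere (0::real^'n) 1 \<in> null_sets lborel"
        using negligible_sphere[of "0::real^'n" 1]
        by (simp add: negligible_iff_null_sets null_sets_completion_iff)
      then have "AE x in lborel. x \<notin> sphere (0::real^'n) 1" by (rule AE_not_in)
      then show "AE x in lborel. f (sgn x \<bullet> e) * indicator (ball 0 1) x = f ((x \<bullet> e) / norm (x::real^'n)) * indicator {..1} (norm x)"
        by eventually_elim (auto simp: indicator_def sgn_div_norm divide_inverse mult.commute)
    qed
    also have "\<dots> = (\<integral>\<^sup>+F. f (((\<Sum>b\<in>Basis. F b *\<^sub>R b) \<bullet> e) / norm (\<Sum>b\<in>Basis. F b *\<^sub>R b :: real^'n)) *
         indicator {..1} (norm (\<Sum>b\<in>Basis. F b *\<^sub>R b :: real^'n)) \<partial>Pi\<^sub>M Basis (\<lambda>_. lborel))"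
      by (subst lborel_eq) (subst nn_integral_distr, auto)
    also have "\<dots> = (\<integral>\<^sup>+F. f (F e / sqrt (\<Sum>j\<in>Basis. (F j)\<^sup>2)) * indicator {..1} (sqrt (\<Sum>j\<in>Basis. (F j)\<^sup>2))
        \<partial>Pi\<^sub>M (Basis :: (real^'n) set) (\<lambda>_. lborel))"
    proof (rule nn_integral_cong)
      fix F :: "real^'n \<Rightarrow> real"
      define x where "x = (\<Sum>b\<in>Basis. F b *\<^sub>R b)"
      have co: "x \<bullet> b = F b" if "b \<in> Basis" for b
        using that by (simp add: x_def inner_sum_left_Basis)
      have "norm x = sqrt (\<Sum>j\<in>Basis. (F j)\<^sup>2)"
        unfolding norm_eq_sqrt_inner euclidean_inner[of x x] using co
        by (simp add: power2_eq_square cong: sum.cong)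
      then show "f (((\<Sum>b\<in>Basis. F b *\<^sub>R b) \<bullet> e) / norm (\<Sum>b\<in>Basis. F b *\<^sub>R b)) * indicator {..1} (norm (\<Sum>b\<in>Basis. F b *\<^sub>R b))
        = f (F e / sqrt (\<Sum>j\<in>Basis. (F j)\<^sup>2)) * indicator {..1} (sqrt (\<Sum>j\<in>Basis. (F j)\<^sup>2))"
        unfolding x_def[symmetric] using co[OF e] by simp
    qed
    also have "\<dots> = ennreal c1 * (\<integral>\<^sup>+s. f s * ennreal ((1 - s\<^sup>2) powr ((real CARD('n) - 3) / 2)) * indicator {-1<..<1} s \<partial>lborel)"
      unfolding B(1) c1_def cardA'[symmetric] by (rule nn_integral_zonal_PiM) (use B A0 in auto)
    also have "\<dots> / ennreal V = (ennreal c1 / ennreal V) * (\<integral>\<^sup>+s. f s * ennreal ((1 - s\<^sup>2) powr ((real CARD('n) - 3) / 2)) * indicator {-1<..<1} s \<partial>lborel)"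
      by (simp add: divide_ennreal_def mult_ac)
    also have "ennreal c1 / ennreal V = ennreal (c1 / V)"
      using c1 V by (simp add: divide_ennreal)
    finally show ?thesis .
  qed
  show ?thesis
    by (rule exI[of _ "c1 / V"]) (use c1 V main in auto)
qed

section \<open>Distribution of the chord length\<close>

lemma powr_bounded_on_interval:
  fixes w :: real
  assumes "3/4 \<le> w" "w \<le> 1" "e \<ge> -1/2"
  shows "w powr e \<le> 2" "min 1 ((3/4) powr e) \<le> w powr e"
proof -
  show "w powr e \<le> 2"
  proof (cases "e \<ge> 0")
    case True
    then have "w powr e \<le> 1 powr e" using assms by (intro powr_mono2) auto
    then show ?thesis by simp
  next
    case False
    have "w powr e \<le> w powr (-1)" 
      using assms False by (intro powr_mono') auto
    also have "\<dots> \<le> 2" using assms by (simp add: powr_minus_divide field_simps)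
    finally show ?thesis .
  qed
  show "min 1 ((3/4) powr e) \<le> w powr e"
  proof (cases "e \<ge> 0")
    case True
    have "(3/4) powr e \<le> w powr e" using assms True by (intro powr_mono2) auto
    then show ?thesis by (simp add: min_def)
  next
    case False
    have "1 powr e \<le> w powr e" using assms False by (intro powr_mono2') auto
    then show ?thesis by (simp add: min_def)
  qed
qed

lemma norm_diff_sphere:
  fixes \<xi> \<zeta> :: "'a::real_inner"
  assumes "norm \<xi> = 1" "norm \<zeta> = 1"
  shows "norm (\<zeta> - \<xi>) = sqrt (2 - 2 * (\<zeta> \<bullet> \<xi>))"
    and "norm (r *\<^sub>R \<xi> - \<zeta>) = sqrt (1 + r\<^sup>2 - 2 * r * (\<zeta> \<bullet> \<xi>))"
proof -
  have i: "\<xi> \<bullet> \<xi> = 1" "\<zeta> \<bullet> \<zeta> = 1" using assms by (simp_all add: dot_square_norm)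
  show "norm (\<zeta> - \<xi>) = sqrt (2 - 2 * (\<zeta> \<bullet> \<xi>))"
    unfolding norm_eq_sqrt_inner using i by (simp add: inner_diff inner_commute)
  show "norm (r *\<^sub>R \<xi> - \<zeta>) = sqrt (1 + r\<^sup>2 - 2 * r * (\<zeta> \<bullet> \<xi>))"
    unfolding norm_eq_sqrt_inner using i by (simp add: inner_diff inner_commute power2_eq_square algebra_simps)
qed

text \<open>The zonal formula under t^2 = 2 - 2 s. The sign of s is reversed first, so that the
  substituted function t^2/2 - 1 is increasing. From 1 - s^2 = t^2 (1 - t^2/4) and the Jacobian t,
  the power of t is 2 e + 1 = n - 2.\<close>

lemma nn_integral_sphere_measure_chord_ex:
  assumes n: "CARD('n) \<ge> 2"
  shows "\<exists>c>0. \<forall>f\<in>borel_measurable borel. \<forall>\<xi>\<in>sphere (0::real^'n) 1.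
    (\<integral>\<^sup>+\<zeta>. f (norm (\<zeta> - \<xi>)) \<partial>sphere_measure) = ennreal c *
      (\<integral>\<^sup>+t. f t * ennreal (t powr (real CARD('n) - 2) * (1 - t\<^sup>2 / 4) powr ((real CARD('n) - 3) / 2))
          * indicator {0..2} t \<partial>lborel)"
proof -
  define e where "e = (real CARD('n) - 3) / 2"
  obtain c where c: "c > 0" and z: "\<And>f \<xi>. f \<in> borel_measurable borel \<Longrightarrow> \<xi> \<in> sphere (0::real^'n) 1 \<Longrightarrow>
    (\<integral>\<^sup>+\<zeta>. f (\<zeta> \<bullet> \<xi>) \<partial>sphere_measure) = ennreal c *
      (\<integral>\<^sup>+s. f s * ennreal ((1 - s\<^sup>2) powr e) * indicator {-1<..<1} s \<partial>lborel)"
    using nn_integral_sphere_measure_zonal_ex[OF n] unfolding e_def by blast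
  have "(\<integral>\<^sup>+\<zeta>. f (norm (\<zeta> - \<xi>)) \<partial>sphere_measure) = ennreal c *
      (\<integral>\<^sup>+t. f t * ennreal (t powr (real CARD('n) - 2) * (1 - t\<^sup>2 / 4) powr e) * indicator {0..2} t \<partial>lborel)"
    if [measurable]: "f \<in> borel_measurable borel" and \<xi>: "\<xi> \<in> sphere (0::real^'n) 1" for f \<xi>
  proof -
    have "(\<integral>\<^sup>+\<zeta>. f (norm (\<zeta> - \<xi>)) \<partial>sphere_measure) = (\<integral>\<^sup>+\<zeta>. f (sqrt (2 - 2 * (\<zeta> \<bullet> \<xi>))) \<partial>sphere_measure)"
      using \<xi> by (intro nn_integral_cong) (simp add: norm_diff_sphere)
    also have "\<dots> = ennreal c * (\<integral>\<^sup>+s. f (sqrt (2 - 2 * s)) * ennreal ((1 - s\<^sup>2) powr e) * indicator {-1<..<1} s \<partial>lborel)"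
      by (rule z[OF _ \<xi>]) measurable
    also have "(\<integral>\<^sup>+s. f (sqrt (2 - 2 * s)) * ennreal ((1 - s\<^sup>2) powr e) * indicator {-1<..<1} s \<partial>lborel)
       = ennreal \<bar>-1\<bar> * (\<integral>\<^sup>+s. f (sqrt (2 - 2 * (0 + -1 * s))) * ennreal ((1 - (0 + -1 * s)\<^sup>2) powr e) * indicator {-1<..<1} (0 + -1 * s) \<partial>lborel)"
      by (rule nn_integral_real_affine) auto
    also have "\<dots> = (\<integral>\<^sup>+s. (f (sqrt (2 + 2 * s)) * ennreal ((1 - s\<^sup>2) powr e)) * indicator {0\<^sup>2/2 - 1..2\<^sup>2/2 - 1} s \<partial>lborel)"
    proof -
      \<comment> \<open>At the endpoints the weight is \<open>0 powr e\<close>, which is 0 whatever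
        the sign of e; so the open interval may be replaced by the closed one.\<close>
      have "f (sqrt (2 + 2 * s)) * ennreal ((1 - s\<^sup>2) powr e) * indicator {-1<..<1} (- s)
         = (f (sqrt (2 + 2 * s)) * ennreal ((1 - s\<^sup>2) powr e)) * indicator {0\<^sup>2/2 - 1..2\<^sup>2/2 - 1} s" for s :: real
        by (cases "s = 1 \<or> s = -1") (auto simp: indicator_def)
      then show ?thesis by simp
    qed
    also have "\<dots> = (\<integral>\<^sup>+t. (f (sqrt (2 + 2 * (t\<^sup>2/2 - 1))) * ennreal ((1 - (t\<^sup>2/2 - 1)\<^sup>2) powr e)) * ennreal t * indicator {0..2} t \<partial>lborel)"
      by (rule nn_integral_substitution_aux) (auto intro!: derivative_eq_intros continuous_intros)
    also have "\<dots> = (\<integral>\<^sup>+t. f t * ennreal (t powr (real CARD('n) - 2) * (1 - t\<^sup>2 / 4) powr e) * indicator {0..2} t \<partial>lborel)"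
    proof (rule nn_integral_cong)
      fix t :: real
      consider "t \<in> {0<..2}" | "t = 0" | "t \<notin> {0..2}" by fastforce
      then show "(f (sqrt (2 + 2 * (t\<^sup>2/2 - 1))) * ennreal ((1 - (t\<^sup>2/2 - 1)\<^sup>2) powr e)) * ennreal t * indicator {0..2} t
        = f t * ennreal (t powr (real CARD('n) - 2) * (1 - t\<^sup>2 / 4) powr e) * indicator {0..2} t"
      proof cases
        case 1
        then have "t\<^sup>2 \<le> 2\<^sup>2" by (intro power_mono) auto
        then have p: "1 - t\<^sup>2/4 \<ge> 0" by simp
        have eq: "1 - (t\<^sup>2/2 - 1)\<^sup>2 = t\<^sup>2 * (1 - t\<^sup>2/4)"
          by (simp add: power2_eq_square field_simps)
        have "(1 - (t\<^sup>2/2 - 1)\<^sup>2) powr e * t = (t powr 2) powr e * (1 - t\<^sup>2/4) powr e * t powr 1"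
          unfolding eq using 1 p by (simp add: powr_mult)
        also have "\<dots> = t powr (2 * e + 1) * (1 - t\<^sup>2/4) powr e"
          unfolding powr_powr powr_add by simp
        also have "2 * e + 1 = real CARD('n) - 2" by (simp add: e_def field_simps)
        finally have "ennreal ((1 - (t\<^sup>2/2 - 1)\<^sup>2) powr e) * ennreal t = ennreal (t powr (real CARD('n) - 2) * (1 - t\<^sup>2/4) powr e)"
          using 1 by (simp flip: ennreal_mult)
        moreover have "sqrt (2 + 2 * (t\<^sup>2/2 - 1)) = t" using 1 by simp
        ultimately show ?thesis by (simp add: mult.assoc)
      qed auto
    qed
    finally show ?thesis .
  qed
  then show ?thesis using c unfolding e_def by blast
qed

text \<open>On [0, 1] the factor 1 - t^2/4 stays in [3/4, 1] and its exponent is at least -1/2, so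
  the density is comparable to t^(n-2). Near the antipode t = 2 the density is unbounded for n = 2;
  there f is bounded by M instead, and the total mass 1 is used.\<close>

lemma nn_integral_sphere_measure_chord_bounds:
  assumes n: "CARD('n) \<ge> 2"
  shows "\<exists>k>0. \<exists>K>0. \<forall>f\<in>borel_measurable borel. \<forall>\<xi>\<in>sphere (0::real^'n) 1.
     ennreal k * (\<integral>\<^sup>+t. f t * ennreal (t powr (real CARD('n) - 2)) * indicator {0..1} t \<partial>lborel)
       \<le> (\<integral>\<^sup>+\<zeta>. f (norm (\<zeta> - \<xi>)) \<partial>sphere_measure) \<and>
     (\<forall>M. (\<forall>t\<in>{1..2}. f t \<le> M) \<longrightarrow> (\<integral>\<^sup>+\<zeta>. f (norm (\<zeta> - \<xi>)) \<partial>sphere_measure)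
       \<le> ennreal K * (\<integral>\<^sup>+t. f t * ennreal (t powr (real CARD('n) - 2)) * indicator {0..1} t \<partial>lborel) + M)"
proof -
  interpret prob_space "sphere_measure :: (real^'n) measure" by (rule prob_space_sphere_measure)
  define e where "e = (real CARD('n) - 3) / 2"
  have e: "e \<ge> -1/2" using n by (simp add: e_def)
  obtain c where c: "c > 0" and z: "\<And>f \<xi>. f \<in> borel_measurable borel \<Longrightarrow> \<xi> \<in> sphere (0::real^'n) 1 \<Longrightarrow>
    (\<integral>\<^sup>+\<zeta>. f (norm (\<zeta> - \<xi>)) \<partial>sphere_measure) = ennreal c *
      (\<integral>\<^sup>+t. f t * ennreal (t powr (real CARD('n) - 2) * (1 - t\<^sup>2 / 4) powr e) * indicator {0..2} t \<partial>lborel)"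
    using nn_integral_sphere_measure_chord_ex[OF n] unfolding e_def by blast
  define m where "m = min 1 ((3/4) powr e :: real)"
  have m: "m > 0" by (simp add: m_def)
  have w: "3/4 \<le> 1 - t\<^sup>2/4" "1 - t\<^sup>2/4 \<le> 1" if "0 \<le> t" "t \<le> 1" for t :: real
  proof -
    have "t\<^sup>2 \<le> 1" using that by (simp add: power_le_one)
    then show "3/4 \<le> 1 - t\<^sup>2/4" "1 - t\<^sup>2/4 \<le> 1" by simp_all
  qed
  have lower: "ennreal (c * m) * (\<integral>\<^sup>+t. f t * ennreal (t powr (real CARD('n) - 2)) * indicator {0..1} t \<partial>lborel)
       \<le> (\<integral>\<^sup>+\<zeta>. f (norm (\<zeta> - \<xi>)) \<partial>sphere_measure)"
    if [measurable]: "f \<in> borel_measurable borel" and \<xi>: "\<xi> \<in> sphere (0::real^'n) 1" for f \<xi>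
  proof -
    have "ennreal (c * m) * (\<integral>\<^sup>+t. f t * ennreal (t powr (real CARD('n) - 2)) * indicator {0..1} t \<partial>lborel)
       = ennreal c * (\<integral>\<^sup>+t. ennreal m * (f t * ennreal (t powr (real CARD('n) - 2)) * indicator {0..1} t) \<partial>lborel)"
      using c m by (simp add: ennreal_mult nn_integral_cmult mult.assoc)
    also have "\<dots> \<le> ennreal c * (\<integral>\<^sup>+t. f t * ennreal (t powr (real CARD('n) - 2) * (1 - t\<^sup>2 / 4) powr e) * indicator {0..2} t \<partial>lborel)"
    proof (intro mult_left_mono nn_integral_mono)
      fix t :: real
      show "ennreal m * (f t * ennreal (t powr (real CARD('n) - 2)) * indicator {0..1} t)
         \<le> f t * ennreal (t powr (real CARD('n) - 2) * (1 - t\<^sup>2 / 4) powr e) * indicator {0..2} t"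
      proof (cases "t \<in> {0..1}")
        case True
        then have "m \<le> (1 - t\<^sup>2/4) powr e"
          unfolding m_def by (intro powr_bounded_on_interval w e) auto
        then have "m * t powr (real CARD('n) - 2) \<le> t powr (real CARD('n) - 2) * (1 - t\<^sup>2 / 4) powr e"
          by (subst mult.commute) (intro mult_left_mono, auto)
        then have "ennreal m * ennreal (t powr (real CARD('n) - 2)) \<le> ennreal (t powr (real CARD('n) - 2) * (1 - t\<^sup>2 / 4) powr e)"
          using m by (subst ennreal_mult[symmetric]) (auto intro: ennreal_leI)
        then have "f t * (ennreal m * ennreal (t powr (real CARD('n) - 2))) \<le> f t * ennreal (t powr (real CARD('n) - 2) * (1 - t\<^sup>2 / 4) powr e)"
          by (rule mult_left_mono) simp
        then show ?thesis using True by (simp add: mult_ac)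
      qed auto
    qed simp
    finally show ?thesis using z[OF that] by simp
  qed
  have upper: "(\<integral>\<^sup>+\<zeta>. f (norm (\<zeta> - \<xi>)) \<partial>sphere_measure)
       \<le> ennreal (c * 2) * (\<integral>\<^sup>+t. f t * ennreal (t powr (real CARD('n) - 2)) * indicator {0..1} t \<partial>lborel) + M"
    if [measurable]: "f \<in> borel_measurable borel" and \<xi>: "\<xi> \<in> sphere (0::real^'n) 1" and M: "\<forall>t\<in>{1..2}. f t \<le> M" for f \<xi> M
  proof -
    define f1 where "f1 t = f t * indicator {0..1} t" for t
    have [measurable]: "f1 \<in> borel_measurable borel" unfolding f1_def by measurable
    have "(\<integral>\<^sup>+\<zeta>. f (norm (\<zeta> - \<xi>)) \<partial>sphere_measure) \<le> (\<integral>\<^sup>+\<zeta>. f1 (norm (\<zeta> - \<xi>)) + M \<partial>sphere_measure)"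
    proof (rule nn_integral_mono)
      fix \<zeta> :: "real^'n" assume "\<zeta> \<in> space sphere_measure"
      then have "norm (\<zeta> - \<xi>) \<le> 2" using \<xi> norm_triangle_ineq4[of \<zeta> \<xi>] by simp
      then show "f (norm (\<zeta> - \<xi>)) \<le> f1 (norm (\<zeta> - \<xi>)) + M"
        using M by (cases "norm (\<zeta> - \<xi>) \<le> 1") (auto simp: f1_def)
    qed
    also have "\<dots> = (\<integral>\<^sup>+\<zeta>. f1 (norm (\<zeta> - \<xi>)) \<partial>sphere_measure) + M"
      using emeasure_space_1 by (subst nn_integral_add) auto
    also have "(\<integral>\<^sup>+\<zeta>. f1 (norm (\<zeta> - \<xi>)) \<partial>sphere_measure) = ennreal c *
      (\<integral>\<^sup>+t. f1 t * ennreal (t powr (real CARD('n) - 2) * (1 - t\<^sup>2 / 4) powr e) * indicator {0..2} t \<partial>lborel)"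
      by (rule z[OF _ \<xi>]) measurable
    also have "\<dots> \<le> ennreal c * (\<integral>\<^sup>+t. ennreal 2 * (f t * ennreal (t powr (real CARD('n) - 2)) * indicator {0..1} t) \<partial>lborel)"
    proof (intro mult_left_mono nn_integral_mono)
      fix t :: real
      show "f1 t * ennreal (t powr (real CARD('n) - 2) * (1 - t\<^sup>2 / 4) powr e) * indicator {0..2} t
         \<le> ennreal 2 * (f t * ennreal (t powr (real CARD('n) - 2)) * indicator {0..1} t)"
      proof (cases "t \<in> {0..1}")
        case True
        then have "(1 - t\<^sup>2/4) powr e \<le> 2"
          by (intro powr_bounded_on_interval w e) auto
        then have "t powr (real CARD('n) - 2) * (1 - t\<^sup>2 / 4) powr e \<le> t powr (real CARD('n) - 2) * 2"
          by (intro mult_left_mono, auto)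
        then have "ennreal (t powr (real CARD('n) - 2) * (1 - t\<^sup>2 / 4) powr e) \<le> ennreal 2 * ennreal (t powr (real CARD('n) - 2))"
          by (subst ennreal_mult[symmetric]) (auto intro!: ennreal_leI simp: mult.commute)
        then have "f t * ennreal (t powr (real CARD('n) - 2) * (1 - t\<^sup>2 / 4) powr e) \<le> f t * (ennreal 2 * ennreal (t powr (real CARD('n) - 2)))"
          by (rule mult_left_mono) simp
        then show ?thesis using True by (simp add: mult_ac f1_def)
      qed (auto simp: f1_def)
    qed simp
    also have "\<dots> = ennreal (c * 2) * (\<integral>\<^sup>+t. f t * ennreal (t powr (real CARD('n) - 2)) * indicator {0..1} t \<partial>lborel)"
      using c by (simp add: ennreal_mult nn_integral_cmult mult.assoc)
    finally show ?thesis by (simp add: add_right_mono)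
  qed
  show ?thesis
    by (rule exI[of _ "c * m"], rule conjI, use c m in simp, rule exI[of _ "c * 2"], rule conjI, use c in simp)
       (intro ballI conjI lower allI impI upper; blast)
qed

section \<open>Beta integrals and the normalizing constant\<close>

lemma nn_integral_powr_chord_density:
  fixes \<beta> b :: real
  assumes \<beta>: "\<beta> > -1" and b: "b > 0"
  shows "(\<integral>\<^sup>+t. ennreal (t powr \<beta> * (1 - t\<^sup>2 / 4) powr (b - 1)) * indicator {0..2} t \<partial>lborel)
    = ennreal (2 powr \<beta> * Beta ((1 + \<beta>) / 2) b)"
proof -
  define a where "a = (1 + \<beta>) / 2"
  have a: "a > 0" using \<beta> by (simp add: a_def)
  have "ennreal (Beta a b) = (\<integral>\<^sup>+u. ennreal (u powr (a - 1) * (1 - u) powr (b - 1)) * indicator {0..1} u \<partial>lborel)"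
    by (rule nn_integral_has_integral_lebesgue'[symmetric]) (use has_integral_Beta_real[OF a b] in auto)
  also have "\<dots> = (\<integral>\<^sup>+u. ennreal (u powr (a - 1) * (1 - u) powr (b - 1)) * indicator {0\<^sup>2/4..2\<^sup>2/4} u \<partial>lborel)"
    by simp
  also have "\<dots> = (\<integral>\<^sup>+t. ennreal ((t\<^sup>2/4) powr (a - 1) * (1 - t\<^sup>2/4) powr (b - 1)) * ennreal (t/2) * indicator {0..2} t \<partial>lborel)"
    by (rule nn_integral_substitution_aux) (auto intro!: derivative_eq_intros continuous_intros)
  also have "\<dots> = (\<integral>\<^sup>+t. ennreal (2 powr (-\<beta>)) * (ennreal (t powr \<beta> * (1 - t\<^sup>2 / 4) powr (b - 1)) * indicator {0..2} t) \<partial>lborel)"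
  proof (rule nn_integral_cong)
    fix t :: real
    consider "t \<in> {0<..2}" | "t = 0" | "t \<notin> {0..2}" by fastforce
    then show "ennreal ((t\<^sup>2/4) powr (a - 1) * (1 - t\<^sup>2/4) powr (b - 1)) * ennreal (t/2) * indicator {0..2} t
      = ennreal (2 powr (-\<beta>)) * (ennreal (t powr \<beta> * (1 - t\<^sup>2 / 4) powr (b - 1)) * indicator {0..2} t)"
    proof cases
      case 1
      have "t\<^sup>2/4 = (t/2) powr 2" using 1 by (simp add: power_divide)
      then have "(t\<^sup>2/4) powr (a - 1) * (t/2) = (t/2) powr (2 * (a - 1)) * (t/2) powr 1"
        using 1 by (simp only: powr_powr) simp
      also have "\<dots> = (t/2) powr \<beta>"
        unfolding powr_add[symmetric] by (simp add: a_def field_simps)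
      also have "\<dots> = 2 powr (-\<beta>) * t powr \<beta>" 
        using 1 by (simp add: powr_divide powr_minus field_simps)
      finally have "(t\<^sup>2/4) powr (a - 1) * (t/2) * (1 - t\<^sup>2/4) powr (b - 1) = 2 powr (-\<beta>) * t powr \<beta> * (1 - t\<^sup>2/4) powr (b - 1)"
        by (rule arg_cong)
      then have "((t\<^sup>2/4) powr (a - 1) * (1 - t\<^sup>2/4) powr (b - 1)) * (t/2) = 2 powr (-\<beta>) * (t powr \<beta> * (1 - t\<^sup>2/4) powr (b - 1))"
        by (simp only: mult_ac)
      then have "ennreal ((t\<^sup>2/4) powr (a - 1) * (1 - t\<^sup>2/4) powr (b - 1)) * ennreal (t/2) = ennreal (2 powr (-\<beta>)) * ennreal (t powr \<beta> * (1 - t\<^sup>2/4) powr (b - 1))"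
        using 1 by (simp flip: ennreal_mult)
      then show ?thesis by (simp add: mult.assoc)
    qed auto
  qed
  also have "\<dots> = ennreal (2 powr (-\<beta>)) * (\<integral>\<^sup>+t. (ennreal (t powr \<beta> * (1 - t\<^sup>2 / 4) powr (b - 1)) * indicator {0..2} t) \<partial>lborel)"
    by (rule nn_integral_cmult) measurable
  finally have "ennreal (2 powr \<beta>) * ennreal (Beta a b) = ennreal (2 powr \<beta>) * (ennreal (2 powr (-\<beta>)) * (\<integral>\<^sup>+t. (ennreal (t powr \<beta> * (1 - t\<^sup>2 / 4) powr (b - 1)) * indicator {0..2} t) \<partial>lborel))"
    by simp
  also have "\<dots> = (\<integral>\<^sup>+t. (ennreal (t powr \<beta> * (1 - t\<^sup>2 / 4) powr (b - 1)) * indicator {0..2} t) \<partial>lborel)"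
    by (simp add: mult.assoc[symmetric] powr_minus flip: ennreal_mult)
  finally show ?thesis by (simp add: a_def ennreal_mult')
qed

lemma Gamma_legendre_duplication_real:
  fixes x :: real
  assumes "x > 0"
  shows "Gamma x * Gamma (x + 1/2) = 2 powr (1 - 2 * x) * sqrt pi * Gamma (2 * x)"
proof -
  have nz: "complex_of_real x \<notin> \<int>\<^sub>\<le>\<^sub>0" "complex_of_real x + 1/2 \<notin> \<int>\<^sub>\<le>\<^sub>0"
  proof -
    show "complex_of_real x \<notin> \<int>\<^sub>\<le>\<^sub>0"
      using assms by (auto elim!: nonpos_Ints_cases simp: complex_eq_iff)
    show "complex_of_real x + 1/2 \<notin> \<int>\<^sub>\<le>\<^sub>0"
      using assms by (auto elim!: nonpos_Ints_cases simp: complex_eq_iff)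
  qed
  have "complex_of_real (Gamma x * Gamma (x + 1/2)) = Gamma (complex_of_real x) * Gamma (complex_of_real x + 1/2)"
    by (simp flip: Gamma_complex_of_real)
  also have "\<dots> = exp ((1 - 2 * complex_of_real x) * of_real (ln 2)) * of_real (sqrt pi) * Gamma (2 * complex_of_real x)"
    by (rule Gamma_legendre_duplication[OF nz])
  also have "\<dots> = complex_of_real (exp ((1 - 2 * x) * ln 2) * sqrt pi * Gamma (2 * x))"
    by (simp flip: Gamma_complex_of_real exp_of_real)
  finally have "Gamma x * Gamma (x + 1/2) = exp ((1 - 2 * x) * ln 2) * sqrt pi * Gamma (2 * x)"
    by (rule of_real_eq_iff[THEN iffD1])
  then show ?thesis by (simp add: powr_def)
qed

lemma poisson_const_pos:
  assumes "\<alpha> > -1" "n \<ge> 2"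
  shows "poisson_const n \<alpha> > 0"
  using assms unfolding poisson_const_def
  by (intro divide_pos_pos mult_pos_pos Gamma_real_pos) auto

text \<open>The two Beta terms are, up to the common density constant, the moments of
  t^(2+\<alpha>-n) and of 1 under the chord distribution, so that the kernel constant is the inverse
  of a moment. Duplication at (1+\<alpha>)/2 and at (n-1)/2 reduces both sides to sqrt pi a /
  b.\<close>

lemma poisson_const_Beta:
  fixes \<alpha> :: real
  assumes \<alpha>: "\<alpha> > -1" and n: "n \<ge> 2"
  shows "poisson_const n \<alpha> * (2 powr \<alpha> * Beta ((1 + \<alpha>) / 2) ((real n - 1) / 2))
    = 2 powr (real n - 2) * Beta ((real n - 1) / 2) ((real n - 1) / 2)"
proof -
  define a where "a = Gamma ((real n - 1) / 2)"
  define b where "b = Gamma (real n / 2)"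
  define g where "g = Gamma (1 + \<alpha>)"
  define d where "d = Gamma (real n - 1)"
  define u where "u = Gamma ((1 + \<alpha>) / 2)"
  define v where "v = Gamma (1 + \<alpha> / 2)"
  define w where "w = Gamma ((real n + \<alpha>) / 2)"
  have pos: "a > 0" "b > 0" "g > 0" "d > 0" "u > 0" "v > 0" "w > 0"
    unfolding a_def b_def g_def d_def u_def v_def w_def using \<alpha> n by (auto intro!: Gamma_real_pos)
  have d1: "u * v = 2 powr (- \<alpha>) * sqrt pi * g"
    using Gamma_legendre_duplication_real[of "(1 + \<alpha>) / 2"] \<alpha>
    by (simp add: u_def v_def g_def add_divide_distrib add.commute add.assoc)
  have d2: "a * b = 2 powr (2 - real n) * sqrt pi * d"
    using Gamma_legendre_duplication_real[of "(real n - 1) / 2"] n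
    by (simp add: a_def b_def d_def diff_divide_distrib)
  have B1: "Beta ((1 + \<alpha>) / 2) ((real n - 1) / 2) = u * a / w"
    by (simp add: Beta_def u_def a_def w_def add_divide_distrib[symmetric] add.commute)
  have B2: "Beta ((real n - 1) / 2) ((real n - 1) / 2) = a * a / d"
    by (simp add: Beta_def a_def d_def)
  have "poisson_const n \<alpha> = w * v / (b * g)"
    by (simp add: poisson_const_def w_def v_def b_def g_def)
  then have "poisson_const n \<alpha> * (2 powr \<alpha> * Beta ((1 + \<alpha>) / 2) ((real n - 1) / 2)) = 2 powr \<alpha> * (u * v) * a / (b * g)"
    unfolding B1 using pos by (simp add: field_simps)
  also have "\<dots> = sqrt pi * a / b"
    unfolding d1 using pos by (simp add: powr_minus field_simps)
  also have "\<dots> = 2 powr (real n - 2) * (2 powr (2 - real n) * sqrt pi * d) * a / (b * d)"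
  proof -
    have "2 powr (real n - 2) * 2 powr (2 - real n) = (1::real)" by (simp flip: powr_add)
    then show ?thesis using pos by (simp add: field_simps)
  qed
  also have "\<dots> = 2 powr (real n - 2) * (a * a / d)"
    unfolding d2[symmetric] using pos by (simp add: field_simps)
  finally show ?thesis unfolding B2 .
qed

text \<open>The source of the boundary value 1 of P[1]. The exponent 2 + \<alpha> - n is the one
  that chord reflection leaves on the sphere; together with the density t^(n-2) it gives t^\<alpha>,
  integrable because \<alpha> > -1.\<close>

lemma nn_integral_chord_powr:
  assumes n: "CARD('n) \<ge> 2" and \<alpha>: "\<alpha> > -1" and \<xi>: "\<xi> \<in> sphere (0::real^'n) 1"
  shows "(\<integral>\<^sup>+\<zeta>. ennreal (norm (\<zeta> - \<xi>) powr (2 + \<alpha> - real CARD('n))) \<partial>sphere_measure)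
    = ennreal (1 / poisson_const CARD('n) \<alpha>)"
proof -
  interpret prob_space "sphere_measure :: (real^'n) measure" by (rule prob_space_sphere_measure)
  define N where "N = real CARD('n)"
  have N: "N \<ge> 2" using n by (simp add: N_def)
  have e: "(N - 3) / 2 = (N - 1) / 2 - 1" by (simp add: field_simps)
  obtain c where c: "c > 0" and z: "\<And>f. f \<in> borel_measurable borel \<Longrightarrow>
    (\<integral>\<^sup>+\<zeta>. f (norm (\<zeta> - \<xi>)) \<partial>sphere_measure) = ennreal c *
      (\<integral>\<^sup>+t. f t * ennreal (t powr (N - 2) * (1 - t\<^sup>2 / 4) powr ((N - 1) / 2 - 1)) * indicator {0..2} t \<partial>lborel)"
    using nn_integral_sphere_measure_chord_ex[OF n] \<xi> unfolding N_def[symmetric] e by blast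
  \<comment> \<open>The formula for the constant function 1 determines the unknown density constant
    c.\<close>
  have "1 = (\<integral>\<^sup>+\<zeta>. 1 \<partial>(sphere_measure :: (real^'n) measure))"
    using emeasure_space_1 by simp
  also have "\<dots> = ennreal c * ennreal (2 powr (N - 2) * Beta ((N - 1) / 2) ((N - 1) / 2))"
    using z[of "\<lambda>_. 1"] nn_integral_powr_chord_density[of "N - 2" "(N - 1) / 2"] N by simp
  finally have "ennreal (c * (2 powr (N - 2) * Beta ((N - 1) / 2) ((N - 1) / 2))) = 1"
    using c by (simp add: ennreal_mult')
  then have c1: "c * (2 powr (N - 2) * Beta ((N - 1) / 2) ((N - 1) / 2)) = 1"
    by (rule ennreal_eq_1[THEN iffD1])
  have "(\<integral>\<^sup>+\<zeta>. ennreal (norm (\<zeta> - \<xi>) powr (2 + \<alpha> - N)) \<partial>sphere_measure) = ennreal c *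
     (\<integral>\<^sup>+t. ennreal (t powr (2 + \<alpha> - N)) * ennreal (t powr (N - 2) * (1 - t\<^sup>2 / 4) powr ((N - 1) / 2 - 1)) * indicator {0..2} t \<partial>lborel)"
    by (rule z) measurable
  also have "\<dots> = ennreal c * (\<integral>\<^sup>+t. ennreal (t powr \<alpha> * (1 - t\<^sup>2 / 4) powr ((N - 1) / 2 - 1)) * indicator {0..2} t \<partial>lborel)"
  proof -
    have "ennreal (t powr (2 + \<alpha> - N)) * ennreal (t powr (N - 2) * (1 - t\<^sup>2 / 4) powr ((N - 1) / 2 - 1))
       = ennreal (t powr \<alpha> * (1 - t\<^sup>2 / 4) powr ((N - 1) / 2 - 1))" for t :: real
    proof -
      have "t powr (2 + \<alpha> - N) * t powr (N - 2) = t powr \<alpha>" by (simp flip: powr_add)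
      then show ?thesis by (simp add: mult.assoc[symmetric] flip: ennreal_mult)
    qed
    then show ?thesis by simp
  qed
  also have "\<dots> = ennreal c * ennreal (2 powr \<alpha> * Beta ((1 + \<alpha>) / 2) ((N - 1) / 2))"
    using nn_integral_powr_chord_density[of \<alpha> "(N - 1) / 2"] \<alpha> N by simp
  also have "\<dots> = ennreal (c * (2 powr \<alpha> * Beta ((1 + \<alpha>) / 2) ((N - 1) / 2)))"
    using c by (simp add: ennreal_mult')
  also have "c * (2 powr \<alpha> * Beta ((1 + \<alpha>) / 2) ((N - 1) / 2)) = 1 / poisson_const CARD('n) \<alpha>"
  proof -
    have "poisson_const CARD('n) \<alpha> * (c * (2 powr \<alpha> * Beta ((1 + \<alpha>) / 2) ((N - 1) / 2))) = 1"
      using poisson_const_Beta[OF \<alpha> n] c1 unfolding N_def by (simp add: mult.left_commute)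
    then show ?thesis using poisson_const_pos[OF \<alpha> n] by (simp add: field_simps)
  qed
  finally show ?thesis unfolding N_def .
qed

text \<open>The substitution is the one induced on \<open>\<zeta> \<bullet> \<xi>\<close> by the chord reflection that sends \<open>\<zeta>\<close> to
  the second point of the sphere on the line through \<open>\<zeta>\<close> and \<open>r \<xi>\<close>.\<close>

lemma nn_integral_kernel_reflect:
  fixes r e m :: real
  assumes r: "0 \<le> r" "r < 1"
  shows "(\<integral>\<^sup>+s. ennreal ((1 + r\<^sup>2 - 2 * r * s) powr (- m)) * ennreal ((1 - s\<^sup>2) powr e) * indicator {-1<..<1} s \<partial>lborel)
    = ennreal ((1 - r\<^sup>2) powr (2 * e + 2 - 2 * m)) *
      (\<integral>\<^sup>+s. ennreal ((1 + r\<^sup>2 - 2 * r * s) powr (m - 2 * e - 2)) * ennreal ((1 - s\<^sup>2) powr e) * indicator {-1<..<1} s \<partial>lborel)"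
proof -
  define D where "D = 1 - r\<^sup>2"
  have D: "D > 0" using r by (simp add: D_def power_strict_mono abs_square_less_1)
  define v where "v s = 1 + r\<^sup>2 - 2 * r * s" for s
  have v: "v s > 0" if "s \<in> {-1..1}" for s
  proof -
    have "r * s \<le> r * 1" using that r by (intro mult_left_mono) auto
    then have "v s \<ge> (1 - r)\<^sup>2" by (simp add: v_def power2_eq_square algebra_simps)
    moreover have "(1 - r)\<^sup>2 > 0" using r by simp
    ultimately show ?thesis by linarith
  qed
  \<comment> \<open>If \<zeta> has cosine s with \<xi>, then the other end of its chord through r
    \<xi> has cosine - \<open>g s\<close>. The sign is absorbed by replacing s by -s in the integral
    beforehand, which makes the substitution increasing.\<close>
  define g where "g s = ((1 + r\<^sup>2) * s - 2 * r) / v s" for s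
  define g' where "g' s = D\<^sup>2 / (v s)\<^sup>2" for s
  have g'0: "g' s \<ge> 0" for s by (simp add: g'_def)
  have g1: "g (-1) = -1" "g 1 = 1"
    using v[of "-1"] v[of 1] unfolding g_def by (simp_all add: v_def field_simps)
  have deriv: "(g has_real_derivative g' s) (at s)" if "s \<in> {-1..1}" for s
  proof -
    have "(g has_real_derivative ((1 + r\<^sup>2) * v s - ((1 + r\<^sup>2) * s - 2 * r) * (- 2 * r)) / (v s * v s)) (at s)"
      unfolding g_def using v[OF that] unfolding v_def by (auto intro!: derivative_eq_intros)
    also have "((1 + r\<^sup>2) * v s - ((1 + r\<^sup>2) * s - 2 * r) * (- 2 * r)) / (v s * v s) = g' s"
    proof -
      have "(1 + r\<^sup>2) * v s - ((1 + r\<^sup>2) * s - 2 * r) * (- 2 * r) = D\<^sup>2"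
        by (simp add: v_def D_def power2_eq_square algebra_simps)
      then show ?thesis by (simp add: g'_def power2_eq_square)
    qed
    finally show ?thesis .
  qed
  have contg': "continuous_on {-1..1} g'"
  proof -
    have "continuous_on {-1..1} v" unfolding v_def by (intro continuous_intros)
    then show ?thesis unfolding g'_def using v by (intro continuous_intros) force+
  qed
  have id1: "1 - (g s)\<^sup>2 = D\<^sup>2 * (1 - s\<^sup>2) / (v s)\<^sup>2" if "s \<in> {-1..1}" for s
  proof -
    have "(v s)\<^sup>2 - ((1 + r\<^sup>2) * s - 2 * r)\<^sup>2 = D\<^sup>2 * (1 - s\<^sup>2)"
      by (simp add: v_def D_def power2_eq_square algebra_simps)
    then show ?thesis using v[OF that] by (simp add: g_def power_divide field_simps)
  qed
  \<comment> \<open>The power of the point r \<xi>: the two segments of a chord through it have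
    product D = 1 - r^2. The squared length of one is \<open>v s\<close>, hence that of the other is
    D^2 / \<open>v s\<close>.\<close>
  have id2: "1 + r\<^sup>2 + 2 * r * g s = D\<^sup>2 / v s" if "s \<in> {-1..1}" for s
  proof -
    have "(1 + r\<^sup>2) * v s + 2 * r * ((1 + r\<^sup>2) * s - 2 * r) = D\<^sup>2"
      by (simp add: v_def D_def power2_eq_square algebra_simps)
    then show ?thesis using v[OF that] by (simp add: g_def field_simps)
  qed
  have "(\<integral>\<^sup>+s. ennreal ((1 + r\<^sup>2 - 2 * r * s) powr (- m)) * ennreal ((1 - s\<^sup>2) powr e) * indicator {-1<..<1} s \<partial>lborel)
    = ennreal \<bar>-1\<bar> * (\<integral>\<^sup>+s. ennreal ((1 + r\<^sup>2 - 2 * r * (0 + -1 * s)) powr (- m)) * ennreal ((1 - (0 + -1 * s)\<^sup>2) powr e) * indicator {-1<..<1} (0 + -1 * s) \<partial>lborel)"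
    by (rule nn_integral_real_affine) auto
  also have "\<dots> = (\<integral>\<^sup>+s. (ennreal ((1 + r\<^sup>2 + 2 * r * s) powr (- m)) * ennreal ((1 - s\<^sup>2) powr e)) * indicator {g (-1)..g 1} s \<partial>lborel)"
  proof -
    have "ennreal ((1 + r\<^sup>2 + 2 * r * s) powr (- m)) * ennreal ((1 - s\<^sup>2) powr e) * indicator {-1<..<1} (- s)
       = (ennreal ((1 + r\<^sup>2 + 2 * r * s) powr (- m)) * ennreal ((1 - s\<^sup>2) powr e)) * indicator {-1..1} s" for s :: real
      by (cases "s = 1 \<or> s = -1") (auto simp: indicator_def)
    then show ?thesis unfolding g1 by simp
  qed
  also have "\<dots> = (\<integral>\<^sup>+s. (ennreal ((1 + r\<^sup>2 + 2 * r * g s) powr (- m)) * ennreal ((1 - (g s)\<^sup>2) powr e)) * ennreal (g' s) * indicator {-1..1} s \<partial>lborel)"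
    by (rule nn_integral_substitution_aux[OF _ _ deriv contg']) (auto simp: g'_def)
  also have "\<dots> = (\<integral>\<^sup>+s. ennreal (D powr (2 * e + 2 - 2 * m)) * (ennreal (v s powr (m - 2 * e - 2)) * ennreal ((1 - s\<^sup>2) powr e) * indicator {-1<..<1} s) \<partial>lborel)"
  proof (rule nn_integral_cong)
    fix s :: real
    consider "s \<in> {-1<..<1}" | "s = 1" | "s = -1" | "s \<notin> {-1..1}" by fastforce
    then show "(ennreal ((1 + r\<^sup>2 + 2 * r * g s) powr (- m)) * ennreal ((1 - (g s)\<^sup>2) powr e)) * ennreal (g' s) * indicator {-1..1} s
       = ennreal (D powr (2 * e + 2 - 2 * m)) * (ennreal (v s powr (m - 2 * e - 2)) * ennreal ((1 - s\<^sup>2) powr e) * indicator {-1<..<1} s)"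
    proof cases
      case 1
      then have s: "s \<in> {-1..1}" by auto
      have vs: "v s > 0" by (rule v[OF s])
      have s2: "1 - s\<^sup>2 > 0" using 1 by (auto simp: abs_square_less_1)
      \<comment> \<open>With all bases written as exponentials, the identity between products of
        powers becomes one between linear combinations of L, V and Q.\<close>
      define L V Q where "L = ln D" and "V = ln (v s)" and "Q = ln (1 - s\<^sup>2)"
      have ex: "D = exp L" "v s = exp V" "1 - s\<^sup>2 = exp Q"
        using D vs s2 by (simp_all add: L_def V_def Q_def)
      have "(1 + r\<^sup>2 + 2 * r * g s) powr (- m) * (1 - (g s)\<^sup>2) powr e * g' s
         = exp (2 * L - V) powr (- m) * exp (2 * L + Q - 2 * V) powr e * exp (2 * L - 2 * V)"
        unfolding id1[OF s] id2[OF s] g'_def ex by (simp add: exp_add exp_diff exp_double)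
      also have "\<dots> = exp L powr (2 * e + 2 - 2 * m) * (exp V powr (m - 2 * e - 2) * exp Q powr e)"
        by (simp add: powr_def algebra_simps flip: exp_add)
      finally have eq: "(1 + r\<^sup>2 + 2 * r * g s) powr (- m) * (1 - (g s)\<^sup>2) powr e * g' s
         = D powr (2 * e + 2 - 2 * m) * (v s powr (m - 2 * e - 2) * (1 - s\<^sup>2) powr e)"
        unfolding ex .
      have "ennreal ((1 + r\<^sup>2 + 2 * r * g s) powr (- m)) * ennreal ((1 - (g s)\<^sup>2) powr e) * ennreal (g' s)
         = ennreal (D powr (2 * e + 2 - 2 * m)) * (ennreal (v s powr (m - 2 * e - 2)) * ennreal ((1 - s\<^sup>2) powr e))"
        using arg_cong[OF eq, of ennreal] g'0 by (simp add: ennreal_mult mult.assoc)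
      then show ?thesis using 1 s by simp
    qed (auto simp: g1)
  qed
  also have "\<dots> = ennreal (D powr (2 * e + 2 - 2 * m)) * (\<integral>\<^sup>+s. ennreal (v s powr (m - 2 * e - 2)) * ennreal ((1 - s\<^sup>2) powr e) * indicator {-1<..<1} s \<partial>lborel)"
    unfolding v_def by (rule nn_integral_cmult) measurable
  finally show ?thesis unfolding D_def v_def .
qed

text \<open>For the exponents of the Poisson kernel the reflection produces exactly the power -(1 +
  \<alpha>) of 1 - r^2, which cancels the prefactor. The exponent 2 + \<alpha> - n that remains
  exceeds -(n - 1), so the right-hand integral also makes sense for r = 1.\<close>

lemma nn_integral_poisson_reflect:
  assumes n: "CARD('n) \<ge> 2" and \<xi>: "\<xi> \<in> sphere (0::real^'n) 1" and r: "0 \<le> r" "r < 1"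
  shows "ennreal ((1 - r\<^sup>2) powr (1 + \<alpha>)) * (\<integral>\<^sup>+\<zeta>. ennreal (norm (r *\<^sub>R \<xi> - \<zeta>) powr (- (real CARD('n) + \<alpha>))) \<partial>sphere_measure)
    = (\<integral>\<^sup>+\<zeta>. ennreal (norm (r *\<^sub>R \<xi> - \<zeta>) powr (2 + \<alpha> - real CARD('n))) \<partial>sphere_measure)"
proof -
  define N where "N = real CARD('n)"
  obtain c where c: "c > 0" and z: "\<And>f. f \<in> borel_measurable borel \<Longrightarrow>
    (\<integral>\<^sup>+\<zeta>. f (\<zeta> \<bullet> \<xi>) \<partial>sphere_measure) = ennreal c *
      (\<integral>\<^sup>+s. f s * ennreal ((1 - s\<^sup>2) powr ((N - 3) / 2)) * indicator {-1<..<1} s \<partial>lborel)"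
    using nn_integral_sphere_measure_zonal_ex[OF n] \<xi> unfolding N_def by blast
  have nn: "(\<integral>\<^sup>+\<zeta>. ennreal (norm (r *\<^sub>R \<xi> - \<zeta>) powr q) \<partial>sphere_measure) = ennreal c *
      (\<integral>\<^sup>+s. ennreal ((1 + r\<^sup>2 - 2 * r * s) powr (q / 2)) * ennreal ((1 - s\<^sup>2) powr ((N - 3) / 2)) * indicator {-1<..<1} s \<partial>lborel)" for q
  proof -
    have "(\<integral>\<^sup>+\<zeta>. ennreal (norm (r *\<^sub>R \<xi> - \<zeta>) powr q) \<partial>sphere_measure) = (\<integral>\<^sup>+\<zeta>. ennreal ((1 + r\<^sup>2 - 2 * r * (\<zeta> \<bullet> \<xi>)) powr (q / 2)) \<partial>sphere_measure)"
    proof (rule nn_integral_cong)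
      fix \<zeta> :: "real^'n" assume "\<zeta> \<in> space sphere_measure"
      then have eq: "norm (r *\<^sub>R \<xi> - \<zeta>) = sqrt (1 + r\<^sup>2 - 2 * r * (\<zeta> \<bullet> \<xi>))" using \<xi> by (simp add: norm_diff_sphere)
      have "1 + r\<^sup>2 - 2 * r * (\<zeta> \<bullet> \<xi>) \<ge> 0" 
        using eq norm_ge_zero[of "r *\<^sub>R \<xi> - \<zeta>"] by simp
      then show "ennreal (norm (r *\<^sub>R \<xi> - \<zeta>) powr q) = ennreal ((1 + r\<^sup>2 - 2 * r * (\<zeta> \<bullet> \<xi>)) powr (q / 2))"
        unfolding eq by (simp add: powr_half_sqrt[symmetric] powr_powr)
    qed
    also have "\<dots> = ennreal c *
      (\<integral>\<^sup>+s. ennreal ((1 + r\<^sup>2 - 2 * r * s) powr (q / 2)) * ennreal ((1 - s\<^sup>2) powr ((N - 3) / 2)) * indicator {-1<..<1} s \<partial>lborel)"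
      by (rule z) measurable
    finally show ?thesis .
  qed
  have D: "1 - r\<^sup>2 > 0" using r by (simp add: abs_square_less_1)
  have e1: "2 * ((N - 3) / 2) + 2 - 2 * ((N + \<alpha>) / 2) = - (1 + \<alpha>)" by (simp add: field_simps)
  have e2: "(N + \<alpha>) / 2 - 2 * ((N - 3) / 2) - 2 = (2 + \<alpha> - N) / 2" by (simp add: field_simps)
  have "ennreal ((1 - r\<^sup>2) powr (1 + \<alpha>)) * (ennreal c * (ennreal ((1 - r\<^sup>2) powr (- (1 + \<alpha>))) * X)) = ennreal c * X" for X
  proof -
    have "(1 - r\<^sup>2) powr (1 + \<alpha>) * (1 - r\<^sup>2) powr (- (1 + \<alpha>)) = 1" using D by (simp flip: powr_add)
    then have "ennreal ((1 - r\<^sup>2) powr (1 + \<alpha>)) * ennreal ((1 - r\<^sup>2) powr (- (1 + \<alpha>))) = 1"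
      by (simp flip: ennreal_mult)
    then show ?thesis by (metis mult.left_commute mult.assoc mult_1)
  qed
  then show ?thesis
    unfolding nn N_def[symmetric] using nn_integral_kernel_reflect[OF r, of "(N + \<alpha>) / 2" "(N - 3) / 2"]
    unfolding e1 e2 by (simp add: minus_divide_left)
qed

section \<open>Minkowski's integral inequality\<close>

text \<open>By convexity the graph of X^p lies above its tangent at Y. For p > 1 this is Young's
  inequality applied to X and Y^(p-1) with conjugate exponent p/(p-1).\<close>

lemma powr_tangent_bound:
  fixes X Y p :: real
  assumes p: "p \<ge> 1" and X: "X \<ge> 0" and Y: "Y \<ge> 0"
  shows "p * Y powr (p - 1) * X \<le> X powr p + (p - 1) * Y powr p"
proof (cases "p = 1")
  case True
  then show ?thesis using X by (simp add: powr_def)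
next
  case False
  then have p1: "p > 1" using p by simp
  define q where "q = p / (p - 1)"
  have q1: "q > 1" using p1 by (simp add: q_def field_simps)
  have pq: "1 / p + 1 / q = 1" using p1 by (simp add: q_def field_simps)
  have "X * Y powr (p - 1) \<le> X powr p / p + (Y powr (p - 1)) powr q / q"
    by (rule Youngs_inequality[OF p1 q1 pq X]) simp
  also have "(Y powr (p - 1)) powr q = Y powr p"
    using p1 by (simp add: powr_powr q_def)
  finally have "p * (X * Y powr (p - 1)) \<le> p * (X powr p / p + Y powr p / q)"
    using p1 by (intro mult_left_mono) auto
  also have "\<dots> = X powr p + (p - 1) * Y powr p"
    using p1 by (simp add: q_def field_simps)
  finally show ?thesis by (simp add: mult_ac)
qed

text \<open>Jensen's inequality for the weight \<open>\<bar>K\<bar> m / A\<close>, applied to \<open>\<bar>g\<bar> / m\<close>.\<close>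

lemma nn_integral_powr_minkowski:
  fixes g :: "'a \<Rightarrow> 'b \<Rightarrow> real" and p A :: real
  assumes "sigma_finite_measure M" "sigma_finite_measure N"
    and p: "p \<ge> 1" and A: "A > 0"
    and [measurable]: "(\<lambda>(R, z). g R z) \<in> borel_measurable (M \<Otimes>\<^sub>M N)"
      "K \<in> borel_measurable N" "m \<in> borel_measurable N"
    and m0: "\<And>z. z \<in> space N \<Longrightarrow> m z \<ge> 0"
    and zero: "\<And>R z. R \<in> space M \<Longrightarrow> z \<in> space N \<Longrightarrow> m z = 0 \<Longrightarrow> g R z = 0"
    and bound: "\<And>z. z \<in> space N \<Longrightarrow> (\<integral>\<^sup>+R. ennreal (\<bar>g R z\<bar> powr p) \<partial>M) \<le> ennreal (m z powr p)"
    and total: "(\<integral>\<^sup>+z. ennreal (\<bar>K z\<bar> * m z) \<partial>N) \<le> ennreal A"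
    and intg: "\<And>R. R \<in> space M \<Longrightarrow> integrable N (\<lambda>z. K z * g R z)"
  shows "(\<integral>\<^sup>+R. ennreal (\<bar>LINT z|N. K z * g R z\<bar> powr p) \<partial>M) \<le> ennreal (A powr p)"
proof -
  interpret M: sigma_finite_measure M by fact
  interpret N: sigma_finite_measure N by fact
  interpret pair_sigma_finite M N ..
  define D where "D z = \<bar>K z\<bar> * m z / A" for z
  define X where "X R z = \<bar>g R z\<bar> / m z" for R z
  have [measurable]: "D \<in> borel_measurable N" unfolding D_def by measurable
  have D0: "D z \<ge> 0" if "z \<in> space N" for z using m0[OF that] A by (simp add: D_def)
  have X0: "X R z \<ge> 0" if "z \<in> space N" for R z using m0[OF that] by (simp add: X_def)
  have totD: "(\<integral>\<^sup>+z. ennreal (D z) \<partial>N) \<le> 1"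
  proof -
    have "(\<integral>\<^sup>+z. ennreal (D z) \<partial>N) = (\<integral>\<^sup>+z. ennreal (1 / A) * ennreal (\<bar>K z\<bar> * m z) \<partial>N)"
      using A m0 by (intro nn_integral_cong) (simp add: D_def flip: ennreal_mult)
    also have "\<dots> = ennreal (1 / A) * (\<integral>\<^sup>+z. ennreal (\<bar>K z\<bar> * m z) \<partial>N)"
      by (rule nn_integral_cmult) measurable
    also have "\<dots> \<le> ennreal (1 / A) * ennreal A" by (intro mult_left_mono total) simp
    also have "\<dots> = 1" using A by (simp flip: ennreal_mult)
    finally show ?thesis .
  qed
  have jensen: "ennreal (\<bar>LINT z|N. K z * g R z\<bar> powr p)
      \<le> ennreal (A powr p) * (\<integral>\<^sup>+z. ennreal (D z * X R z powr p) \<partial>N)" if R: "R \<in> space M" for R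
  proof -
    note [measurable] = R
    have [measurable]: "(\<lambda>z. g R z) \<in> borel_measurable N" by measurable
    have [measurable]: "X R \<in> borel_measurable N" unfolding X_def by measurable
    define Y where "Y = (LINT z|N. \<bar>K z * g R z\<bar>) / A"
    have Y0: "Y \<ge> 0" using A by (simp add: Y_def)
    \<comment> \<open>Where \<open>m z = 0\<close>, the left side is 0 by its factor
      \<open>m z\<close>, and the right side is 0 by the hypothesis \<open>zero\<close>.\<close>
    have DX: "D z * X R z = \<bar>K z * g R z\<bar> / A" if "z \<in> space N" for z
      using zero[OF R that] by (cases "m z = 0") (auto simp: D_def X_def abs_mult)
    have YY: "Y powr (p - 1) * Y = Y powr p"
      using Y0 p by (cases "Y = 0") (auto simp: powr_diff)
    \<comment> \<open>Y is the integral of X against D. Jensen's inequality is obtained by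
      integrating the tangent inequality at Y against D; as D has mass at most 1 and p \<ge> 1, the
      constant term contributes at most (p - 1) Y^p, which is finite and can be cancelled.\<close>
    have "ennreal (p * Y powr p) = ennreal (p * Y powr (p - 1)) * ennreal Y"
      using p Y0 by (simp add: mult.assoc YY flip: ennreal_mult)
    also have "ennreal Y = (\<integral>\<^sup>+z. ennreal (\<bar>K z * g R z\<bar> / A) \<partial>N)"
      unfolding Y_def using intg[OF R] A
      by (subst nn_integral_eq_integral) (auto intro!: integrable_divide)
    also have "ennreal (p * Y powr (p - 1)) * \<dots> = (\<integral>\<^sup>+z. ennreal (p * Y powr (p - 1)) * ennreal (\<bar>K z * g R z\<bar> / A) \<partial>N)"
      by (rule nn_integral_cmult[symmetric]) measurable
    also have "\<dots> \<le> (\<integral>\<^sup>+z. ennreal (D z * X R z powr p) + ennreal ((p - 1) * Y powr p) * ennreal (D z) \<partial>N)"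
    proof (rule nn_integral_mono)
      fix z assume z: "z \<in> space N"
      have "p * Y powr (p - 1) * (\<bar>K z * g R z\<bar> / A) = D z * (p * Y powr (p - 1) * X R z)"
        unfolding DX[OF z, symmetric] by (simp add: mult_ac)
      also have "\<dots> \<le> D z * (X R z powr p + (p - 1) * Y powr p)"
        by (intro mult_left_mono powr_tangent_bound p Y0 X0 D0 z)
      also have "\<dots> = D z * X R z powr p + (p - 1) * Y powr p * D z" by (simp add: algebra_simps)
      finally have "ennreal (p * Y powr (p - 1) * (\<bar>K z * g R z\<bar> / A)) \<le> ennreal (D z * X R z powr p + (p - 1) * Y powr p * D z)"
        by (rule ennreal_leI)
      then show "ennreal (p * Y powr (p - 1)) * ennreal (\<bar>K z * g R z\<bar> / A)
         \<le> ennreal (D z * X R z powr p) + ennreal ((p - 1) * Y powr p) * ennreal (D z)"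
        using p Y0 A D0[OF z] X0[OF z] by (simp add: ennreal_mult[symmetric] ennreal_plus[symmetric] del: ennreal_plus)
    qed
    also have "\<dots> = (\<integral>\<^sup>+z. ennreal (D z * X R z powr p) \<partial>N) + ennreal ((p - 1) * Y powr p) * (\<integral>\<^sup>+z. ennreal (D z) \<partial>N)"
      by (subst nn_integral_add) (auto intro!: nn_integral_cmult)
    also have "\<dots> \<le> (\<integral>\<^sup>+z. ennreal (D z * X R z powr p) \<partial>N) + ennreal ((p - 1) * Y powr p) * 1"
      by (intro add_left_mono mult_left_mono totD) simp
    also have "ennreal (p * Y powr p) = ennreal ((p - 1) * Y powr p) + ennreal (Y powr p)"
    proof -
      have "p * Y powr p = (p - 1) * Y powr p + Y powr p" by (simp add: algebra_simps)
      then show ?thesis using p by (simp only: ennreal_plus) simp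
    qed
    finally have "ennreal ((p - 1) * Y powr p) + ennreal (Y powr p)
        \<le> ennreal ((p - 1) * Y powr p) + (\<integral>\<^sup>+z. ennreal (D z * X R z powr p) \<partial>N)"
      by (simp only: mult_1_right add.commute)
    then have Yle: "ennreal (Y powr p) \<le> (\<integral>\<^sup>+z. ennreal (D z * X R z powr p) \<partial>N)"
      unfolding ennreal_add_left_cancel_le by simp
    have "\<bar>LINT z|N. K z * g R z\<bar> \<le> A * Y"
      unfolding Y_def using A integral_norm_bound[of N "\<lambda>z. K z * g R z"] by simp
    then have "\<bar>LINT z|N. K z * g R z\<bar> powr p \<le> (A * Y) powr p"
      using p by (intro powr_mono2) auto
    also have "\<dots> = A powr p * Y powr p" using A Y0 by (simp add: powr_mult)
    finally have "ennreal (\<bar>LINT z|N. K z * g R z\<bar> powr p) \<le> ennreal (A powr p) * ennreal (Y powr p)"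
      by (simp add: ennreal_leI flip: ennreal_mult)
    also have "\<dots> \<le> ennreal (A powr p) * (\<integral>\<^sup>+z. ennreal (D z * X R z powr p) \<partial>N)"
      by (intro mult_left_mono Yle) simp
    finally show ?thesis .
  qed
  have [measurable]: "(\<lambda>(R, z). X R z) \<in> borel_measurable (M \<Otimes>\<^sub>M N)"
    unfolding X_def by measurable
  have "(\<integral>\<^sup>+R. ennreal (\<bar>LINT z|N. K z * g R z\<bar> powr p) \<partial>M)
     \<le> (\<integral>\<^sup>+R. ennreal (A powr p) * (\<integral>\<^sup>+z. ennreal (D z * X R z powr p) \<partial>N) \<partial>M)"
    by (intro nn_integral_mono jensen)
  also have "\<dots> = ennreal (A powr p) * (\<integral>\<^sup>+R. (\<integral>\<^sup>+z. ennreal (D z * X R z powr p) \<partial>N) \<partial>M)"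
    by (rule nn_integral_cmult) measurable
  also have "(\<integral>\<^sup>+R. (\<integral>\<^sup>+z. ennreal (D z * X R z powr p) \<partial>N) \<partial>M) = (\<integral>\<^sup>+z. (\<integral>\<^sup>+R. ennreal (D z * X R z powr p) \<partial>M) \<partial>N)"
    by (rule Fubini'[symmetric]) measurable
  also have "\<dots> \<le> (\<integral>\<^sup>+z. ennreal (D z) \<partial>N)"
  proof (rule nn_integral_mono)
    fix z assume z: "z \<in> space N"
    note [measurable] = z
    have [measurable]: "(\<lambda>R. g R z) \<in> borel_measurable M" by measurable
    have X1: "(\<integral>\<^sup>+R. ennreal (X R z powr p) \<partial>M) \<le> 1"
    proof (cases "m z = 0")
      case True
      then show ?thesis by (simp add: X_def)
    next
      case False
      then have mz: "m z > 0" using m0[OF z] by simp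
      have "(\<integral>\<^sup>+R. ennreal (X R z powr p) \<partial>M) = (\<integral>\<^sup>+R. ennreal (1 / m z powr p) * ennreal (\<bar>g R z\<bar> powr p) \<partial>M)"
        using mz by (intro nn_integral_cong) (simp add: X_def powr_divide flip: ennreal_mult)
      also have "\<dots> = ennreal (1 / m z powr p) * (\<integral>\<^sup>+R. ennreal (\<bar>g R z\<bar> powr p) \<partial>M)"
        by (rule nn_integral_cmult) measurable
      also have "\<dots> \<le> ennreal (1 / m z powr p) * ennreal (m z powr p)"
        by (intro mult_left_mono bound z) simp
      also have "\<dots> = 1" using mz by (simp flip: ennreal_mult)
      finally show ?thesis .
    qed
    have "(\<integral>\<^sup>+R. ennreal (D z * X R z powr p) \<partial>M) = (\<integral>\<^sup>+R. ennreal (D z) * ennreal (X R z powr p) \<partial>M)"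
      using D0[OF z] by (simp add: ennreal_mult)
    also have "\<dots> = ennreal (D z) * (\<integral>\<^sup>+R. ennreal (X R z powr p) \<partial>M)"
      by (rule nn_integral_cmult) (unfold X_def, measurable)
    also have "\<dots> \<le> ennreal (D z) * 1" by (intro mult_left_mono X1) simp
    finally show "(\<integral>\<^sup>+R. ennreal (D z * X R z powr p) \<partial>M) \<le> ennreal (D z)" by simp
  qed
  also have "\<dots> \<le> 1" by (rule totD)
  finally show ?thesis by (simp add: mult_left_mono)
qed

section \<open>Majorants\<close>

locale majorant_fun =
  fixes \<omega> :: "real \<Rightarrow> real"
  assumes majorant: "majorant \<omega>"
begin

lemma zero [simp]: "\<omega> 0 = 0"
  using majorant by (simp add: majorant_def)

lemma mono: "0 \<le> s \<Longrightarrow> s \<le> t \<Longrightarrow> \<omega> s \<le> \<omega> t"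
  using majorant by (auto simp: majorant_def intro: mono_onD)

lemma nonneg: "0 \<le> t \<Longrightarrow> 0 \<le> \<omega> t"
  using majorant by (simp add: majorant_def)

lemma quotient_antimono: "0 < s \<Longrightarrow> s \<le> t \<Longrightarrow> \<omega> t / t \<le> \<omega> s / s"
  using majorant by (auto simp: majorant_def monotone_on_def)

text \<open>From a point u with \<open>\<omega> u \<noteq> 0\<close>, positivity spreads to the
  right by monotonicity of \<omega> and to the left by that of \<omega>(t)/t.\<close>

lemma pos:
  assumes "t > 0"
  shows "\<omega> t > 0"
proof -
  obtain u where u: "u \<ge> 0" "\<omega> u \<noteq> 0" using majorant by (auto simp: majorant_def)
  then have u0: "u > 0" by (cases "u = 0") auto
  have wu: "\<omega> u > 0" using u nonneg[of u] by simp
  show ?thesis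
  proof (cases "u \<le> t")
    case True
    then show ?thesis using mono[of u t] u0 wu by simp
  next
    case False
    then have "\<omega> u / u \<le> \<omega> t / t" using assms by (intro quotient_antimono) auto
    moreover have "\<omega> u / u > 0" using wu u0 by simp
    ultimately have "\<omega> t / t > 0" by linarith
    then show ?thesis using assms by (simp add: zero_less_divide_iff)
  qed
qed

lemma scale:
  assumes "c \<ge> 1" "t \<ge> 0"
  shows "\<omega> (c * t) \<le> c * \<omega> t"
proof (cases "t = 0")
  case False
  then have t: "t > 0" using assms by simp
  then have "\<omega> (c * t) / (c * t) \<le> \<omega> t / t"
    using assms by (intro quotient_antimono) (auto simp: field_simps)
  then show ?thesis using t assms by (simp add: field_simps)
qed simp

lemma linear_lower:
  assumes "0 < h" "h \<le> T"
  shows "\<omega> T / T * h \<le> \<omega> h"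
  using quotient_antimono[OF assms] assms by (simp add: field_simps)

text \<open>Majorants are subadditive: the chord from the origin to the graph at y lies below the
  graph at x and at y - x, and its values there add up to \<omega>(y). This is what puts
  \<omega>(|\<zeta> - \<xi>|) itself into the class for the exponent \<infinity>.\<close>

lemma abs_diff:
  assumes "a \<ge> 0" "b \<ge> 0"
  shows "\<bar>\<omega> a - \<omega> b\<bar> \<le> \<omega> \<bar>a - b\<bar>"
proof -
  have sub: "\<omega> y - \<omega> x \<le> \<omega> (y - x)" if "0 \<le> x" "x \<le> y" for x y
  proof (cases "x = 0 \<or> x = y")
    case False
    then have xy: "0 < x" "x < y" using that by auto
    have "\<omega> y / y * x \<le> \<omega> x" "\<omega> y / y * (y - x) \<le> \<omega> (y - x)"
      by (rule linear_lower; use xy in simp)+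
    then have "\<omega> y / y * x + \<omega> y / y * (y - x) \<le> \<omega> x + \<omega> (y - x)" by linarith
    moreover have "\<omega> y / y * x + \<omega> y / y * (y - x) = \<omega> y" using xy by (simp add: field_simps)
    ultimately show ?thesis by linarith
  qed auto
  show ?thesis
  proof (cases "a \<le> b")
    case True
    then show ?thesis using sub[of a b] mono[of a b] assms by (simp add: abs_if)
  next
    case False
    then show ?thesis using sub[of b a] mono[of b a] assms by (simp add: abs_if)
  qed
qed

lemma continuous: "continuous_on {0..} \<omega>"
  using majorant by (simp add: majorant_def)

text \<open>Nothing is known of \<omega> on negative numbers. Composition with the absolute value
  gives a continuous, hence Borel, function on the whole line, which is why the integrands below
  contain \<open>\<omega> \<bar>t\<bar>\<close>.\<close>

lemma continuous_abs: "continuous_on UNIV (\<lambda>t. \<omega> \<bar>t\<bar>)"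
  by (rule continuous_on_compose2[OF continuous]) (auto intro!: continuous_intros)

lemma measurable_abs [measurable]: "(\<lambda>t. \<omega> \<bar>t\<bar>) \<in> borel_measurable borel"
  by (rule borel_measurable_continuous_onI[OF continuous_abs])

lemma measurable_norm_diff [measurable]:
  "(\<lambda>x. \<omega> (norm (x - a))) \<in> borel_measurable borel" for a :: "'a::{real_normed_vector, second_countable_topology}"
proof -
  have "(\<lambda>x. \<omega> \<bar>norm (x - a)\<bar>) \<in> borel_measurable borel" by measurable
  then show ?thesis by simp
qed

lemma integrand_continuous:
  assumes "a > 0"
  shows "continuous_on {a..b} (\<lambda>t. \<omega> t / t powr \<beta>)"
  using assms by (intro continuous_intros continuous_on_subset[OF continuous]) auto

lemma integrand_nonneg: "t \<ge> 0 \<Longrightarrow> \<omega> t / t powr \<beta> \<ge> 0"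
  by (simp add: nonneg)

lemma integral_mono_interval:
  assumes "0 < a" "a \<le> a'" "b' \<le> b"
  shows "integral {a'..b'} (\<lambda>t. \<omega> t / t powr \<beta>) \<le> integral {a..b} (\<lambda>t. \<omega> t / t powr \<beta>)"
  using assms by (intro integral_subset_le integrable_continuous_real integrand_continuous)
    (auto intro: integrand_nonneg)

lemma integral_pos:
  assumes "0 < a" "a < b" "\<beta> \<ge> 0"
  shows "integral {a..b} (\<lambda>t. \<omega> t / t powr \<beta>) > 0"
proof -
  have "integral {a..b} (\<lambda>t. \<omega> a / b powr \<beta>) \<le> integral {a..b} (\<lambda>t. \<omega> t / t powr \<beta>)"
  proof (intro integral_le integrable_continuous_real integrand_continuous)
    fix t :: real assume t: "t \<in> {a..b}"
    have "t powr \<beta> \<le> b powr \<beta>" using t assms by (intro powr_mono2) auto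
    then show "\<omega> a / b powr \<beta> \<le> \<omega> t / t powr \<beta>"
      using t assms by (intro frac_le mono nonneg) auto
  qed (use assms in auto)
  moreover have "integral {a..b} (\<lambda>t. \<omega> a / b powr \<beta>) > 0"
    using assms pos[of a] by simp
  ultimately show ?thesis by linarith
qed

lemma nn_integral_eq_integral:
  assumes "0 < a"
  shows "(\<integral>\<^sup>+t. ennreal (\<omega> \<bar>t\<bar> / t powr \<beta>) * indicator {a..b} t \<partial>lborel) = ennreal (integral {a..b} (\<lambda>t. \<omega> t / t powr \<beta>))"
proof -
  have "(\<integral>\<^sup>+t. ennreal (\<omega> \<bar>t\<bar> / t powr \<beta>) * indicator {a..b} t \<partial>lborel) = (\<integral>\<^sup>+t. ennreal (\<omega> t / t powr \<beta>) * indicator {a..b} t \<partial>lborel)"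
    using assms by (intro nn_integral_cong) (auto simp: indicator_def)
  also have "\<dots> = ennreal (integral {a..b} (\<lambda>t. \<omega> t / t powr \<beta>))"
    using assms by (intro nn_integral_has_integral_lebesgue' integrable_integral integrable_continuous_real integrand_continuous)
     (auto intro: integrand_nonneg)
  finally show ?thesis .
qed

end

text \<open>The substitution t -> h/t, which exchanges the endpoints h and 1. It is verified by
  evaluating both sides; for \<alpha> = 0, where the antiderivative is a logarithm, the two
  integrands coincide.\<close>

lemma nn_integral_powr_symmetry:
  fixes h \<alpha> :: real
  assumes h: "0 < h" "h \<le> 1"
  shows "ennreal h * (\<integral>\<^sup>+t. ennreal (t powr (\<alpha> - 1)) * indicator {h..1} t \<partial>lborel)
    = ennreal (h powr (1 + \<alpha>)) * (\<integral>\<^sup>+t. ennreal (t powr (- 1 - \<alpha>)) * indicator {h..1} t \<partial>lborel)"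
proof (cases "\<alpha> = 0")
  case True
  then show ?thesis using h by simp
next
  case False
  have F: "(\<integral>\<^sup>+t. ennreal (t powr (\<beta> - 1)) * indicator {h..1} t \<partial>lborel) = ennreal (1 powr \<beta> / \<beta> - h powr \<beta> / \<beta>)"
    if "\<beta> \<noteq> 0" for \<beta>
    using that h by (intro nn_integral_FTC_Icc) (auto intro!: derivative_eq_intros)
  have nn: "(1 - h powr \<alpha>) / \<alpha> \<ge> 0"
  proof (cases "\<alpha> > 0")
    case True
    then have "h powr \<alpha> \<le> 1 powr \<alpha>" using h by (intro powr_mono2) auto
    then show ?thesis using True by simp
  next
    case F: False
    then have "1 powr \<alpha> \<le> h powr \<alpha>" using h by (intro powr_mono2') auto
    then show ?thesis using F by (simp add: divide_nonpos_nonpos)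
  qed
  have eq: "h powr (1 + \<alpha>) * (1 powr (-\<alpha>) / (-\<alpha>) - h powr (-\<alpha>) / (-\<alpha>)) = h * ((1 - h powr \<alpha>) / \<alpha>)"
    using h False by (simp add: powr_add powr_minus field_simps)
  have "ennreal (h powr (1 + \<alpha>)) * (\<integral>\<^sup>+t. ennreal (t powr (- 1 - \<alpha>)) * indicator {h..1} t \<partial>lborel)
     = ennreal (h powr (1 + \<alpha>) * (1 powr (-\<alpha>) / (-\<alpha>) - h powr (-\<alpha>) / (-\<alpha>)))"
    using F[of "-\<alpha>"] False by (simp add: ennreal_mult' diff_minus_eq_add minus_diff_commute)
  also have "\<dots> = ennreal h * ennreal ((1 - h powr \<alpha>) / \<alpha>)"
    unfolding eq using h nn by (intro ennreal_mult) auto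
  also have "\<dots> = ennreal h * (\<integral>\<^sup>+t. ennreal (t powr (\<alpha> - 1)) * indicator {h..1} t \<partial>lborel)"
    using F[OF False] by (simp add: diff_divide_distrib)
  finally show ?thesis by (rule sym)
qed

section \<open>Lower bounds for \<omega> forced by (C2)\<close>

locale regular_majorant = majorant_fun +
  fixes \<alpha> :: real
  assumes \<alpha>: "\<alpha> > -1" and C2: "cond_C2 \<alpha> \<omega>"
begin

lemma nn_integral_C2:
  "\<exists>C>0. \<forall>h\<in>{0<..1}. ennreal (h powr (1 + \<alpha>)) *
     (\<integral>\<^sup>+t. ennreal (\<omega> \<bar>t\<bar> / t powr (2 + \<alpha>)) * indicator {h..1} t \<partial>lborel) \<le> ennreal (C * \<omega> h)"
proof -
  obtain C where C: "C > 0" and le: "\<And>\<delta>. 0 < \<delta> \<Longrightarrow> \<delta> \<le> pi \<Longrightarrow>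
     \<delta> powr (1 + \<alpha>) * integral {\<delta>..pi} (\<lambda>t. \<omega> t / t powr (2 + \<alpha>)) \<le> C * \<omega> \<delta>"
    using C2 unfolding cond_C2_def by auto
  have "ennreal (h powr (1 + \<alpha>)) * (\<integral>\<^sup>+t. ennreal (\<omega> \<bar>t\<bar> / t powr (2 + \<alpha>)) * indicator {h..1} t \<partial>lborel) \<le> ennreal (C * \<omega> h)"
    if h: "0 < h" "h \<le> 1" for h
  proof -
    have "h powr (1 + \<alpha>) * integral {h..1} (\<lambda>t. \<omega> t / t powr (2 + \<alpha>))
       \<le> h powr (1 + \<alpha>) * integral {h..pi} (\<lambda>t. \<omega> t / t powr (2 + \<alpha>))"
      using h pi_gt3 by (intro mult_left_mono integral_mono_interval) auto
    also have "\<dots> \<le> C * \<omega> h" using h pi_gt3 by (intro le) auto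
    finally show ?thesis
      unfolding nn_integral_eq_integral[OF h(1)] by (simp add: ennreal_leI flip: ennreal_mult')
  qed
  with C show ?thesis by auto
qed

text \<open>For h \<le> 1 the integral in (C2) contains the fixed positive contribution of [1, pi].
  So the condition prevents \<omega> from being smaller than a multiple of h^(1+\<alpha>).\<close>

lemma powr_le: "\<exists>C>0. \<forall>h\<in>{0<..1}. h powr (1 + \<alpha>) \<le> C * \<omega> h"
proof -
  obtain C where C: "C > 0" and le: "\<And>\<delta>. 0 < \<delta> \<Longrightarrow> \<delta> \<le> pi \<Longrightarrow>
     \<delta> powr (1 + \<alpha>) * integral {\<delta>..pi} (\<lambda>t. \<omega> t / t powr (2 + \<alpha>)) \<le> C * \<omega> \<delta>"
    using C2 unfolding cond_C2_def by auto
  define I where "I = integral {1..pi} (\<lambda>t. \<omega> t / t powr (2 + \<alpha>))"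
  have I: "I > 0"
    unfolding I_def using \<alpha> pi_gt3 by (intro integral_pos) auto
  have "h powr (1 + \<alpha>) \<le> C / I * \<omega> h" if h: "0 < h" "h \<le> 1" for h
  proof -
    have "h powr (1 + \<alpha>) * I \<le> h powr (1 + \<alpha>) * integral {h..pi} (\<lambda>t. \<omega> t / t powr (2 + \<alpha>))"
      unfolding I_def using h by (intro mult_left_mono integral_mono_interval) auto
    also have "\<dots> \<le> C * \<omega> h" using h pi_gt3 by (intro le) auto
    finally show ?thesis using I by (simp add: field_simps)
  qed
  then show ?thesis using C I by (intro exI[of _ "C / I"]) auto
qed

text \<open>By the symmetry t -> h/t the left side carries the weight t^(-1-\<alpha>), and since
  \<omega>(t) \<ge> \<omega>(1) t on (0, 1] this is at most 1/\<omega>(1) times the integrand of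
  (C2). For \<alpha> = 0 the left side is h log (1/h).\<close>

lemma log_integral_le:
  "\<exists>C>0. \<forall>h\<in>{0<..1}. ennreal h * (\<integral>\<^sup>+t. ennreal (t powr (\<alpha> - 1)) * indicator {h..1} t \<partial>lborel) \<le> ennreal (C * \<omega> h)"
proof -
  obtain C where C: "C > 0" and le: "\<And>h. 0 < h \<Longrightarrow> h \<le> 1 \<Longrightarrow> ennreal (h powr (1 + \<alpha>)) *
     (\<integral>\<^sup>+t. ennreal (\<omega> \<bar>t\<bar> / t powr (2 + \<alpha>)) * indicator {h..1} t \<partial>lborel) \<le> ennreal (C * \<omega> h)"
    using nn_integral_C2 by auto
  have w1: "\<omega> 1 > 0" by (simp add: pos)
  have "ennreal h * (\<integral>\<^sup>+t. ennreal (t powr (\<alpha> - 1)) * indicator {h..1} t \<partial>lborel) \<le> ennreal (C / \<omega> 1 * \<omega> h)"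
    if h: "0 < h" "h \<le> 1" for h
  proof -
    have "(\<integral>\<^sup>+t. ennreal (t powr (- 1 - \<alpha>)) * indicator {h..1} t \<partial>lborel)
       \<le> (\<integral>\<^sup>+t. ennreal (1 / \<omega> 1) * (ennreal (\<omega> \<bar>t\<bar> / t powr (2 + \<alpha>)) * indicator {h..1} t) \<partial>lborel)"
    proof (rule nn_integral_mono)
      fix t :: real
      show "ennreal (t powr (- 1 - \<alpha>)) * indicator {h..1} t \<le> ennreal (1 / \<omega> 1) * (ennreal (\<omega> \<bar>t\<bar> / t powr (2 + \<alpha>)) * indicator {h..1} t)"
      proof (cases "t \<in> {h..1}")
        case True
        then have t: "t > 0" "t \<le> 1" using h by auto
        have "t powr (-1 - \<alpha>) = t / t powr (2 + \<alpha>)"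
        proof -
          have "t / t powr (2 + \<alpha>) = t powr 1 / t powr (2 + \<alpha>)" using t by simp
          also have "\<dots> = t powr (1 - (2 + \<alpha>))" by (rule powr_diff[symmetric])
          finally show ?thesis by (simp add: algebra_simps)
        qed
        also have "\<dots> \<le> (\<omega> t / \<omega> 1) / t powr (2 + \<alpha>)"
          using linear_lower[of t 1] t w1 by (intro divide_right_mono) (auto simp: field_simps)
        also have "\<dots> = (1 / \<omega> 1) * (\<omega> \<bar>t\<bar> / t powr (2 + \<alpha>))" using t by simp
        finally have "ennreal (t powr (-1 - \<alpha>)) \<le> ennreal (1 / \<omega> 1) * ennreal (\<omega> \<bar>t\<bar> / t powr (2 + \<alpha>))"
          using w1 by (simp add: ennreal_leI flip: ennreal_mult')
        then show ?thesis using True by simp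
      qed simp
    qed
    also have "\<dots> = ennreal (1 / \<omega> 1) * (\<integral>\<^sup>+t. (ennreal (\<omega> \<bar>t\<bar> / t powr (2 + \<alpha>)) * indicator {h..1} t) \<partial>lborel)"
      by (rule nn_integral_cmult) measurable
    finally have "ennreal (h powr (1 + \<alpha>)) * (\<integral>\<^sup>+t. ennreal (t powr (- 1 - \<alpha>)) * indicator {h..1} t \<partial>lborel)
      \<le> ennreal (h powr (1 + \<alpha>)) * (ennreal (1 / \<omega> 1) * (\<integral>\<^sup>+t. (ennreal (\<omega> \<bar>t\<bar> / t powr (2 + \<alpha>)) * indicator {h..1} t) \<partial>lborel))"
      by (rule mult_left_mono) simp
    also have "\<dots> = ennreal (1 / \<omega> 1) * (ennreal (h powr (1 + \<alpha>)) * (\<integral>\<^sup>+t. (ennreal (\<omega> \<bar>t\<bar> / t powr (2 + \<alpha>)) * indicator {h..1} t) \<partial>lborel))"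
      by (rule mult.left_commute)
    also have "\<dots> \<le> ennreal (1 / \<omega> 1) * ennreal (C * \<omega> h)"
      by (intro mult_left_mono le h) simp
    also have "\<dots> = ennreal (C / \<omega> 1 * \<omega> h)" using w1 by (simp flip: ennreal_mult')
    finally show ?thesis unfolding nn_integral_powr_symmetry[OF h] .
  qed
  then show ?thesis using C w1 by (intro exI[of _ "C / \<omega> 1"]) auto
qed

end

section \<open>Kernel estimates\<close>

text \<open>Mean value theorem. The hypothesis keeps the intermediate point z between a/2 and 2 a,
  so replacing z^(s-1) by a^(s-1) costs at most the factor 2^|s-1|, whatever the sign of s -
  1.\<close>

lemma powr_diff_bound:
  fixes a b s :: real
  assumes a: "a > 0" and ab: "\<bar>a - b\<bar> \<le> a / 2"
  shows "\<bar>a powr s - b powr s\<bar> \<le> \<bar>s\<bar> * 2 powr \<bar>s - 1\<bar> * a powr (s - 1) * \<bar>a - b\<bar>"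
proof -
  have bound: "\<bar>a powr s - b powr s\<bar> \<le> \<bar>s\<bar> * 2 powr \<bar>s - 1\<bar> * a powr (s - 1) * \<bar>a - b\<bar>"
    if z: "a / 2 \<le> z" "z \<le> 2 * a" and eq: "a powr s - b powr s = (a - b) * (s * z powr (s - 1))" for z
  proof -
    have z0: "z > 0" using z a by linarith
    have "(z / a) powr (s - 1) \<le> 2 powr \<bar>s - 1\<bar>"
    proof (cases "s - 1 \<ge> 0")
      case True
      then have "(z / a) powr (s - 1) \<le> 2 powr (s - 1)"
        using z z0 a by (intro powr_mono2) (auto simp: field_simps)
      then show ?thesis using True by simp
    next
      case False
      then have "(z / a) powr (s - 1) \<le> (1/2) powr (s - 1)"
        using z z0 a by (intro powr_mono2') (auto simp: field_simps)
      also have "\<dots> = 2 powr (- (s - 1))"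
        by (simp only: powr_minus powr_divide powr_one_eq_one inverse_eq_divide)
      also have "- (s - 1) = \<bar>s - 1\<bar>" using False by simp
      finally show ?thesis .
    qed
    then have "z powr (s - 1) \<le> 2 powr \<bar>s - 1\<bar> * a powr (s - 1)"
      using z0 a by (simp add: powr_divide field_simps)
    then have "\<bar>s\<bar> * z powr (s - 1) * \<bar>a - b\<bar> \<le> \<bar>s\<bar> * (2 powr \<bar>s - 1\<bar> * a powr (s - 1)) * \<bar>a - b\<bar>"
      by (intro mult_left_mono mult_right_mono) auto
    then show ?thesis unfolding eq by (simp add: abs_mult mult_ac)
  qed
  have deriv: "((\<lambda>x. x powr s) has_real_derivative s * x powr (s - 1)) (at x)" if "x > 0" for x
    using that by (auto intro!: derivative_eq_intros)
  consider "a < b" | "a = b" | "b < a" by linarith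
  then show ?thesis
  proof cases
    case 1
    obtain z where z: "a < z" "z < b" "b powr s - a powr s = (b - a) * (s * z powr (s - 1))"
      using MVT2[OF 1, of "\<lambda>x. x powr s" "\<lambda>x. s * x powr (s - 1)"] deriv a by auto
    show ?thesis
    proof (rule bound)
      show "a powr s - b powr s = (a - b) * (s * z powr (s - 1))" using z(3) by (simp add: algebra_simps)
    qed (use z 1 ab a in auto)
  next
    case 3
    have b0: "b > 0" using ab a 3 by linarith
    obtain z where z: "b < z" "z < a" "a powr s - b powr s = (a - b) * (s * z powr (s - 1))"
      using MVT2[OF 3, of "\<lambda>x. x powr s" "\<lambda>x. s * x powr (s - 1)"] deriv b0 by auto
    show ?thesis
      by (rule bound[OF _ _ z(3)]) (use z 3 ab a in auto)
  qed simp
qed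

text \<open>One bound for both signs of the exponent: for e \<ge> 0 only v \<le> 2 is used, which
  accounts for the summand 1; for e < 0 only v \<ge> t/2.\<close>

lemma powr_le_of_half:
  fixes v t e :: real
  assumes "t > 0" "t / 2 \<le> v" "v \<le> 2"
  shows "v powr e \<le> 2 powr \<bar>e\<bar> * (t powr e + 1)"
proof (cases "e \<ge> 0")
  case True
  have "v powr e \<le> 2 powr e" using assms True by (intro powr_mono2) auto
  also have "\<dots> \<le> 2 powr e * (t powr e + 1)" by (simp add: algebra_simps)
  finally show ?thesis using True by simp
next
  case False
  have "v powr e \<le> (t / 2) powr e" using assms False by (intro powr_mono2') auto
  also have "\<dots> = 2 powr \<bar>e\<bar> * t powr e"
    using assms False by (simp add: powr_divide powr_minus field_simps)
  finally show ?thesis by (simp add: algebra_simps add_increasing)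
qed

text \<open>Write v for the distance from r \<xi> to \<zeta> and t for the chord length. The
  inequalities combine to t \<le> 2 v and to v \<le> (1 - r) + t \<le> 3 v; these are the forms in
  which they are applied.\<close>

lemma norm_radial_diff_bounds:
  fixes \<xi> \<zeta> :: "'a::real_normed_vector"
  assumes "norm \<xi> = 1" "norm \<zeta> = 1" "0 \<le> r" "r \<le> 1"
  shows "1 - r \<le> norm (r *\<^sub>R \<xi> - \<zeta>)"
    and "norm (\<zeta> - \<xi>) \<le> (1 - r) + norm (r *\<^sub>R \<xi> - \<zeta>)"
    and "norm (r *\<^sub>R \<xi> - \<zeta>) \<le> (1 - r) + norm (\<zeta> - \<xi>)"
    and "norm (r *\<^sub>R \<xi> - \<zeta>) \<le> 2"
proof -
  have n: "norm (r *\<^sub>R \<xi>) = r" using assms by simp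
  have m: "norm (r *\<^sub>R \<xi> - \<xi>) = 1 - r"
  proof -
    have "r *\<^sub>R \<xi> - \<xi> = (r - 1) *\<^sub>R \<xi>" by (simp add: scaleR_diff_left)
    then show ?thesis using assms by simp
  qed
  show "1 - r \<le> norm (r *\<^sub>R \<xi> - \<zeta>)"
    using norm_triangle_ineq2[of \<zeta> "r *\<^sub>R \<xi>"] assms n by (simp add: norm_minus_commute)
  show "norm (\<zeta> - \<xi>) \<le> (1 - r) + norm (r *\<^sub>R \<xi> - \<zeta>)"
    using norm_triangle_ineq[of "\<zeta> - r *\<^sub>R \<xi>" "r *\<^sub>R \<xi> - \<xi>"] m by (simp add: norm_minus_commute)
  show "norm (r *\<^sub>R \<xi> - \<zeta>) \<le> (1 - r) + norm (\<zeta> - \<xi>)"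
    using norm_triangle_ineq[of "r *\<^sub>R \<xi> - \<xi>" "\<xi> - \<zeta>"] m by (simp add: norm_minus_commute)
  show "norm (r *\<^sub>R \<xi> - \<zeta>) \<le> 2"
    using norm_triangle_ineq4[of "r *\<^sub>R \<xi>" \<zeta>] assms n by simp
qed

context majorant_fun
begin

text \<open>Only chord lengths in [\<delta>, 1] are kept. There \<delta> + t \<le> 2 t, the origin
  of the factor 2^(-(n+\<alpha>)), and the density turns t^(-(n+\<alpha>)) into the weight
  t^(-(2+\<alpha>)) of (C2).\<close>

lemma weighted_kernel_lower_bound:
  assumes n: "CARD('n) \<ge> 2" and \<alpha>: "\<alpha> > -1"
  shows "\<exists>c>0. \<forall>\<xi>\<in>sphere (0::real^'n) 1. \<forall>\<delta>\<in>{0<..1}.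
    ennreal (c * \<delta> powr (1 + \<alpha>)) * (\<integral>\<^sup>+t. ennreal (\<omega> \<bar>t\<bar> / t powr (2 + \<alpha>)) * indicator {\<delta>..1} t \<partial>lborel)
    \<le> (\<integral>\<^sup>+\<zeta>. ennreal (\<delta> powr (1 + \<alpha>) * \<omega> (norm (\<zeta> - \<xi>)) / (\<delta> + norm (\<zeta> - \<xi>)) powr (real CARD('n) + \<alpha>)) \<partial>sphere_measure)"
proof -
  define N where "N = real CARD('n)"
  have N: "N \<ge> 2" using n by (simp add: N_def)
  obtain k where k: "k > 0" and lower: "\<And>f \<xi>. f \<in> borel_measurable borel \<Longrightarrow> \<xi> \<in> sphere (0::real^'n) 1 \<Longrightarrow>
     ennreal k * (\<integral>\<^sup>+t. f t * ennreal (t powr (N - 2)) * indicator {0..1} t \<partial>lborel)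
       \<le> (\<integral>\<^sup>+\<zeta>. f (norm (\<zeta> - \<xi>)) \<partial>sphere_measure)"
    using nn_integral_sphere_measure_chord_bounds[OF n] unfolding N_def by blast
  define c where "c = 2 powr (- (N + \<alpha>))"
  have c: "c > 0" by (simp add: c_def)
  have "ennreal (k * c * \<delta> powr (1 + \<alpha>)) * (\<integral>\<^sup>+t. ennreal (\<omega> \<bar>t\<bar> / t powr (2 + \<alpha>)) * indicator {\<delta>..1} t \<partial>lborel)
    \<le> (\<integral>\<^sup>+\<zeta>. ennreal (\<delta> powr (1 + \<alpha>) * \<omega> (norm (\<zeta> - \<xi>)) / (\<delta> + norm (\<zeta> - \<xi>)) powr (N + \<alpha>)) \<partial>sphere_measure)"
    if \<xi>: "\<xi> \<in> sphere (0::real^'n) 1" and \<delta>: "0 < \<delta>" "\<delta> \<le> 1" for \<xi> \<delta>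
  proof -
    define f where "f t = ennreal (\<delta> powr (1 + \<alpha>) * \<omega> \<bar>t\<bar> / (\<delta> + t) powr (N + \<alpha>))" for t
    have [measurable]: "f \<in> borel_measurable borel" unfolding f_def by measurable
    have "ennreal (k * c * \<delta> powr (1 + \<alpha>)) * (\<integral>\<^sup>+t. ennreal (\<omega> \<bar>t\<bar> / t powr (2 + \<alpha>)) * indicator {\<delta>..1} t \<partial>lborel)
      = ennreal k * (\<integral>\<^sup>+t. ennreal (c * \<delta> powr (1 + \<alpha>)) * (ennreal (\<omega> \<bar>t\<bar> / t powr (2 + \<alpha>)) * indicator {\<delta>..1} t) \<partial>lborel)"
      using k c by (subst nn_integral_cmult) (auto simp: ennreal_mult mult.assoc)
    also have "\<dots> \<le> ennreal k * (\<integral>\<^sup>+t. f t * ennreal (t powr (N - 2)) * indicator {0..1} t \<partial>lborel)"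
    proof (intro mult_left_mono nn_integral_mono)
      fix t :: real
      show "ennreal (c * \<delta> powr (1 + \<alpha>)) * (ennreal (\<omega> \<bar>t\<bar> / t powr (2 + \<alpha>)) * indicator {\<delta>..1} t)
         \<le> f t * ennreal (t powr (N - 2)) * indicator {0..1} t"
      proof (cases "t \<in> {\<delta>..1}")
        case True
        then have t: "t > 0" "\<delta> \<le> t" using \<delta> by auto
        have "c * (1 / t powr (2 + \<alpha>)) = t powr (N - 2) / (2 * t) powr (N + \<alpha>)"
          using t by (simp add: c_def powr_mult powr_minus powr_add powr_diff field_simps power2_eq_square)
        also have "\<dots> \<le> t powr (N - 2) / (\<delta> + t) powr (N + \<alpha>)"
          using t \<delta> N \<alpha> by (intro divide_left_mono powr_mono2) auto
        finally have "(\<delta> powr (1 + \<alpha>) * \<omega> t) * (c * (1 / t powr (2 + \<alpha>))) \<le> (\<delta> powr (1 + \<alpha>) * \<omega> t) * (t powr (N - 2) / (\<delta> + t) powr (N + \<alpha>))"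
          using t by (intro mult_left_mono) (auto simp: nonneg)
        then have "ennreal (c * \<delta> powr (1 + \<alpha>) * (\<omega> \<bar>t\<bar> / t powr (2 + \<alpha>))) \<le> ennreal (\<delta> powr (1 + \<alpha>) * \<omega> \<bar>t\<bar> / (\<delta> + t) powr (N + \<alpha>) * t powr (N - 2))"
          using t by (intro ennreal_leI) (simp add: mult_ac)
        moreover have "f t * ennreal (t powr (N - 2)) = ennreal (\<delta> powr (1 + \<alpha>) * \<omega> \<bar>t\<bar> / (\<delta> + t) powr (N + \<alpha>) * t powr (N - 2))"
          unfolding f_def by (subst ennreal_mult''[symmetric]) auto
        moreover have "ennreal (c * \<delta> powr (1 + \<alpha>) * (\<omega> \<bar>t\<bar> / t powr (2 + \<alpha>))) = ennreal (c * \<delta> powr (1 + \<alpha>)) * ennreal (\<omega> \<bar>t\<bar> / t powr (2 + \<alpha>))"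
          using c by (intro ennreal_mult') auto
        ultimately show ?thesis using True \<delta> by simp
      qed simp
    qed simp
    also have "\<dots> \<le> (\<integral>\<^sup>+\<zeta>. f (norm (\<zeta> - \<xi>)) \<partial>sphere_measure)"
      by (rule lower[OF _ \<xi>]) measurable
    finally show ?thesis by (simp add: f_def)
  qed
  then show ?thesis using k c unfolding N_def by (intro exI[of _ "k * c"]) auto
qed

end

context regular_majorant
begin

text \<open>Three ranges of the chord length. For t < \<delta> the integrand, density included, is
  at most \<omega>(\<delta>)/\<delta> on an interval of length \<delta>. For \<delta> \<le> t \<le>
  1 it is at most the integrand of (C2). For t \<ge> 1 it is at most \<delta>^(1+\<alpha>)
  \<omega>(2), and \<delta>^(1+\<alpha>) is bounded by a multiple of \<omega>(\<delta>).\<close>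

lemma weighted_kernel_upper_bound:
  assumes n: "CARD('n) \<ge> 2"
  shows "\<exists>C>0. \<forall>\<xi>\<in>sphere (0::real^'n) 1. \<forall>\<delta>\<in>{0<..1}.
    (\<integral>\<^sup>+\<zeta>. ennreal (\<delta> powr (1 + \<alpha>) * \<omega> (norm (\<zeta> - \<xi>)) / (\<delta> + norm (\<zeta> - \<xi>)) powr (real CARD('n) + \<alpha>)) \<partial>sphere_measure)
    \<le> ennreal (C * \<omega> \<delta>)"
proof -
  define N where "N = real CARD('n)"
  have N: "N \<ge> 2" using n by (simp add: N_def)
  obtain K where K: "K > 0" and upper: "\<And>f \<xi> M. f \<in> borel_measurable borel \<Longrightarrow> \<xi> \<in> sphere (0::real^'n) 1 \<Longrightarrow>
     (\<And>t. t \<in> {1..2} \<Longrightarrow> f t \<le> M) \<Longrightarrow> (\<integral>\<^sup>+\<zeta>. f (norm (\<zeta> - \<xi>)) \<partial>sphere_measure)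
       \<le> ennreal K * (\<integral>\<^sup>+t. f t * ennreal (t powr (N - 2)) * indicator {0..1} t \<partial>lborel) + M"
    using nn_integral_sphere_measure_chord_bounds[OF n] unfolding N_def by blast
  obtain C1 where C1: "C1 > 0" and C2': "\<And>h. 0 < h \<Longrightarrow> h \<le> 1 \<Longrightarrow> ennreal (h powr (1 + \<alpha>)) *
     (\<integral>\<^sup>+t. ennreal (\<omega> \<bar>t\<bar> / t powr (2 + \<alpha>)) * indicator {h..1} t \<partial>lborel) \<le> ennreal (C1 * \<omega> h)"
    using nn_integral_C2 by auto
  obtain C3 where C3: "C3 > 0" and W: "\<And>h. 0 < h \<Longrightarrow> h \<le> 1 \<Longrightarrow> h powr (1 + \<alpha>) \<le> C3 * \<omega> h"
    using powr_le by auto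
  have "(\<integral>\<^sup>+\<zeta>. ennreal (\<delta> powr (1 + \<alpha>) * \<omega> (norm (\<zeta> - \<xi>)) / (\<delta> + norm (\<zeta> - \<xi>)) powr (N + \<alpha>)) \<partial>sphere_measure)
    \<le> ennreal ((K * (1 + C1) + C3 * \<omega> 2) * \<omega> \<delta>)"
    if \<xi>: "\<xi> \<in> sphere (0::real^'n) 1" and \<delta>: "0 < \<delta>" "\<delta> \<le> 1" for \<xi> \<delta>
  proof -
    define f where "f t = ennreal (\<delta> powr (1 + \<alpha>) * \<omega> \<bar>t\<bar> / (\<delta> + t) powr (N + \<alpha>))" for t
    have [measurable]: "f \<in> borel_measurable borel" unfolding f_def by measurable
    have w\<delta>: "\<omega> \<delta> \<ge> 0" using \<delta> by (simp add: nonneg)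
    have M: "f t \<le> ennreal (C3 * \<omega> 2 * \<omega> \<delta>)" if t: "t \<in> {1..2}" for t
    proof -
      have "1 powr (N + \<alpha>) \<le> (\<delta> + t) powr (N + \<alpha>)"
        using t \<delta> N \<alpha> by (intro powr_mono2) auto
      then have "\<delta> powr (1 + \<alpha>) * \<omega> t / (\<delta> + t) powr (N + \<alpha>) \<le> \<delta> powr (1 + \<alpha>) * \<omega> t / 1"
        using t by (intro divide_left_mono mult_nonneg_nonneg) (auto simp: nonneg)
      also have "\<dots> \<le> (C3 * \<omega> \<delta>) * \<omega> 2"
        using t W[OF \<delta>] by (auto intro!: mult_mono mono simp: nonneg w\<delta> C3 less_imp_le)
      finally show ?thesis using t by (auto simp: f_def mult_ac intro!: ennreal_leI)
    qed
    have fm: "f t * ennreal (t powr (N - 2)) = ennreal (\<delta> powr (1 + \<alpha>) * \<omega> \<bar>t\<bar> / (\<delta> + t) powr (N + \<alpha>) * t powr (N - 2))" for t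
      unfolding f_def by (subst ennreal_mult''[symmetric]) auto
    have pw: "f t * ennreal (t powr (N - 2)) * indicator {0..1} t \<le> ennreal (\<omega> \<delta> / \<delta>) * indicator {0..\<delta>} t +
       ennreal (\<delta> powr (1 + \<alpha>)) * (ennreal (\<omega> \<bar>t\<bar> / t powr (2 + \<alpha>)) * indicator {\<delta>..1} t)" for t
    proof -
      consider "t = 0" | "0 < t" "t < \<delta>" | "\<delta> \<le> t" "t \<le> 1" | "t \<notin> {0..1}" using \<delta> by fastforce
      then show ?thesis
      proof cases
        case 2
        have "\<delta> powr (1 + \<alpha>) * \<omega> t / (\<delta> + t) powr (N + \<alpha>) * t powr (N - 2)
           \<le> \<delta> powr (1 + \<alpha>) * \<omega> \<delta> / \<delta> powr (N + \<alpha>) * \<delta> powr (N - 2)"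
          using 2 \<delta> N \<alpha> by (intro mult_mono frac_le mult_left_mono mono powr_mono2 mult_nonneg_nonneg divide_nonneg_nonneg) (auto simp: nonneg)
        also have "\<dots> = \<omega> \<delta> / \<delta>"
          using \<delta> by (simp add: powr_add powr_diff field_simps power2_eq_square)
        finally have "ennreal (\<delta> powr (1 + \<alpha>) * \<omega> t / (\<delta> + t) powr (N + \<alpha>) * t powr (N - 2)) \<le> ennreal (\<omega> \<delta> / \<delta>)"
          by (rule ennreal_leI)
        then show ?thesis using 2 \<delta> by (simp add: fm)
      next
        case 3
        then have t: "t > 0" using \<delta> by simp
        have "\<delta> powr (1 + \<alpha>) * \<omega> t / (\<delta> + t) powr (N + \<alpha>) * t powr (N - 2)
           \<le> \<delta> powr (1 + \<alpha>) * \<omega> t / t powr (N + \<alpha>) * t powr (N - 2)"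
          using t \<delta> N \<alpha> by (intro mult_right_mono divide_left_mono powr_mono2 mult_nonneg_nonneg) (auto simp: nonneg)
        also have "\<dots> = \<delta> powr (1 + \<alpha>) * (\<omega> t / t powr (2 + \<alpha>))"
          using t by (simp add: powr_add powr_diff field_simps power2_eq_square)
        finally have "ennreal (\<delta> powr (1 + \<alpha>) * \<omega> t / (\<delta> + t) powr (N + \<alpha>) * t powr (N - 2)) \<le> ennreal (\<delta> powr (1 + \<alpha>) * (\<omega> t / t powr (2 + \<alpha>)))"
          by (rule ennreal_leI)
        then have "f t * ennreal (t powr (N - 2)) \<le> ennreal (\<delta> powr (1 + \<alpha>)) * ennreal (\<omega> \<bar>t\<bar> / t powr (2 + \<alpha>))"
          using t by (simp only: fm ennreal_mult'[OF powr_ge_zero] abs_of_pos)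
        then show ?thesis using 3 t by (simp add: add_increasing)
      qed (auto simp: indicator_def)
    qed
    have "(\<integral>\<^sup>+\<zeta>. f (norm (\<zeta> - \<xi>)) \<partial>sphere_measure)
       \<le> ennreal K * (\<integral>\<^sup>+t. f t * ennreal (t powr (N - 2)) * indicator {0..1} t \<partial>lborel) + ennreal (C3 * \<omega> 2 * \<omega> \<delta>)"
      by (rule upper[OF _ \<xi> M]) measurable
    also have "(\<integral>\<^sup>+t. f t * ennreal (t powr (N - 2)) * indicator {0..1} t \<partial>lborel) \<le> (\<integral>\<^sup>+t. ennreal (\<omega> \<delta> / \<delta>) * indicator {0..\<delta>} t +
       ennreal (\<delta> powr (1 + \<alpha>)) * (ennreal (\<omega> \<bar>t\<bar> / t powr (2 + \<alpha>)) * indicator {\<delta>..1} t) \<partial>lborel)"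
      by (intro nn_integral_mono pw)
    also have "\<dots> = ennreal (\<omega> \<delta> / \<delta>) * ennreal \<delta> + ennreal (\<delta> powr (1 + \<alpha>)) * (\<integral>\<^sup>+t. ennreal (\<omega> \<bar>t\<bar> / t powr (2 + \<alpha>)) * indicator {\<delta>..1} t \<partial>lborel)"
      using \<delta> by (subst nn_integral_add) (auto simp: nn_integral_cmult)
    also have "\<dots> \<le> ennreal (\<omega> \<delta> / \<delta>) * ennreal \<delta> + ennreal (C1 * \<omega> \<delta>)"
      by (intro add_left_mono C2' \<delta>)
    also have "\<dots> = ennreal ((1 + C1) * \<omega> \<delta>)"
      using \<delta> w\<delta> C1 by (simp add: algebra_simps flip: ennreal_mult' ennreal_plus)
    also have "ennreal K * ennreal ((1 + C1) * \<omega> \<delta>) + ennreal (C3 * \<omega> 2 * \<omega> \<delta>) = ennreal ((K * (1 + C1) + C3 * \<omega> 2) * \<omega> \<delta>)"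
      using K C1 C3 w\<delta> nonneg[of 2] by (simp add: algebra_simps flip: ennreal_mult' ennreal_plus)
    finally have "(\<integral>\<^sup>+\<zeta>. f (norm (\<zeta> - \<xi>)) \<partial>sphere_measure) \<le> ennreal ((K * (1 + C1) + C3 * \<omega> 2) * \<omega> \<delta>)"
      by (simp add: add_right_mono mult_left_mono)
    then show ?thesis by (simp add: f_def)
  qed
  moreover have "K * (1 + C1) + C3 * \<omega> 2 > 0"
    using K C1 C3 nonneg[of 2] by (intro add_pos_nonneg mult_pos_pos mult_nonneg_nonneg) auto
  ultimately show ?thesis unfolding N_def by (intro exI[of _ "K * (1 + C1) + C3 * \<omega> 2"]) auto
qed

text \<open>Let h be the difference of the radii. For chords t < 4 h there is no cancellation to
  exploit: both powers are bounded separately, and integrating t^\<alpha> gives h^(1+\<alpha>). For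
  longer chords the mean value theorem gives h t^(\<alpha>-1) after multiplication by the density.
  The summands 1 contribute multiples of h, hence of \<omega>(h). The bound h \<le> 1/4 ensures that
  all chords of length at least 1 are of the second kind.\<close>

lemma chord_powr_difference:
  assumes n: "CARD('n) \<ge> 2"
  shows "\<exists>C>0. \<forall>\<xi>\<in>sphere (0::real^'n) 1. \<forall>r1\<in>{0..1}. \<forall>r2\<in>{0..1}. 0 < \<bar>r1 - r2\<bar> \<longrightarrow> \<bar>r1 - r2\<bar> \<le> 1/4 \<longrightarrow>
    (\<integral>\<^sup>+\<zeta>. ennreal \<bar>norm (r1 *\<^sub>R \<xi> - \<zeta>) powr (2 + \<alpha> - real CARD('n)) - norm (r2 *\<^sub>R \<xi> - \<zeta>) powr (2 + \<alpha> - real CARD('n))\<bar> \<partial>sphere_measure)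
    \<le> ennreal (C * \<omega> \<bar>r1 - r2\<bar>)"
proof -
  define N where "N = real CARD('n)"
  have N: "N \<ge> 2" using n by (simp add: N_def)
  define q where "q = 2 + \<alpha> - N"
  obtain K where K: "K > 0" and upper: "\<And>f \<xi> M. f \<in> borel_measurable borel \<Longrightarrow> \<xi> \<in> sphere (0::real^'n) 1 \<Longrightarrow>
     (\<And>t. t \<in> {1..2} \<Longrightarrow> f t \<le> M) \<Longrightarrow> (\<integral>\<^sup>+\<zeta>. f (norm (\<zeta> - \<xi>)) \<partial>sphere_measure)
       \<le> ennreal K * (\<integral>\<^sup>+t. f t * ennreal (t powr (N - 2)) * indicator {0..1} t \<partial>lborel) + M"
    using nn_integral_sphere_measure_chord_bounds[OF n] unfolding N_def by blast
  obtain C1 where C1: "C1 > 0" and LI: "\<And>h. 0 < h \<Longrightarrow> h \<le> 1 \<Longrightarrow>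
     ennreal h * (\<integral>\<^sup>+t. ennreal (t powr (\<alpha> - 1)) * indicator {h..1} t \<partial>lborel) \<le> ennreal (C1 * \<omega> h)"
    using log_integral_le by auto
  obtain C3 where C3: "C3 > 0" and W: "\<And>h. 0 < h \<Longrightarrow> h \<le> 1 \<Longrightarrow> h powr (1 + \<alpha>) \<le> C3 * \<omega> h"
    using powr_le by auto
  define C4 where "C4 = 1 / \<omega> 1"
  have C4: "C4 > 0" by (simp add: C4_def pos)
  have lin: "h \<le> C4 * \<omega> h" if "0 < h" "h \<le> 1" for h
    using linear_lower[OF that] pos[of 1] by (simp add: C4_def field_simps)
  define K1 where "K1 = \<bar>q\<bar> * 2 powr \<bar>q - 1\<bar> * 2 powr \<bar>q - 1\<bar>"
  define K2 where "K2 = 2 * 2 powr \<bar>q\<bar>"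
  have K12: "K1 \<ge> 0" "K2 > 0" by (simp_all add: K1_def K2_def)
  define K3 where "K3 = K1 * (2 powr \<bar>q - 1\<bar> + 1)"
  have K3: "K3 \<ge> 0" using K12 by (simp add: K3_def)
  define B where "B = K * (K2 * (4 powr (1 + \<alpha>) / (1 + \<alpha>) * C3 + 4 * C4) + K1 * (C1 + C4)) + K3 * C4"
  have B: "B > 0"
  proof -
    have "K2 * (4 powr (1 + \<alpha>) / (1 + \<alpha>) * C3 + 4 * C4) > 0" 
    proof -
      have "4 powr (1 + \<alpha>) / (1 + \<alpha>) > 0" using \<alpha> by simp
      then show ?thesis using K12 C3 C4 by (intro mult_pos_pos add_pos_pos) auto
    qed
    moreover have "K1 * (C1 + C4) \<ge> 0" "K3 * C4 \<ge> 0" using K12 K3 C1 C4 by auto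
    ultimately show ?thesis using K by (auto simp: B_def intro!: add_pos_nonneg mult_pos_pos)
  qed
  have "(\<integral>\<^sup>+\<zeta>. ennreal \<bar>norm (r1 *\<^sub>R \<xi> - \<zeta>) powr q - norm (r2 *\<^sub>R \<xi> - \<zeta>) powr q\<bar> \<partial>sphere_measure)
    \<le> ennreal (B * \<omega> \<bar>r1 - r2\<bar>)"
    if \<xi>: "\<xi> \<in> sphere (0::real^'n) 1" and r1: "0 \<le> r1" "r1 \<le> 1" and r2: "0 \<le> r2" "r2 \<le> 1"
      and h0: "0 < \<bar>r1 - r2\<bar>" "\<bar>r1 - r2\<bar> \<le> 1/4" for \<xi> r1 r2
  proof -
    define h where "h = \<bar>r1 - r2\<bar>"
    have h: "0 < h" "h \<le> 1/4" "h \<le> 1" using h0 by (auto simp: h_def)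
    \<comment> \<open>The value \<infinity> makes the bound trivial at \<zeta> = \<xi> and costs
      nothing in the integral, since the density \<open>t powr (N - 2)\<close> is 0 at t = 0, even
      for N = 2.\<close>
    define f where "f t = (if t \<le> 0 then \<infinity> else if t < 4 * h then ennreal (K2 * (t powr q + 1)) else ennreal (K1 * h * (t powr (q - 1) + 1)))" for t
    have [measurable]: "f \<in> borel_measurable borel" unfolding f_def by measurable
    have pointwise: "ennreal \<bar>norm (r1 *\<^sub>R \<xi> - \<zeta>) powr q - norm (r2 *\<^sub>R \<xi> - \<zeta>) powr q\<bar> \<le> f (norm (\<zeta> - \<xi>))"
      if \<zeta>: "\<zeta> \<in> space sphere_measure" for \<zeta>
    proof (cases "\<zeta> = \<xi>")
      case True
      then show ?thesis by (simp add: f_def)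
    next
      case False
      define t where "t = norm (\<zeta> - \<xi>)"
      define v where "v r = norm (r *\<^sub>R \<xi> - \<zeta>)" for r
      have t: "t > 0" using False by (simp add: t_def)
      have vr: "t / 2 \<le> v r" "v r \<le> 2" if "0 \<le> r" "r \<le> 1" for r
        using norm_radial_diff_bounds[of \<xi> \<zeta> r] that \<xi> \<zeta> by (auto simp: v_def t_def)
      have vd: "\<bar>v r1 - v r2\<bar> \<le> h"
      proof -
        have "\<bar>v r1 - v r2\<bar> \<le> norm ((r1 *\<^sub>R \<xi> - \<zeta>) - (r2 *\<^sub>R \<xi> - \<zeta>))"
          unfolding v_def by (rule norm_triangle_ineq3)
        also have "(r1 *\<^sub>R \<xi> - \<zeta>) - (r2 *\<^sub>R \<xi> - \<zeta>) = (r1 - r2) *\<^sub>R \<xi>" by (simp add: scaleR_diff_left)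
        finally show ?thesis using \<xi> by (simp add: h_def)
      qed
      show ?thesis
      proof (cases "t < 4 * h")
        case True
        have "\<bar>v r1 powr q - v r2 powr q\<bar> \<le> v r1 powr q + v r2 powr q"
          by (rule order_trans[OF abs_triangle_ineq4]) simp
        also have "\<dots> \<le> 2 powr \<bar>q\<bar> * (t powr q + 1) + 2 powr \<bar>q\<bar> * (t powr q + 1)"
          by (intro add_mono powr_le_of_half t vr r1 r2)
        also have "\<dots> = K2 * (t powr q + 1)" by (simp add: K2_def)
        finally show ?thesis using True t by (auto simp: f_def v_def t_def intro!: ennreal_leI)
      next
        case False
        have v1: "v r1 > 0" using vr[OF r1] t by linarith
        \<comment> \<open>The threshold 4 h comes from here: t \<ge> 4 h and
          \<open>v r1 \<ge> t / 2\<close> give h \<le> \<open>v r1 / 2\<close>, the closeness that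
          the mean value estimate requires.\<close>
        have "\<bar>v r1 powr q - v r2 powr q\<bar> \<le> \<bar>q\<bar> * 2 powr \<bar>q - 1\<bar> * v r1 powr (q - 1) * \<bar>v r1 - v r2\<bar>"
          by (rule powr_diff_bound[OF v1]) (use vd vr[OF r1] False in linarith)
        also have "\<dots> \<le> \<bar>q\<bar> * 2 powr \<bar>q - 1\<bar> * (2 powr \<bar>q - 1\<bar> * (t powr (q - 1) + 1)) * h"
          by (intro mult_mono powr_le_of_half t vr r1 vd) auto
        also have "\<dots> = K1 * h * (t powr (q - 1) + 1)" by (simp add: K1_def)
        finally show ?thesis using False t by (auto simp: f_def v_def t_def intro!: ennreal_leI)
      qed
    qed
    have M: "f t \<le> ennreal (K3 * C4 * \<omega> h)" if t: "t \<in> {1..2}" for t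
    proof -
      have e: "t powr (q - 1) \<le> 2 powr \<bar>q - 1\<bar>"
      proof -
        have "t powr (q - 1) \<le> t powr \<bar>q - 1\<bar>" using t by (intro powr_mono) auto
        also have "\<dots> \<le> 2 powr \<bar>q - 1\<bar>" using t by (intro powr_mono2) auto
        finally show ?thesis .
      qed
      have "K1 * h * (t powr (q - 1) + 1) \<le> K1 * h * (2 powr \<bar>q - 1\<bar> + 1)"
        using K12 h e by (intro mult_left_mono) auto
      also have "\<dots> = K3 * h" by (simp add: K3_def)
      also have "\<dots> \<le> K3 * (C4 * \<omega> h)" using K3 lin[OF h(1,3)] by (intro mult_left_mono)
      finally show ?thesis using t h by (auto simp: f_def mult.assoc intro!: ennreal_leI)
    qed
    have pw: "f t * ennreal (t powr (N - 2)) * indicator {0..1} t \<le>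
       ennreal K2 * (ennreal (t powr \<alpha>) * indicator {0..4 * h} t + indicator {0..4 * h} t) +
       ennreal (K1 * h) * (ennreal (t powr (\<alpha> - 1)) * indicator {h..1} t + indicator {h..1} t)" for t
    proof (cases "0 < t \<and> t \<le> 1")
      case False
      then have "t = 0 \<or> t \<notin> {0..1}" by auto
      then show ?thesis by auto
    next
      case True
      then have t: "0 < t" "t \<le> 1" by auto
      have tN: "t powr (N - 2) \<le> 1" using powr_mono2[of "N - 2" t 1] t N by simp
      show ?thesis
      proof (cases "t < 4 * h")
        case True
        have "t powr q * t powr (N - 2) = t powr \<alpha>" by (simp add: q_def flip: powr_add)
        then have "K2 * (t powr q + 1) * t powr (N - 2) \<le> K2 * (t powr \<alpha> + 1)"
          using K12 tN by (simp add: algebra_simps)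
        then have "f t * ennreal (t powr (N - 2)) \<le> ennreal (K2 * (t powr \<alpha> + 1))"
          using True t K12 by (simp add: f_def ennreal_leI flip: ennreal_mult')
        also have "\<dots> = ennreal K2 * (ennreal (t powr \<alpha>) + 1)"
          using K12 by (simp add: ennreal_mult' flip: ennreal_1)
        finally show ?thesis using True t by (simp add: add_increasing2)
      next
        case False
        have "t powr (q - 1) * t powr (N - 2) = t powr (\<alpha> - 1)" by (simp add: q_def flip: powr_add)
        then have "(t powr (q - 1) + 1) * t powr (N - 2) \<le> (t powr (\<alpha> - 1) + 1)"
          using tN by (simp add: algebra_simps)
        then have "K1 * h * ((t powr (q - 1) + 1) * t powr (N - 2)) \<le> K1 * h * (t powr (\<alpha> - 1) + 1)"
          using K12 h by (intro mult_left_mono) auto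
        then have "f t * ennreal (t powr (N - 2)) \<le> ennreal (K1 * h * (t powr (\<alpha> - 1) + 1))"
          using False t K12 h by (simp add: f_def ennreal_leI mult.assoc flip: ennreal_mult')
        also have "\<dots> = ennreal (K1 * h) * (ennreal (t powr (\<alpha> - 1)) + 1)"
          using K12 h by (simp add: ennreal_mult' flip: ennreal_1)
        finally show ?thesis using False t h by (simp add: add_increasing)
      qed
    qed
    have i1: "(\<integral>\<^sup>+t. ennreal (t powr \<alpha>) * indicator {0..4 * h} t \<partial>lborel) = ennreal ((4 * h) powr (\<alpha> + 1) / (\<alpha> + 1))"
      using h \<alpha> by (intro nn_integral_has_integral_lebesgue' has_integral_powr_from_0) auto
    have wh: "\<omega> h \<ge> 0" using h by (simp add: nonneg)
    have "(\<integral>\<^sup>+\<zeta>. ennreal \<bar>norm (r1 *\<^sub>R \<xi> - \<zeta>) powr q - norm (r2 *\<^sub>R \<xi> - \<zeta>) powr q\<bar> \<partial>sphere_measure)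
      \<le> (\<integral>\<^sup>+\<zeta>. f (norm (\<zeta> - \<xi>)) \<partial>sphere_measure)"
      by (intro nn_integral_mono pointwise)
    also have "\<dots> \<le> ennreal K * (\<integral>\<^sup>+t. f t * ennreal (t powr (N - 2)) * indicator {0..1} t \<partial>lborel) + ennreal (K3 * C4 * \<omega> h)"
      by (rule upper[OF _ \<xi> M]) measurable
    also have "(\<integral>\<^sup>+t. f t * ennreal (t powr (N - 2)) * indicator {0..1} t \<partial>lborel) \<le>
      (\<integral>\<^sup>+t. ennreal K2 * (ennreal (t powr \<alpha>) * indicator {0..4 * h} t + indicator {0..4 * h} t) +
       ennreal (K1 * h) * (ennreal (t powr (\<alpha> - 1)) * indicator {h..1} t + indicator {h..1} t) \<partial>lborel)"
      by (intro nn_integral_mono pw)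
    also have "\<dots> = ennreal K2 * (ennreal ((4 * h) powr (\<alpha> + 1) / (\<alpha> + 1)) + ennreal (4 * h)) +
       ennreal (K1 * h) * ((\<integral>\<^sup>+t. ennreal (t powr (\<alpha> - 1)) * indicator {h..1} t \<partial>lborel) + ennreal (1 - h))"
      using h by (simp add: nn_integral_add nn_integral_cmult i1)
    also have "ennreal K2 * (ennreal ((4 * h) powr (\<alpha> + 1) / (\<alpha> + 1)) + ennreal (4 * h)) \<le> ennreal (K2 * (4 powr (1 + \<alpha>) / (1 + \<alpha>) * C3 + 4 * C4) * \<omega> h)"
    proof -
      have "(4 * h) powr (\<alpha> + 1) / (\<alpha> + 1) = 4 powr (1 + \<alpha>) / (1 + \<alpha>) * h powr (1 + \<alpha>)"
        using h by (simp add: powr_mult add.commute)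
      also have "\<dots> \<le> 4 powr (1 + \<alpha>) / (1 + \<alpha>) * (C3 * \<omega> h)"
        using W[OF h(1,3)] \<alpha> by (intro mult_left_mono) auto
      finally have "(4 * h) powr (\<alpha> + 1) / (\<alpha> + 1) + 4 * h \<le> 4 powr (1 + \<alpha>) / (1 + \<alpha>) * (C3 * \<omega> h) + 4 * (C4 * \<omega> h)"
        using lin[OF h(1,3)] by linarith
      then have "K2 * ((4 * h) powr (\<alpha> + 1) / (\<alpha> + 1) + 4 * h) \<le> K2 * (4 powr (1 + \<alpha>) / (1 + \<alpha>) * (C3 * \<omega> h) + 4 * (C4 * \<omega> h))"
        using K12 by (intro mult_left_mono) auto
      then have "ennreal (K2 * ((4 * h) powr (\<alpha> + 1) / (\<alpha> + 1) + 4 * h)) \<le> ennreal (K2 * (4 powr (1 + \<alpha>) / (1 + \<alpha>) * C3 + 4 * C4) * \<omega> h)"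
        by (intro ennreal_leI) (simp add: algebra_simps)
      then show ?thesis using K12 h \<alpha> by (simp add: ennreal_mult')
    qed
    also have "ennreal (K1 * h) * ((\<integral>\<^sup>+t. ennreal (t powr (\<alpha> - 1)) * indicator {h..1} t \<partial>lborel) + ennreal (1 - h)) \<le> ennreal (K1 * (C1 + C4) * \<omega> h)"
    proof -
      have "ennreal (K1 * h) * ((\<integral>\<^sup>+t. ennreal (t powr (\<alpha> - 1)) * indicator {h..1} t \<partial>lborel) + ennreal (1 - h))
        = ennreal K1 * (ennreal h * (\<integral>\<^sup>+t. ennreal (t powr (\<alpha> - 1)) * indicator {h..1} t \<partial>lborel) + ennreal h * ennreal (1 - h))"
        using K12 h by (simp add: ennreal_mult distrib_left mult.assoc)
      also have "\<dots> \<le> ennreal K1 * (ennreal (C1 * \<omega> h) + ennreal (C4 * \<omega> h))"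
      proof (intro mult_left_mono add_mono LI)
        have "h * (1 - h) \<le> h * 1" using h by (intro mult_left_mono) auto
        then have "h * (1 - h) \<le> C4 * \<omega> h" using lin[OF h(1,3)] by linarith
        then show "ennreal h * ennreal (1 - h) \<le> ennreal (C4 * \<omega> h)"
          using h by (simp add: ennreal_leI flip: ennreal_mult)
      qed (use h in auto)
      also have "\<dots> = ennreal (K1 * (C1 + C4) * \<omega> h)"
        using K12 C1 C4 wh by (simp add: algebra_simps flip: ennreal_mult' ennreal_plus)
      finally show ?thesis .
    qed
    finally have "(\<integral>\<^sup>+\<zeta>. ennreal \<bar>norm (r1 *\<^sub>R \<xi> - \<zeta>) powr q - norm (r2 *\<^sub>R \<xi> - \<zeta>) powr q\<bar> \<partial>sphere_measure)
      \<le> ennreal K * (ennreal (K2 * (4 powr (1 + \<alpha>) / (1 + \<alpha>) * C3 + 4 * C4) * \<omega> h) + ennreal (K1 * (C1 + C4) * \<omega> h)) + ennreal (K3 * C4 * \<omega> h)"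
      by (simp add: add_right_mono add_left_mono mult_left_mono)
    also have "\<dots> = ennreal (B * \<omega> h)"
    proof -
      have p: "0 \<le> K2 * (4 powr (1 + \<alpha>) / (1 + \<alpha>) * C3 + 4 * C4) * \<omega> h" "0 \<le> K1 * (C1 + C4) * \<omega> h" "0 \<le> K3 * C4 * \<omega> h"
        using K12 C1 C3 C4 K3 wh \<alpha> by auto
      have "B * \<omega> h = K * (K2 * (4 powr (1 + \<alpha>) / (1 + \<alpha>) * C3 + 4 * C4) * \<omega> h + K1 * (C1 + C4) * \<omega> h) + K3 * C4 * \<omega> h"
        by (simp add: B_def algebra_simps)
      then show ?thesis using p K by (simp only: ennreal_plus[symmetric] ennreal_mult'[symmetric] ennreal_plus[OF mult_nonneg_nonneg] add_nonneg_nonneg less_imp_le)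
    qed
    finally show ?thesis by (simp add: h_def)
  qed
  then show ?thesis using B unfolding N_def q_def by (intro exI[of _ B]) auto
qed

end

section \<open>The Poisson kernel\<close>

lemma poisson_kernel_orthogonal:
  fixes T :: "real^'n \<Rightarrow> real^'n"
  assumes T: "orthogonal_transformation T"
  shows "poisson_kernel \<alpha> (T x) (T \<zeta>) = poisson_kernel \<alpha> x \<zeta>"
proof -
  have "norm (T x - T \<zeta>) = norm (x - \<zeta>)"
    using orthogonal_transformation_norm[OF T, of "x - \<zeta>"]
    by (simp add: linear_diff[OF orthogonal_transformation_linear[OF T]])
  then show ?thesis by (simp add: poisson_kernel_def orthogonal_transformation_norm[OF T])
qed

lemma borel_measurable_poisson_kernel [measurable]:
  "(\<lambda>\<zeta>. poisson_kernel \<alpha> x \<zeta>) \<in> borel_measurable borel"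
  unfolding poisson_kernel_def by measurable

text \<open>The factor 2^(1+\<alpha>) comes from 1 - r \<le> 1 - r^2 \<le> 2 (1 - r), and the factor
  3^(n+\<alpha>) from the comparison of |r \<xi> - \<zeta>| with (1 - r) + |\<zeta> - \<xi>| up to a
  factor 3.\<close>

lemma poisson_kernel_bounds:
  fixes \<xi> \<zeta> :: "real^'n"
  assumes n: "CARD('n) \<ge> 2" and \<alpha>: "\<alpha> > -1" and r: "0 \<le> r" "r < 1" and S: "norm \<xi> = 1" "norm \<zeta> = 1"
  shows "poisson_const CARD('n) \<alpha> * ((1 - r) powr (1 + \<alpha>) / ((1 - r) + norm (\<zeta> - \<xi>)) powr (real CARD('n) + \<alpha>))
       \<le> poisson_kernel \<alpha> (r *\<^sub>R \<xi>) \<zeta>"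
    and "poisson_kernel \<alpha> (r *\<^sub>R \<xi>) \<zeta> \<le> poisson_const CARD('n) \<alpha> * (2 powr (1 + \<alpha>) * 3 powr (real CARD('n) + \<alpha>)) *
       ((1 - r) powr (1 + \<alpha>) / ((1 - r) + norm (\<zeta> - \<xi>)) powr (real CARD('n) + \<alpha>))"
proof -
  define m where "m = real CARD('n) + \<alpha>"
  have m: "m > 0" using n \<alpha> by (simp add: m_def)
  define c where "c = poisson_const CARD('n) \<alpha>"
  have c: "c > 0" unfolding c_def by (rule poisson_const_pos[OF \<alpha> n])
  define d where "d = (1 - r) + norm (\<zeta> - \<xi>)"
  have d: "d > 0" using r by (simp add: d_def add_pos_nonneg)
  define v where "v = norm (r *\<^sub>R \<xi> - \<zeta>)"
  have v: "v > 0" "v \<le> d" "d / 3 \<le> v"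
    using norm_radial_diff_bounds[OF S, of r] r by (auto simp: v_def d_def)
  have k: "poisson_kernel \<alpha> (r *\<^sub>R \<xi>) \<zeta> = c * ((1 - r\<^sup>2) powr (1 + \<alpha>) / v powr m)"
    using S r by (simp add: poisson_kernel_def c_def v_def m_def)
  have a: "1 - r\<^sup>2 = (1 - r) * (1 + r)" by (simp add: power2_eq_square algebra_simps)
  have a1: "1 - r \<le> 1 - r\<^sup>2" unfolding a using r mult_left_mono[of 1 "1 + r" "1 - r"] by simp
  have a2: "1 - r\<^sup>2 \<le> 2 * (1 - r)" unfolding a using r mult_left_mono[of "1 + r" 2 "1 - r"] by simp
  have "(1 - r) powr (1 + \<alpha>) / d powr m \<le> (1 - r\<^sup>2) powr (1 + \<alpha>) / v powr m"
    using a1 v m \<alpha> r d by (intro frac_le powr_mono2) auto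
  then show "poisson_const CARD('n) \<alpha> * ((1 - r) powr (1 + \<alpha>) / ((1 - r) + norm (\<zeta> - \<xi>)) powr (real CARD('n) + \<alpha>))
       \<le> poisson_kernel \<alpha> (r *\<^sub>R \<xi>) \<zeta>"
    unfolding k unfolding c_def[symmetric] m_def[symmetric] d_def[symmetric] using c by (intro mult_left_mono) auto
  have "(1 - r\<^sup>2) powr (1 + \<alpha>) / v powr m \<le> (2 * (1 - r)) powr (1 + \<alpha>) / (d / 3) powr m"
    using a1 a2 v m \<alpha> r d by (intro frac_le powr_mono2) auto
  also have "\<dots> = (2 powr (1 + \<alpha>) * 3 powr m) * ((1 - r) powr (1 + \<alpha>) / d powr m)"
  proof -
    have "(2 * (1 - r)) powr (1 + \<alpha>) = 2 powr (1 + \<alpha>) * (1 - r) powr (1 + \<alpha>)"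
      by (rule powr_mult)
    moreover have "(d / 3) powr m = d powr m / 3 powr m"
      by (rule powr_divide)
    ultimately show ?thesis by simp
  qed
  finally have "c * ((1 - r\<^sup>2) powr (1 + \<alpha>) / v powr m) \<le> c * ((2 powr (1 + \<alpha>) * 3 powr m) * ((1 - r) powr (1 + \<alpha>) / d powr m))"
    using c by (intro mult_left_mono) auto
  then show "poisson_kernel \<alpha> (r *\<^sub>R \<xi>) \<zeta> \<le> poisson_const CARD('n) \<alpha> * (2 powr (1 + \<alpha>) * 3 powr (real CARD('n) + \<alpha>)) *
       ((1 - r) powr (1 + \<alpha>) / ((1 - r) + norm (\<zeta> - \<xi>)) powr (real CARD('n) + \<alpha>))"
    unfolding k unfolding c_def[symmetric] m_def[symmetric] d_def[symmetric] by (simp add: mult.assoc)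
qed

lemma poisson_kernel_nonneg:
  assumes "CARD('n) \<ge> 2" "\<alpha> > -1"
  shows "poisson_kernel \<alpha> (x::real^'n) \<zeta> \<ge> 0"
  using poisson_const_pos[OF assms(2,1)] by (simp add: poisson_kernel_def)

lemma polar_decomposition:
  fixes x :: "real^'n"
  obtains \<xi> where "norm \<xi> = 1" "x = norm x *\<^sub>R \<xi>"
proof (cases "x = 0")
  case True
  obtain e :: "real^'n" where "e \<in> Basis" using nonempty_Basis by blast
  then show ?thesis using that[of e] True by simp
next
  case False
  then show ?thesis using that[of "sgn x"] by (simp add: norm_sgn sgn_div_norm)
qed

text \<open>Serves integrability for fixed x; the bound degenerates as x approaches the
  sphere.\<close>

lemma poisson_kernel_bounded:
  fixes x :: "real^'n"
  assumes n: "CARD('n) \<ge> 2" and \<alpha>: "\<alpha> > -1" and x: "norm x < 1"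
  shows "\<exists>b\<ge>0. \<forall>\<zeta>\<in>sphere 0 1. \<bar>poisson_kernel \<alpha> x \<zeta>\<bar> \<le> b"
proof -
  obtain \<xi> :: "real^'n" where \<xi>: "norm \<xi> = 1" "x = norm x *\<^sub>R \<xi>" by (rule polar_decomposition)
  define m where "m = real CARD('n) + \<alpha>"
  have m: "m > 0" using n \<alpha> by (simp add: m_def)
  define c where "c = poisson_const CARD('n) \<alpha> * (2 powr (1 + \<alpha>) * 3 powr m)"
  have c: "c > 0" unfolding c_def using poisson_const_pos[OF \<alpha> n] by simp
  define b where "b = c * ((1 - norm x) powr (1 + \<alpha>) / (1 - norm x) powr m)"
  have "\<bar>poisson_kernel \<alpha> x \<zeta>\<bar> \<le> b" if \<zeta>: "\<zeta> \<in> sphere 0 1" for \<zeta>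
  proof -
    have "poisson_kernel \<alpha> x \<zeta> \<le> c * ((1 - norm x) powr (1 + \<alpha>) / ((1 - norm x) + norm (\<zeta> - \<xi>)) powr m)"
      using poisson_kernel_bounds(2)[OF n \<alpha>, of "norm x" \<xi> \<zeta>] x \<xi> \<zeta> by (simp add: c_def m_def)
    also have "\<dots> \<le> b"
    proof -
      have "1 - norm x + norm (\<zeta> - \<xi>) > 0" using x by (simp add: add_pos_nonneg)
      then show ?thesis
        unfolding b_def using x m c by (intro mult_left_mono divide_left_mono powr_mono2 mult_pos_pos) auto
    qed
    finally show ?thesis using poisson_kernel_nonneg[OF n \<alpha>, of x \<zeta>] by simp
  qed
  moreover have "b \<ge> 0" using c by (simp add: b_def)
  ultimately show ?thesis by blast
qed

lemma integrable_sphere_bounded: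
  fixes f :: "real^'n \<Rightarrow> real"
  assumes "f \<in> borel_measurable sphere_measure" and "\<And>\<zeta>. \<zeta> \<in> sphere 0 1 \<Longrightarrow> \<bar>f \<zeta>\<bar> \<le> b"
  shows "integrable sphere_measure f"
proof -
  interpret prob_space "sphere_measure :: (real^'n) measure" by (rule prob_space_sphere_measure)
  show ?thesis
    by (rule integrable_const_bound[of _ b]) (use assms in auto)
qed

lemma integrable_poisson_kernel:
  fixes x :: "real^'n"
  assumes n: "CARD('n) \<ge> 2" and \<alpha>: "\<alpha> > -1" and x: "norm x < 1"
  shows "integrable sphere_measure (poisson_kernel \<alpha> x)"
proof -
  obtain b where "\<forall>\<zeta>\<in>sphere 0 1. \<bar>poisson_kernel \<alpha> x \<zeta>\<bar> \<le> b"
    using poisson_kernel_bounded[OF assms] by blast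
  then show ?thesis by (intro integrable_sphere_bounded[of _ b]) auto
qed

text \<open>Equal to the Poisson integral of the constant function 1, which is not constant in general.
  In this form, obtained by chord reflection, it makes sense up to the boundary.\<close>

definition poisson_mass :: "real \<Rightarrow> real^'n \<Rightarrow> real" where
  "poisson_mass \<alpha> x = poisson_const CARD('n) \<alpha> *
     (LINT \<zeta>|sphere_measure. norm (x - \<zeta>) powr (2 + \<alpha> - real CARD('n)))"

lemma poisson_mass_sphere:
  fixes \<xi> :: "real^'n"
  assumes n: "CARD('n) \<ge> 2" and \<alpha>: "\<alpha> > -1" and \<xi>: "norm \<xi> = 1"
  shows "poisson_mass \<alpha> \<xi> = 1"
    and "integrable sphere_measure (\<lambda>\<zeta>. norm (\<xi> - \<zeta>) powr (2 + \<alpha> - real CARD('n)))"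
proof -
  have nn: "(\<integral>\<^sup>+\<zeta>. ennreal (norm (\<xi> - \<zeta>) powr (2 + \<alpha> - real CARD('n))) \<partial>sphere_measure) = ennreal (1 / poisson_const CARD('n) \<alpha>)"
    using nn_integral_chord_powr[OF n \<alpha>, of \<xi>] \<xi> by (simp add: norm_minus_commute)
  have p: "poisson_const CARD('n) \<alpha> > 0" by (rule poisson_const_pos[OF \<alpha> n])
  have "(LINT \<zeta>|sphere_measure. norm (\<xi> - \<zeta>) powr (2 + \<alpha> - real CARD('n))) = 1 / poisson_const CARD('n) \<alpha>"
    using p by (intro integral_eq_nn_integral[THEN trans]) (auto simp: nn)
  then show "poisson_mass \<alpha> \<xi> = 1" using p by (simp add: poisson_mass_def)
  show "integrable sphere_measure (\<lambda>\<zeta>. norm (\<xi> - \<zeta>) powr (2 + \<alpha> - real CARD('n)))"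
    by (rule integrableI_nonneg) (auto simp: nn)
qed

lemma integrable_powr_ball:
  fixes x :: "real^'n"
  assumes x: "norm x < 1"
  shows "integrable sphere_measure (\<lambda>\<zeta>. norm (x - \<zeta>) powr q)"
proof -
  have "norm (x - \<zeta>) powr q \<le> 2 powr \<bar>q\<bar> * ((1 - norm x) powr q + 1)" if \<zeta>: "\<zeta> \<in> sphere 0 1" for \<zeta>
  proof (rule powr_le_of_half)
    have "norm \<zeta> - norm x \<le> norm (\<zeta> - x)" by (rule norm_triangle_ineq2)
    then show "(1 - norm x) / 2 \<le> norm (x - \<zeta>)" using x \<zeta> by (simp add: norm_minus_commute)
    show "norm (x - \<zeta>) \<le> 2" using norm_triangle_ineq4[of x \<zeta>] x \<zeta> by simp
  qed (use x in auto)
  then show ?thesis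
    by (intro integrable_sphere_bounded[of _ "2 powr \<bar>q\<bar> * ((1 - norm x) powr q + 1)"]) auto
qed

lemma poisson_mass_ball:
  fixes x :: "real^'n"
  assumes n: "CARD('n) \<ge> 2" and \<alpha>: "\<alpha> > -1" and x: "norm x < 1"
  shows "(LINT \<zeta>|sphere_measure. poisson_kernel \<alpha> x \<zeta>) = poisson_mass \<alpha> x"
proof -
  obtain \<xi> :: "real^'n" where \<xi>: "norm \<xi> = 1" "x = norm x *\<^sub>R \<xi>" by (rule polar_decomposition)
  define c where "c = poisson_const CARD('n) \<alpha>"
  have c: "c > 0" unfolding c_def by (rule poisson_const_pos[OF \<alpha> n])
  define a where "a = (1 - (norm x)\<^sup>2) powr (1 + \<alpha>)"
  define m where "m = real CARD('n) + \<alpha>"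
  have "(1 - (norm x)\<^sup>2) powr (1 + \<alpha>) * (LINT \<zeta>|sphere_measure. norm (x - \<zeta>) powr (- m))
      = (LINT \<zeta>|sphere_measure. norm (x - \<zeta>) powr (2 + \<alpha> - real CARD('n)))"
  proof -
    have "ennreal (a * (LINT \<zeta>|sphere_measure. norm (x - \<zeta>) powr (- m)))
      = ennreal a * (\<integral>\<^sup>+\<zeta>. ennreal (norm (x - \<zeta>) powr (- m)) \<partial>sphere_measure)"
      by (subst nn_integral_eq_integral[OF integrable_powr_ball[OF x]]) (auto simp: a_def ennreal_mult')
    also have "\<dots> = (\<integral>\<^sup>+\<zeta>. ennreal (norm (x - \<zeta>) powr (2 + \<alpha> - real CARD('n))) \<partial>sphere_measure)"
      using nn_integral_poisson_reflect[OF n, of \<xi> "norm x" \<alpha>] x \<xi> by (simp add: a_def m_def)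
    also have "\<dots> = ennreal (LINT \<zeta>|sphere_measure. norm (x - \<zeta>) powr (2 + \<alpha> - real CARD('n)))"
      by (rule nn_integral_eq_integral[OF integrable_powr_ball[OF x]]) auto
    finally show ?thesis
      unfolding a_def by (subst (asm) ennreal_inj) (auto intro!: mult_nonneg_nonneg integral_nonneg)
  qed
  moreover have "poisson_kernel \<alpha> x \<zeta> = c * (a * norm (x - \<zeta>) powr (- m))" for \<zeta>
    unfolding powr_minus_divide by (simp add: poisson_kernel_def c_def a_def m_def)
  ultimately show ?thesis by (simp add: poisson_mass_def c_def a_def)
qed

lemma poisson_mass_orthogonal:
  fixes T :: "real^'n \<Rightarrow> real^'n"
  assumes T: "orthogonal_transformation T"
  shows "poisson_mass \<alpha> (T x) = poisson_mass \<alpha> x"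
proof -
  have "norm (T x - T \<zeta>) = norm (x - \<zeta>)" for \<zeta>
    using orthogonal_transformation_norm[OF T, of "x - \<zeta>"]
    by (simp add: linear_diff[OF orthogonal_transformation_linear[OF T]])
  moreover have "(LINT \<zeta>|sphere_measure. norm (T x - T \<zeta>) powr (2 + \<alpha> - real CARD('n)))
      = (LINT \<zeta>|sphere_measure. norm (T x - \<zeta>) powr (2 + \<alpha> - real CARD('n)))"
    by (rule integral_sphere_measure_orthogonal[OF T]) measurable
  ultimately show ?thesis by (simp add: poisson_mass_def)
qed

text \<open>A relative estimate of Harnack type: the error is proportional to the kernel itself, so
  the weighted integral of the kernel can be reused. Both 1 - |x1|^2 and |x1 - \<zeta>| are at least
  the distance d from x1 to the sphere, while they change by at most 2 u and u, where u = |x1 - x2|.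
  With u \<le> d/4 both changes are at most half of the respective value, and the relative change of
  each power is of order u/d.\<close>

lemma poisson_kernel_difference:
  fixes x1 x2 \<zeta> :: "real^'n"
  assumes n: "CARD('n) \<ge> 2" and \<alpha>: "\<alpha> > -1" and x: "norm x1 < 1" and h: "norm (x1 - x2) \<le> (1 - norm x1) / 4"
    and \<zeta>: "norm \<zeta> = 1"
  defines "m \<equiv> real CARD('n) + \<alpha>"
  shows "\<bar>poisson_kernel \<alpha> x1 \<zeta> - poisson_kernel \<alpha> x2 \<zeta>\<bar>
    \<le> (2 * ((1 + \<alpha>) * 2 powr \<bar>\<alpha>\<bar>) + 2 powr (1 + \<alpha>) * (m * 2 powr (m + 1))) *
      (norm (x1 - x2) / (1 - norm x1)) * poisson_kernel \<alpha> x1 \<zeta>"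
proof -
  define s where "s = 1 + \<alpha>"
  have s: "s > 0" using \<alpha> by (simp add: s_def)
  have m: "m > 0" using n \<alpha> by (simp add: m_def)
  define c where "c = poisson_const CARD('n) \<alpha>"
  have c: "c > 0" unfolding c_def by (rule poisson_const_pos[OF \<alpha> n])
  define d where "d = 1 - norm x1"
  define u where "u = norm (x1 - x2)"
  have d: "d > 0" "u \<le> d / 4" "u \<ge> 0" using x h by (auto simp: d_def u_def)
  have ud: "\<bar>norm x1 - norm x2\<bar> \<le> u" unfolding u_def by (rule norm_triangle_ineq3)
  have x2: "norm x2 < 1" using ud d by (auto simp: d_def)
  define a1 a2 b1 b2 where ab: "a1 = 1 - (norm x1)\<^sup>2" "a2 = 1 - (norm x2)\<^sup>2" "b1 = norm (x1 - \<zeta>)" "b2 = norm (x2 - \<zeta>)"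
  have a1d: "d \<le> a1"
  proof -
    have "(norm x1)\<^sup>2 \<le> norm x1" using x by (simp add: power2_eq_square mult_left_le_one_le)
    then show ?thesis by (simp add: ab d_def)
  qed
  have b1d: "d \<le> b1" using norm_triangle_ineq2[of \<zeta> x1] \<zeta> by (simp add: ab d_def norm_minus_commute)
  have da: "\<bar>a1 - a2\<bar> \<le> 2 * u"
  proof -
    have "a1 - a2 = (norm x2 - norm x1) * (norm x1 + norm x2)"
      by (simp add: ab power2_eq_square algebra_simps)
    then have "\<bar>a1 - a2\<bar> = \<bar>norm x1 - norm x2\<bar> * (norm x1 + norm x2)"
      by (simp add: abs_mult abs_minus_commute)
    also have "\<dots> \<le> u * 2" using ud x x2 by (intro mult_mono) auto
    finally show ?thesis by simp
  qed
  have db: "\<bar>b1 - b2\<bar> \<le> u"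
    unfolding ab u_def using norm_triangle_ineq3[of "x1 - \<zeta>" "x2 - \<zeta>"] by simp
  have A: "\<bar>a1 powr s - a2 powr s\<bar> \<le> 2 * (s * 2 powr \<bar>\<alpha>\<bar>) * (u / d) * a1 powr s"
  proof -
    have "\<bar>a1 powr s - a2 powr s\<bar> \<le> \<bar>s\<bar> * 2 powr \<bar>s - 1\<bar> * a1 powr (s - 1) * \<bar>a1 - a2\<bar>"
      by (rule powr_diff_bound) (use a1d d da in auto)
    also have "\<dots> \<le> s * 2 powr \<bar>\<alpha>\<bar> * (a1 powr s / d) * (2 * u)"
    proof (intro mult_mono da)
      have "a1 powr (s - 1) = a1 powr s / a1" using a1d d by (simp add: powr_diff)
      also have "\<dots> \<le> a1 powr s / d" using a1d d by (intro divide_left_mono) auto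
      finally show "a1 powr (s - 1) \<le> a1 powr s / d" .
    qed (use s d in \<open>auto simp: s_def\<close>)
    finally show ?thesis by (simp add: mult_ac)
  qed
  have B: "\<bar>b1 powr (-m) - b2 powr (-m)\<bar> \<le> m * 2 powr (m + 1) * (u / d) * b1 powr (-m)"
  proof -
    have "\<bar>b1 powr (-m) - b2 powr (-m)\<bar> \<le> \<bar>-m\<bar> * 2 powr \<bar>-m - 1\<bar> * b1 powr (-m - 1) * \<bar>b1 - b2\<bar>"
      by (rule powr_diff_bound) (use b1d d db in auto)
    also have "\<dots> \<le> m * 2 powr (m + 1) * (b1 powr (-m) / d) * u"
    proof (intro mult_mono db)
      have "b1 powr (-m - 1) = b1 powr (-m) / b1" using b1d d by (simp add: powr_diff)
      also have "\<dots> \<le> b1 powr (-m) / d" using b1d d by (intro divide_left_mono) auto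
      finally show "b1 powr (-m - 1) \<le> b1 powr (-m) / d" .
    qed (use m d in auto)
    finally show ?thesis by (simp add: mult_ac)
  qed
  have a2: "a2 powr s \<le> 2 powr s * a1 powr s"
  proof -
    have "a2 \<le> 2 * a1" "a2 \<ge> 0" using da d a1d x2 by (auto simp: ab power_le_one)
    then have "a2 powr s \<le> (2 * a1) powr s" using s by (intro powr_mono2) auto
    then show ?thesis using a1d d by (simp add: powr_mult)
  qed
  have k: "poisson_kernel \<alpha> x1 \<zeta> = c * (a1 powr s * b1 powr (-m))" "poisson_kernel \<alpha> x2 \<zeta> = c * (a2 powr s * b2 powr (-m))"
    unfolding powr_minus_divide by (simp_all add: poisson_kernel_def c_def ab s_def m_def)
  have "\<bar>a1 powr s * b1 powr (-m) - a2 powr s * b2 powr (-m)\<bar>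
     = \<bar>(a1 powr s - a2 powr s) * b1 powr (-m) + a2 powr s * (b1 powr (-m) - b2 powr (-m))\<bar>"
    by (simp add: algebra_simps)
  also have "\<dots> \<le> \<bar>a1 powr s - a2 powr s\<bar> * b1 powr (-m) + a2 powr s * \<bar>b1 powr (-m) - b2 powr (-m)\<bar>"
    by (rule order_trans[OF abs_triangle_ineq]) (simp add: abs_mult)
  also have "\<dots> \<le> (2 * (s * 2 powr \<bar>\<alpha>\<bar>) * (u / d) * a1 powr s) * b1 powr (-m)
      + (2 powr s * a1 powr s) * (m * 2 powr (m + 1) * (u / d) * b1 powr (-m))"
    by (intro add_mono mult_right_mono mult_mono A B a2) auto
  also have "\<dots> = (2 * (s * 2 powr \<bar>\<alpha>\<bar>) + 2 powr s * (m * 2 powr (m + 1))) * (u / d) * (a1 powr s * b1 powr (-m))"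
    by (simp add: algebra_simps add_divide_distrib)
  finally have "c * \<bar>a1 powr s * b1 powr (-m) - a2 powr s * b2 powr (-m)\<bar>
    \<le> c * ((2 * (s * 2 powr \<bar>\<alpha>\<bar>) + 2 powr s * (m * 2 powr (m + 1))) * (u / d) * (a1 powr s * b1 powr (-m)))"
    using c by (intro mult_left_mono) auto
  then show ?thesis
    unfolding k s_def[symmetric] u_def[symmetric] d_def[symmetric] right_diff_distrib[symmetric] abs_mult
    using c by (simp add: mult.left_commute)
qed

section \<open>Rotation covariance and measurability of the Poisson extension\<close>

lemma poisson_ext_rotation:
  fixes \<phi> :: "real^'n \<Rightarrow> real" and T :: "real^'n \<Rightarrow> real^'n"
  assumes T: "orthogonal_transformation T" and x: "norm x < 1" and \<phi>: "\<phi> \<in> borel_measurable sphere_measure"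
  shows "poisson_ext \<alpha> \<phi> (T x) = (LINT \<zeta>|sphere_measure. poisson_kernel \<alpha> x \<zeta> * \<phi> (T \<zeta>))"
proof -
  have "poisson_ext \<alpha> \<phi> (T x) = (LINT \<zeta>|sphere_measure. poisson_kernel \<alpha> (T x) \<zeta> * \<phi> \<zeta>)"
    using x by (simp add: poisson_ext_def orthogonal_transformation_norm[OF T])
  also have "\<dots> = (LINT \<zeta>|sphere_measure. poisson_kernel \<alpha> (T x) (T \<zeta>) * \<phi> (T \<zeta>))"
    by (rule integral_sphere_measure_orthogonal[OF T, symmetric])
      (intro borel_measurable_times \<phi> measurable_sphere_measure_borel borel_measurable_poisson_kernel)
  finally show ?thesis unfolding poisson_kernel_orthogonal[OF T] .
qed

text \<open>Off the sphere \<phi> is an arbitrary function, so Borel measurability on the whole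
  space is stated for its extension by zero.\<close>

lemma borel_measurable_restrict_sphere:
  fixes \<phi> :: "real^'n \<Rightarrow> real"
  assumes "continuous_on (sphere 0 1) \<phi>"
  shows "(\<lambda>\<zeta>. \<phi> \<zeta> * indicator (sphere 0 1) \<zeta>) \<in> borel_measurable borel"
    and "\<phi> \<in> borel_measurable sphere_measure"
proof -
  show b: "(\<lambda>\<zeta>. \<phi> \<zeta> * indicator (sphere 0 1) \<zeta>) \<in> borel_measurable borel"
    using borel_measurable_continuous_on_indicator[OF _ assms] by (simp add: mult.commute)
  have "(\<lambda>\<zeta>. \<phi> \<zeta> * indicator (sphere 0 1) \<zeta>) \<in> borel_measurable sphere_measure"
    by (rule measurable_sphere_measure_borel[OF b])
  also have "?this \<longleftrightarrow> \<phi> \<in> borel_measurable sphere_measure"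
    by (rule measurable_cong) simp
  finally show "\<phi> \<in> borel_measurable sphere_measure" .
qed

text \<open>Under the integral \<phi> may be replaced by its extension by zero, which makes the
  integrand jointly measurable in x and \<zeta>; the parametric integral is then measurable in
  x.\<close>

lemma borel_measurable_poisson_ext:
  fixes \<phi> :: "real^'n \<Rightarrow> real"
  assumes "continuous_on (sphere 0 1) \<phi>"
  shows "(\<lambda>x. poisson_ext \<alpha> \<phi> x * indicator (cball 0 1) x) \<in> borel_measurable borel"
proof -
  interpret prob_space "sphere_measure :: (real^'n) measure" by (rule prob_space_sphere_measure)
  define \<phi>0 where "\<phi>0 \<zeta> = \<phi> \<zeta> * indicator (sphere 0 1) \<zeta>" for \<zeta>
  have [measurable]: "\<phi>0 \<in> borel_measurable borel"
    using borel_measurable_restrict_sphere(1)[OF assms] by (simp add: \<phi>0_def[abs_def])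
  have [measurable]: "(\<lambda>\<zeta>::real^'n. \<zeta>) \<in> borel_measurable sphere_measure"
    by (rule measurable_sphere_measure_borel) simp
  have "(\<lambda>x. LINT \<zeta>|sphere_measure. poisson_kernel \<alpha> x \<zeta> * \<phi>0 \<zeta>) \<in> borel_measurable borel"
    unfolding poisson_kernel_def by measurable
  then have meas: "(\<lambda>x. if x \<in> ball 0 1 then LINT \<zeta>|sphere_measure. poisson_kernel \<alpha> x \<zeta> * \<phi>0 \<zeta> else \<phi>0 x) \<in> borel_measurable borel"
    by (intro measurable_If_set) auto
  have eq: "poisson_ext \<alpha> \<phi> x * indicator (cball 0 1) x
     = (if x \<in> ball 0 1 then LINT \<zeta>|sphere_measure. poisson_kernel \<alpha> x \<zeta> * \<phi>0 \<zeta> else \<phi>0 x)" for x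
  proof -
    have "(LINT \<zeta>|sphere_measure. poisson_kernel \<alpha> x \<zeta> * \<phi>0 \<zeta>) = (LINT \<zeta>|sphere_measure. poisson_kernel \<alpha> x \<zeta> * \<phi> \<zeta>)"
      by (intro Bochner_Integration.integral_cong) (auto simp: \<phi>0_def)
    then show ?thesis by (auto simp: poisson_ext_def \<phi>0_def indicator_def)
  qed
  show ?thesis unfolding eq by (rule meas)
qed

lemma rotation_orthogonal_transformation:
  "R \<in> SO \<Longrightarrow> orthogonal_transformation (\<lambda>x. R *v x)"
  by (simp add: SO_def rotation_matrix_def orthogonal_transformation_matrix)

section \<open>Moduli of continuity under rotations\<close>

context regular_majorant
begin

text \<open>The mass is invariant under rotations, so x2 may be turned onto the ray of x1; this
  leaves the difference of the radii, which is at most |x1 - x2|. Radii in [0, 1] are joined by four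
  steps of length at most 1/4, as required by the estimate for powers of chords. Each step costs at
  most a multiple of \<omega> at the full difference.\<close>

lemma poisson_mass_difference:
  assumes n: "CARD('n) \<ge> 2"
  shows "\<exists>C>0. \<forall>x1\<in>cball (0::real^'n) 1. \<forall>x2\<in>cball 0 1.
    \<bar>poisson_mass \<alpha> x1 - poisson_mass \<alpha> x2\<bar> \<le> C * \<omega> (norm (x1 - x2))"
proof -
  define q where "q = 2 + \<alpha> - real CARD('n)"
  define c where "c = poisson_const CARD('n) \<alpha>"
  have c: "c > 0" unfolding c_def by (rule poisson_const_pos[OF \<alpha> n])
  obtain C where C: "C > 0" and diff: "\<And>\<xi> r1 r2. \<xi> \<in> sphere (0::real^'n) 1 \<Longrightarrow> r1 \<in> {0..1} \<Longrightarrow> r2 \<in> {0..1} \<Longrightarrow>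
     0 < \<bar>r1 - r2\<bar> \<Longrightarrow> \<bar>r1 - r2\<bar> \<le> 1/4 \<Longrightarrow>
    (\<integral>\<^sup>+\<zeta>. ennreal \<bar>norm (r1 *\<^sub>R \<xi> - \<zeta>) powr q - norm (r2 *\<^sub>R \<xi> - \<zeta>) powr q\<bar> \<partial>sphere_measure)
    \<le> ennreal (C * \<omega> \<bar>r1 - r2\<bar>)"
    using chord_powr_difference[OF n] unfolding q_def by blast
  have int: "integrable sphere_measure (\<lambda>\<zeta>. norm (r *\<^sub>R \<xi> - \<zeta>) powr q)" if "\<xi> \<in> sphere (0::real^'n) 1" "r \<in> {0..1}" for r \<xi>
  proof (cases "r = 1")
    case True
    then show ?thesis using poisson_mass_sphere(2)[OF n \<alpha>, of \<xi>] that by (simp add: q_def)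
  next
    case False
    then show ?thesis using integrable_powr_ball[of "r *\<^sub>R \<xi>" q] that by simp
  qed
  have small: "\<bar>poisson_mass \<alpha> (r1 *\<^sub>R \<xi>) - poisson_mass \<alpha> (r2 *\<^sub>R \<xi>)\<bar> \<le> c * C * \<omega> \<bar>r1 - r2\<bar>"
    if \<xi>: "\<xi> \<in> sphere (0::real^'n) 1" and r: "r1 \<in> {0..1}" "r2 \<in> {0..1}" and h: "\<bar>r1 - r2\<bar> \<le> 1/4" for \<xi> r1 r2
  proof (cases "r1 = r2")
    case False
    define D where "D \<zeta> = norm (r1 *\<^sub>R \<xi> - \<zeta>) powr q - norm (r2 *\<^sub>R \<xi> - \<zeta>) powr q" for \<zeta>
    have iD: "integrable sphere_measure D" unfolding D_def using int[OF \<xi>] r by auto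
    have "poisson_mass \<alpha> (r1 *\<^sub>R \<xi>) - poisson_mass \<alpha> (r2 *\<^sub>R \<xi>) = c * (LINT \<zeta>|sphere_measure. D \<zeta>)"
      unfolding poisson_mass_def D_def q_def[symmetric] c_def[symmetric]
      by (subst Bochner_Integration.integral_diff) (use int[OF \<xi>] r in \<open>auto simp: right_diff_distrib\<close>)
    then have "\<bar>poisson_mass \<alpha> (r1 *\<^sub>R \<xi>) - poisson_mass \<alpha> (r2 *\<^sub>R \<xi>)\<bar> = c * \<bar>LINT \<zeta>|sphere_measure. D \<zeta>\<bar>"
      using c by (simp add: abs_mult)
    also have "\<bar>LINT \<zeta>|sphere_measure. D \<zeta>\<bar> \<le> C * \<omega> \<bar>r1 - r2\<bar>"
    proof -
      have "ennreal \<bar>LINT \<zeta>|sphere_measure. D \<zeta>\<bar> \<le> (\<integral>\<^sup>+\<zeta>. ennreal \<bar>D \<zeta>\<bar> \<partial>sphere_measure)"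
        using integral_norm_bound_ennreal[OF iD] by simp
      also have "\<dots> \<le> ennreal (C * \<omega> \<bar>r1 - r2\<bar>)"
        unfolding D_def by (rule diff[OF \<xi> r _ h]) (use False in simp)
      finally show ?thesis using C by (simp add: nonneg)
    qed
    finally show ?thesis using c by (simp add: mult.assoc)
  qed simp
  have chain: "\<bar>poisson_mass \<alpha> (r1 *\<^sub>R \<xi>) - poisson_mass \<alpha> (r2 *\<^sub>R \<xi>)\<bar> \<le> 4 * (c * C) * \<omega> \<bar>r1 - r2\<bar>"
    if \<xi>: "\<xi> \<in> sphere (0::real^'n) 1" and r: "r1 \<in> {0..1}" "r2 \<in> {0..1}" for \<xi> r1 r2
  proof -
    define s where "s k = r1 + real k * ((r2 - r1) / 4)" for k
    define M where "M k = poisson_mass \<alpha> (s k *\<^sub>R \<xi>)" for k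
    have s01: "s k \<in> {0..1}" if "k \<le> 4" for k
    proof -
      have e: "s k = (1 - real k / 4) * r1 + (real k / 4) * r2" by (simp add: s_def field_simps)
      have k: "0 \<le> real k / 4" "real k / 4 \<le> 1" using that by auto
      have "(1 - real k / 4) * r1 + (real k / 4) * r2 \<le> (1 - real k / 4) * 1 + (real k / 4) * 1"
        using r k by (intro add_mono mult_left_mono) auto
      then show ?thesis using r k unfolding e by auto
    qed
    have step: "\<bar>M k - M (Suc k)\<bar> \<le> c * C * \<omega> \<bar>r1 - r2\<bar>" if "k < 4" for k
    proof -
      have d: "\<bar>s k - s (Suc k)\<bar> = \<bar>r1 - r2\<bar> / 4" by (simp add: s_def field_simps abs_if)
      have "\<bar>M k - M (Suc k)\<bar> \<le> c * C * \<omega> \<bar>s k - s (Suc k)\<bar>"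
        unfolding M_def using r by (intro small[OF \<xi>] s01) (use that d in auto)
      also have "\<dots> \<le> c * C * \<omega> \<bar>r1 - r2\<bar>"
        unfolding d using c C by (intro mult_left_mono mono) auto
      finally show ?thesis .
    qed
    have "\<bar>M 0 - M 4\<bar> \<le> 4 * (c * C * \<omega> \<bar>r1 - r2\<bar>)"
      using step[of 0] step[of 1] step[of 2] step[of 3] by (simp add: numeral_eq_Suc abs_le_iff)
    moreover have "s 0 = r1" "s 4 = r2" by (simp_all add: s_def diff_divide_distrib)
    then have "M 0 = poisson_mass \<alpha> (r1 *\<^sub>R \<xi>)" "M 4 = poisson_mass \<alpha> (r2 *\<^sub>R \<xi>)"
      by (simp_all add: M_def)
    ultimately show ?thesis by (simp add: mult.assoc)
  qed
  have "\<bar>poisson_mass \<alpha> x1 - poisson_mass \<alpha> x2\<bar> \<le> 4 * (c * C) * \<omega> (norm (x1 - x2))"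
    if x: "x1 \<in> cball (0::real^'n) 1" "x2 \<in> cball 0 1" for x1 x2
  proof -
    obtain \<xi>1 :: "real^'n" where \<xi>1: "norm \<xi>1 = 1" "x1 = norm x1 *\<^sub>R \<xi>1" by (rule polar_decomposition)
    obtain \<xi>2 :: "real^'n" where \<xi>2: "norm \<xi>2 = 1" "x2 = norm x2 *\<^sub>R \<xi>2" by (rule polar_decomposition)
    obtain T where T: "orthogonal_transformation T" "T \<xi>2 = \<xi>1"
      using orthogonal_transformation_exists[of \<xi>2 \<xi>1] \<xi>1 \<xi>2 by auto
    have "poisson_mass \<alpha> x2 = poisson_mass \<alpha> (T x2)" by (rule poisson_mass_orthogonal[OF T(1), symmetric])
    also have "T x2 = norm x2 *\<^sub>R \<xi>1"
      by (subst \<xi>2(2)) (simp add: orthogonal_transformation_scaleR[OF T(1)] T(2))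
    finally have "\<bar>poisson_mass \<alpha> x1 - poisson_mass \<alpha> x2\<bar> = \<bar>poisson_mass \<alpha> (norm x1 *\<^sub>R \<xi>1) - poisson_mass \<alpha> (norm x2 *\<^sub>R \<xi>1)\<bar>"
      using \<xi>1(2) by simp
    also have "\<dots> \<le> 4 * (c * C) * \<omega> \<bar>norm x1 - norm x2\<bar>"
      by (rule chain) (use \<xi>1 x in auto)
    also have "\<dots> \<le> 4 * (c * C) * \<omega> (norm (x1 - x2))"
      using c C by (intro mult_left_mono mono norm_triangle_ineq3) auto
    finally show ?thesis .
  qed
  then show ?thesis using c C by (intro exI[of _ "4 * (c * C)"]) auto
qed

lemma poisson_kernel_weighted:
  assumes n: "CARD('n) \<ge> 2"
  shows "\<exists>C>0. \<forall>\<xi>\<in>sphere (0::real^'n) 1. \<forall>r. 0 \<le> r \<longrightarrow> r < 1 \<longrightarrow>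
    (\<integral>\<^sup>+\<zeta>. ennreal (poisson_kernel \<alpha> (r *\<^sub>R \<xi>) \<zeta> * \<omega> (norm (\<zeta> - \<xi>))) \<partial>sphere_measure) \<le> ennreal (C * \<omega> (1 - r))"
proof -
  define m where "m = real CARD('n) + \<alpha>"
  define c where "c = poisson_const CARD('n) \<alpha> * (2 powr (1 + \<alpha>) * 3 powr m)"
  have c: "c > 0" unfolding c_def using poisson_const_pos[OF \<alpha> n] by simp
  obtain C where C: "C > 0" and W: "\<And>\<xi> \<delta>. \<xi> \<in> sphere (0::real^'n) 1 \<Longrightarrow> \<delta> \<in> {0<..1} \<Longrightarrow>
    (\<integral>\<^sup>+\<zeta>. ennreal (\<delta> powr (1 + \<alpha>) * \<omega> (norm (\<zeta> - \<xi>)) / (\<delta> + norm (\<zeta> - \<xi>)) powr m) \<partial>sphere_measure)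
    \<le> ennreal (C * \<omega> \<delta>)"
    using weighted_kernel_upper_bound[OF n] unfolding m_def by blast
  have "(\<integral>\<^sup>+\<zeta>. ennreal (poisson_kernel \<alpha> (r *\<^sub>R \<xi>) \<zeta> * \<omega> (norm (\<zeta> - \<xi>))) \<partial>sphere_measure) \<le> ennreal (c * C * \<omega> (1 - r))"
    if \<xi>: "\<xi> \<in> sphere (0::real^'n) 1" and r: "0 \<le> r" "r < 1" for \<xi> r
  proof -
    define f where "f \<zeta> = (1 - r) powr (1 + \<alpha>) * \<omega> (norm (\<zeta> - \<xi>)) / ((1 - r) + norm (\<zeta> - \<xi>)) powr m" for \<zeta>
    have "(\<integral>\<^sup>+\<zeta>. ennreal (poisson_kernel \<alpha> (r *\<^sub>R \<xi>) \<zeta> * \<omega> (norm (\<zeta> - \<xi>))) \<partial>sphere_measure)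
      \<le> (\<integral>\<^sup>+\<zeta>. ennreal c * ennreal (f \<zeta>) \<partial>sphere_measure)"
    proof (rule nn_integral_mono)
      fix \<zeta> :: "real^'n" assume "\<zeta> \<in> space sphere_measure"
      then have \<zeta>: "norm \<zeta> = 1" by simp
      have "poisson_kernel \<alpha> (r *\<^sub>R \<xi>) \<zeta> * \<omega> (norm (\<zeta> - \<xi>))
        \<le> (c * ((1 - r) powr (1 + \<alpha>) / ((1 - r) + norm (\<zeta> - \<xi>)) powr m)) * \<omega> (norm (\<zeta> - \<xi>))"
        using poisson_kernel_bounds(2)[OF n \<alpha> r, of \<xi> \<zeta>] \<xi> \<zeta>
        by (intro mult_right_mono) (auto simp: c_def m_def nonneg)
      also have "\<dots> = c * f \<zeta>" by (simp add: f_def)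
      finally show "ennreal (poisson_kernel \<alpha> (r *\<^sub>R \<xi>) \<zeta> * \<omega> (norm (\<zeta> - \<xi>))) \<le> ennreal c * ennreal (f \<zeta>)"
        using c by (simp add: ennreal_leI flip: ennreal_mult')
    qed
    also have "\<dots> = ennreal c * (\<integral>\<^sup>+\<zeta>. ennreal (f \<zeta>) \<partial>sphere_measure)"
      unfolding f_def by (rule nn_integral_cmult) measurable
    also have "\<dots> \<le> ennreal c * ennreal (C * \<omega> (1 - r))"
      unfolding f_def using r by (intro mult_left_mono W \<xi>) auto
    also have "\<dots> = ennreal (c * C * \<omega> (1 - r))"
      using c by (simp add: mult.assoc flip: ennreal_mult')
    finally show ?thesis .
  qed
  then show ?thesis using c C by (intro exI[of _ "c * C"]) auto
qed

end

section \<open>Moduli in L^q of a finite measure on the rotations, which may be Haar measure or a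
  point mass\<close>

locale rotation_modulus = regular_majorant \<omega> \<alpha> + finite_measure \<mu>
  for \<omega> :: "real \<Rightarrow> real" and \<alpha> :: real and \<mu> :: "(real^'n^'n) measure" +
  fixes q B :: real and \<phi> :: "real^'n \<Rightarrow> real"
  assumes n: "CARD('n) \<ge> 2" and sets_\<mu>: "sets \<mu> = sets (restrict_space borel SO)"
    and q: "q \<ge> 1" and B: "B > 0" and \<phi>: "continuous_on (sphere 0 1) \<phi>"
    and modulus: "\<And>\<zeta>1 \<zeta>2. norm \<zeta>1 = 1 \<Longrightarrow> norm \<zeta>2 = 1 \<Longrightarrow>
      (\<integral>\<^sup>+R. ennreal (\<bar>\<phi> (R *v \<zeta>1) - \<phi> (R *v \<zeta>2)\<bar> powr q) \<partial>\<mu>) \<le> ennreal ((B * \<omega> (norm (\<zeta>1 - \<zeta>2))) powr q)"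
begin

text \<open>For a \<ge> 0 this says that the L^q(\<mu>) norm of G is at most a. With q-th powers on
  both sides it is an inequality of nonnegative integrals and meaningful without
  integrability.\<close>

definition norm_le :: "(real^'n^'n \<Rightarrow> real) \<Rightarrow> real \<Rightarrow> bool" where
  "norm_le G a \<longleftrightarrow> (\<integral>\<^sup>+R. ennreal (\<bar>G R\<bar> powr q) \<partial>\<mu>) \<le> ennreal (a powr q)"

lemma space_\<mu>: "space \<mu> = SO"
  using sets_eq_imp_space_eq[OF sets_\<mu>] by (simp add: space_restrict_space)

lemma norm_le_cong:
  assumes "\<And>R. R \<in> SO \<Longrightarrow> \<bar>G R\<bar> = \<bar>H R\<bar>" and "norm_le G a"
  shows "norm_le H a"
proof -
  have "(\<integral>\<^sup>+R. ennreal (\<bar>H R\<bar> powr q) \<partial>\<mu>) = (\<integral>\<^sup>+R. ennreal (\<bar>G R\<bar> powr q) \<partial>\<mu>)"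
    using assms by (intro nn_integral_cong) (simp add: space_\<mu>)
  then show ?thesis using assms by (simp add: norm_le_def)
qed

lemma norm_le_mono: "norm_le G a \<Longrightarrow> 0 \<le> a \<Longrightarrow> a \<le> b \<Longrightarrow> norm_le G b"
  unfolding norm_le_def using q
  by (elim order_trans) (intro ennreal_leI powr_mono2, auto)

text \<open>A triangle inequality with a constant. The bound (x + y)^q \<le> 2^q (x^q + y^q) gives
  one factor 2, and a^q + b^q \<le> 2 (a + b)^q \<le> (2 (a + b))^q, which uses q \<ge> 1, gives the
  other; 4 is thus independent of q.\<close>

lemma norm_le_add:
  assumes [measurable]: "G \<in> borel_measurable \<mu>" "H \<in> borel_measurable \<mu>"
    and G: "norm_le G a" and H: "norm_le H b" and ab: "0 \<le> a" "0 \<le> b"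
  shows "norm_le (\<lambda>R. G R + H R) (4 * (a + b))"
proof -
  have pw: "\<bar>x + y\<bar> powr q \<le> 2 powr q * (\<bar>x\<bar> powr q + \<bar>y\<bar> powr q)" for x y :: real
  proof -
    have "\<bar>x + y\<bar> powr q \<le> (2 * max \<bar>x\<bar> \<bar>y\<bar>) powr q"
      using q by (intro powr_mono2) auto
    also have "\<dots> = 2 powr q * (max \<bar>x\<bar> \<bar>y\<bar>) powr q" by (rule powr_mult)
    also have "\<dots> \<le> 2 powr q * (\<bar>x\<bar> powr q + \<bar>y\<bar> powr q)"
      by (intro mult_left_mono) (auto simp: max_def)
    finally show ?thesis .
  qed
  have "(\<integral>\<^sup>+R. ennreal (\<bar>G R + H R\<bar> powr q) \<partial>\<mu>) \<le>
    (\<integral>\<^sup>+R. ennreal (2 powr q) * (ennreal (\<bar>G R\<bar> powr q) + ennreal (\<bar>H R\<bar> powr q)) \<partial>\<mu>)"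
    using pw by (intro nn_integral_mono) (simp add: ennreal_leI flip: ennreal_mult ennreal_plus)
  also have "\<dots> = ennreal (2 powr q) * ((\<integral>\<^sup>+R. ennreal (\<bar>G R\<bar> powr q) \<partial>\<mu>) + (\<integral>\<^sup>+R. ennreal (\<bar>H R\<bar> powr q) \<partial>\<mu>))"
    by (simp add: nn_integral_cmult nn_integral_add)
  also have "\<dots> \<le> ennreal (2 powr q) * (ennreal (a powr q) + ennreal (b powr q))"
    using G H by (intro mult_left_mono add_mono) (auto simp: norm_le_def)
  also have "\<dots> = ennreal (2 powr q * (a powr q + b powr q))"
    by (simp flip: ennreal_mult ennreal_plus)
  also have "\<dots> \<le> ennreal ((4 * (a + b)) powr q)"
  proof (rule ennreal_leI)
    have "a powr q \<le> (a + b) powr q" "b powr q \<le> (a + b) powr q"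
      using ab q by (auto intro!: powr_mono2)
    then have "a powr q + b powr q \<le> 2 powr 1 * (a + b) powr q" by simp
    also have "\<dots> \<le> 2 powr q * (a + b) powr q" using q by (intro mult_right_mono powr_mono) auto
    finally have "2 powr q * (a powr q + b powr q) \<le> 2 powr q * (2 powr q * (a + b) powr q)"
      by (intro mult_left_mono) auto
    also have "\<dots> = (2 * (2 * (a + b))) powr q" by (simp only: powr_mult)
    finally show "2 powr q * (a powr q + b powr q) \<le> (4 * (a + b)) powr q" by simp
  qed
  finally show ?thesis by (simp add: norm_le_def)
qed

text \<open>The factor 1 + \<open>measure \<mu> SO\<close> stands in for the q-th root of the total
  mass: being at least 1, it is dominated by its own q-th power.\<close>

lemma norm_le_const:
  assumes "\<And>R. R \<in> SO \<Longrightarrow> \<bar>G R\<bar> \<le> c" "c \<ge> 0"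
  shows "norm_le G (c * (1 + measure \<mu> SO))"
proof -
  have "(\<integral>\<^sup>+R. ennreal (\<bar>G R\<bar> powr q) \<partial>\<mu>) \<le> (\<integral>\<^sup>+R. ennreal (c powr q) \<partial>\<mu>)"
    using assms q by (intro nn_integral_mono ennreal_leI powr_mono2) (auto simp: space_\<mu>)
  also have "\<dots> = ennreal (c powr q) * ennreal (measure \<mu> SO)"
    by (simp add: space_\<mu> emeasure_eq_measure)
  also have "\<dots> = ennreal (c powr q * measure \<mu> SO)" by (simp add: ennreal_mult)
  also have "\<dots> \<le> ennreal ((c * (1 + measure \<mu> SO)) powr q)"
  proof (rule ennreal_leI)
    have "measure \<mu> SO \<le> (1 + measure \<mu> SO) powr 1" by simp
    also have "\<dots> \<le> (1 + measure \<mu> SO) powr q" using q by (intro powr_mono) auto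
    finally show "c powr q * measure \<mu> SO \<le> (c * (1 + measure \<mu> SO)) powr q"
      unfolding powr_mult by (intro mult_left_mono) auto
  qed
  finally show ?thesis by (simp add: norm_le_def)
qed

definition \<phi>0 :: "real^'n \<Rightarrow> real" where
  "\<phi>0 \<zeta> = \<phi> \<zeta> * indicator (sphere 0 1) \<zeta>"

lemma \<phi>0_measurable [measurable]: "\<phi>0 \<in> borel_measurable borel"
  unfolding \<phi>0_def[abs_def] by (rule borel_measurable_restrict_sphere(1)[OF \<phi>])

lemma \<phi>0_eq: "norm \<zeta> = 1 \<Longrightarrow> \<phi>0 \<zeta> = \<phi> \<zeta>"
  by (simp add: \<phi>0_def)

lemma norm_rotation: "R \<in> SO \<Longrightarrow> norm (R *v x) = norm x"
  using rotation_orthogonal_transformation by (rule orthogonal_transformation_norm)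

lemma id_measurable [measurable]: "(\<lambda>R. R) \<in> borel_measurable \<mu>"
proof -
  have "(\<lambda>R. R) \<in> borel_measurable (restrict_space borel (SO :: (real^'n^'n) set))"
    by (rule measurable_restrict_space1) simp
  then show ?thesis by (subst measurable_cong_sets[OF sets_\<mu> refl])
qed

lemma id_measurable_sphere [measurable]: "(\<lambda>\<zeta>. \<zeta>) \<in> borel_measurable (sphere_measure :: (real^'n) measure)"
  by (rule measurable_sphere_measure_borel) simp

lemma matrix_vector_mult_measurable:
  assumes "f \<in> borel_measurable M" "g \<in> borel_measurable M"
  shows "(\<lambda>x. (f x :: real^'n^'n) *v g x) \<in> borel_measurable M"
  using assms
proof (rule borel_measurable_continuous_Pair)
  show "continuous_on UNIV (\<lambda>x::(real^'n^'n) \<times> (real^'n). fst x *v snd x)"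
    unfolding matrix_vector_mult_def by (intro continuous_intros)
qed

lemma rotate_measurable [measurable]: "(\<lambda>R. R *v x) \<in> borel_measurable \<mu>"
  by (rule matrix_vector_mult_measurable) measurable

lemma \<phi>_bounded: "\<exists>b>0. \<forall>\<zeta>\<in>sphere 0 1. \<bar>\<phi> \<zeta>\<bar> \<le> b"
proof -
  have "bounded (\<phi> ` sphere 0 1)"
    by (intro compact_imp_bounded compact_continuous_image \<phi> compact_sphere)
  then show ?thesis unfolding bounded_pos by auto
qed

lemma \<phi>_measurable: "\<phi> \<in> borel_measurable sphere_measure"
  by (rule borel_measurable_restrict_sphere(2)[OF \<phi>])

lemma poisson_ext_measurable: 
  assumes "norm x \<le> 1"
  shows "(\<lambda>R. poisson_ext \<alpha> \<phi> (R *v x)) \<in> borel_measurable \<mu>"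
proof -
  have "(\<lambda>R. poisson_ext \<alpha> \<phi> (R *v x) * indicator (cball 0 1) (R *v x)) \<in> borel_measurable \<mu>"
    by (rule measurable_compose[OF rotate_measurable borel_measurable_poisson_ext[OF \<phi>, of \<alpha>]])
  also have "?this \<longleftrightarrow> ?thesis"
    using assms by (intro measurable_cong) (simp add: space_\<mu> norm_rotation)
  finally show ?thesis .
qed

lemma \<phi>_rotate_measurable:
  assumes "norm \<zeta> = 1"
  shows "(\<lambda>R. \<phi> (R *v \<zeta>)) \<in> borel_measurable \<mu>"
proof -
  have "(\<lambda>R. \<phi>0 (R *v \<zeta>)) \<in> borel_measurable \<mu>" by measurable
  also have "?this \<longleftrightarrow> ?thesis"
    using assms by (intro measurable_cong) (simp add: space_\<mu> norm_rotation \<phi>0_eq)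
  finally show ?thesis .
qed

lemma integrable_kernel_rotation:
  assumes "norm x < 1" "R \<in> SO"
  shows "integrable sphere_measure (\<lambda>\<zeta>. poisson_kernel \<alpha> x \<zeta> * \<phi> (R *v \<zeta>))"
proof -
  obtain b where b: "b \<ge> 0" "\<forall>\<zeta>\<in>sphere (0::real^'n) 1. \<bar>poisson_kernel \<alpha> x \<zeta>\<bar> \<le> b"
    using poisson_kernel_bounded[OF n \<alpha> assms(1)] by blast
  obtain b' where b': "b' > 0" "\<forall>\<zeta>\<in>sphere 0 1. \<bar>\<phi> \<zeta>\<bar> \<le> b'" using \<phi>_bounded by blast
  have m: "(\<lambda>\<zeta>. \<phi> (R *v \<zeta>)) \<in> borel_measurable sphere_measure"
    by (rule measurable_compose[OF sphere_measure_distr_orthogonal(1)[OF rotation_orthogonal_transformation[OF assms(2)]] \<phi>_measurable])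
  show ?thesis
  proof (rule integrable_sphere_bounded)
    show "(\<lambda>\<zeta>. poisson_kernel \<alpha> x \<zeta> * \<phi> (R *v \<zeta>)) \<in> borel_measurable sphere_measure"
      by (intro borel_measurable_times m measurable_sphere_measure_borel borel_measurable_poisson_kernel)
    show "\<bar>poisson_kernel \<alpha> x \<zeta> * \<phi> (R *v \<zeta>)\<bar> \<le> b * b'" if "\<zeta> \<in> sphere 0 1" for \<zeta>
      unfolding abs_mult using b b' that by (intro mult_mono) (auto simp: norm_rotation[OF assms(2)])
  qed
qed

text \<open>Minkowski's inequality for the function \<phi>(R \<zeta>) - \<phi>(R \<xi>) of R and
  \<zeta>. Its norm over R is at most B \<omega>(|\<zeta> - \<xi>|), which plays the role of m; this
  vanishes only at \<zeta> = \<xi>, where the function vanishes too. The kernel K is left general in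
  order to admit both the Poisson kernel and a difference of two of them.\<close>

lemma norm_le_kernel:
  assumes [measurable]: "K \<in> borel_measurable (sphere_measure :: (real^'n) measure)"
    and K: "\<And>\<zeta>. \<zeta> \<in> sphere 0 1 \<Longrightarrow> \<bar>K \<zeta>\<bar> \<le> b" "b \<ge> 0"
    and \<xi>: "norm \<xi> = 1" and A: "A > 0"
    and total: "(\<integral>\<^sup>+\<zeta>. ennreal (\<bar>K \<zeta>\<bar> * \<omega> (norm (\<zeta> - \<xi>))) \<partial>sphere_measure) \<le> ennreal A"
  shows "norm_le (\<lambda>R. LINT \<zeta>|sphere_measure. K \<zeta> * (\<phi> (R *v \<zeta>) - \<phi> (R *v \<xi>))) (B * A)"
proof -
  interpret S: prob_space "sphere_measure :: (real^'n) measure" by (rule prob_space_sphere_measure)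
  define g where "g R \<zeta> = \<phi>0 (R *v \<zeta>) - \<phi>0 (R *v \<xi>)" for R \<zeta>
  define m where "m \<zeta> = B * \<omega> (norm (\<zeta> - \<xi>))" for \<zeta>
  have g: "g R \<zeta> = \<phi> (R *v \<zeta>) - \<phi> (R *v \<xi>)" if "R \<in> SO" "norm \<zeta> = 1" for R \<zeta>
    using that \<xi> by (simp add: g_def \<phi>0_eq norm_rotation)
  note [measurable] = measurable_sphere_measure_borel[OF measurable_norm_diff[of \<xi>]]
  obtain b' where b': "b' > 0" "\<forall>\<zeta>\<in>sphere 0 1. \<bar>\<phi> \<zeta>\<bar> \<le> b'" using \<phi>_bounded by blast
  have "(\<integral>\<^sup>+R. ennreal (\<bar>LINT \<zeta>|sphere_measure. K \<zeta> * g R \<zeta>\<bar> powr q) \<partial>\<mu>) \<le> ennreal ((B * A) powr q)"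
  proof (rule nn_integral_powr_minkowski[where m = m])
    show "sigma_finite_measure \<mu>" "sigma_finite_measure (sphere_measure :: (real^'n) measure)" by unfold_locales
    show "B * A > 0" using A B by simp
    have "(\<lambda>x. fst x *v snd x) \<in> borel_measurable (\<mu> \<Otimes>\<^sub>M sphere_measure)"
      by (rule matrix_vector_mult_measurable) measurable
    then have "(\<lambda>x. \<phi>0 (fst x *v snd x) - \<phi>0 (fst x *v \<xi>)) \<in> borel_measurable (\<mu> \<Otimes>\<^sub>M sphere_measure)"
      using matrix_vector_mult_measurable[of fst "\<mu> \<Otimes>\<^sub>M sphere_measure" "\<lambda>_. \<xi>"]
      by (intro borel_measurable_diff measurable_compose[OF _ \<phi>0_measurable]) auto
    then show "(\<lambda>(R, \<zeta>). g R \<zeta>) \<in> borel_measurable (\<mu> \<Otimes>\<^sub>M sphere_measure)"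
      by (simp add: g_def case_prod_beta)
    show "m \<in> borel_measurable sphere_measure" unfolding m_def by measurable
    show "m \<zeta> \<ge> 0" for \<zeta> using B by (simp add: m_def nonneg)
    show "g R \<zeta> = 0" if "m \<zeta> = 0" for R :: "real^'n^'n" and \<zeta>
    proof -
      have "\<zeta> = \<xi>" using that B pos[of "norm (\<zeta> - \<xi>)"] by (auto simp: m_def)
      then show ?thesis by (simp add: g_def)
    qed
    show "(\<integral>\<^sup>+R. ennreal (\<bar>g R \<zeta>\<bar> powr q) \<partial>\<mu>) \<le> ennreal (m \<zeta> powr q)" if "\<zeta> \<in> space sphere_measure" for \<zeta>
    proof -
      have "(\<integral>\<^sup>+R. ennreal (\<bar>g R \<zeta>\<bar> powr q) \<partial>\<mu>) = (\<integral>\<^sup>+R. ennreal (\<bar>\<phi> (R *v \<zeta>) - \<phi> (R *v \<xi>)\<bar> powr q) \<partial>\<mu>)"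
        using that by (intro nn_integral_cong) (simp add: g space_\<mu>)
      also have "\<dots> \<le> ennreal ((B * \<omega> (norm (\<zeta> - \<xi>))) powr q)"
        using that \<xi> by (intro modulus) auto
      finally show ?thesis by (simp add: m_def)
    qed
    have "(\<integral>\<^sup>+\<zeta>. ennreal (\<bar>K \<zeta>\<bar> * m \<zeta>) \<partial>sphere_measure) = (\<integral>\<^sup>+\<zeta>. ennreal B * ennreal (\<bar>K \<zeta>\<bar> * \<omega> (norm (\<zeta> - \<xi>))) \<partial>sphere_measure)"
      using B by (intro nn_integral_cong) (simp add: m_def mult_ac flip: ennreal_mult')
    also have "\<dots> = ennreal B * (\<integral>\<^sup>+\<zeta>. ennreal (\<bar>K \<zeta>\<bar> * \<omega> (norm (\<zeta> - \<xi>))) \<partial>sphere_measure)"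
      by (rule nn_integral_cmult) measurable
    also have "\<dots> \<le> ennreal B * ennreal A" by (intro mult_left_mono total) simp
    also have "\<dots> = ennreal (B * A)" using B by (simp add: ennreal_mult')
    finally show "(\<integral>\<^sup>+\<zeta>. ennreal (\<bar>K \<zeta>\<bar> * m \<zeta>) \<partial>sphere_measure) \<le> ennreal (B * A)" .
    show "integrable sphere_measure (\<lambda>\<zeta>. K \<zeta> * g R \<zeta>)" if "R \<in> space \<mu>" for R
    proof (rule integrable_sphere_bounded)
      have R: "R \<in> SO" using that by (simp add: space_\<mu>)
      have "(\<lambda>\<zeta>. R *v \<zeta>) \<in> borel_measurable sphere_measure"
        by (intro measurable_sphere_measure_borel borel_measurable_orthogonal_transformation rotation_orthogonal_transformation R)
      then show "(\<lambda>\<zeta>. K \<zeta> * g R \<zeta>) \<in> borel_measurable sphere_measure"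
        unfolding g_def by measurable
      show "\<bar>K \<zeta> * g R \<zeta>\<bar> \<le> b * (b' + b')" if "\<zeta> \<in> sphere 0 1" for \<zeta>
      proof -
        have "\<bar>\<phi> (R *v \<zeta>)\<bar> \<le> b'" "\<bar>\<phi> (R *v \<xi>)\<bar> \<le> b'" using b' that \<xi> by (auto simp: norm_rotation[OF R])
        then have "\<bar>g R \<zeta>\<bar> \<le> b' + b'" using that by (subst g[OF R]) auto
        then show ?thesis unfolding abs_mult using K that by (intro mult_mono) auto
      qed
    qed
  qed (use q in auto)
  then have "norm_le (\<lambda>R. LINT \<zeta>|sphere_measure. K \<zeta> * g R \<zeta>) (B * A)" by (simp add: norm_le_def)
  then show ?thesis
  proof (rule norm_le_cong[rotated])
    fix R :: "real^'n^'n" assume R: "R \<in> SO"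
    have "(LINT \<zeta>|sphere_measure. K \<zeta> * g R \<zeta>) = (LINT \<zeta>|sphere_measure. K \<zeta> * (\<phi> (R *v \<zeta>) - \<phi> (R *v \<xi>)))"
      by (intro Bochner_Integration.integral_cong) (auto simp: g[OF R])
    then show "\<bar>LINT \<zeta>|sphere_measure. K \<zeta> * g R \<zeta>\<bar> = \<bar>LINT \<zeta>|sphere_measure. K \<zeta> * (\<phi> (R *v \<zeta>) - \<phi> (R *v \<xi>))\<bar>"
      by simp
  qed
qed

lemma integral_kernel_rotation_measurable:
  assumes [measurable]: "K \<in> borel_measurable (sphere_measure :: (real^'n) measure)" and \<xi>: "norm \<xi> = 1"
  shows "(\<lambda>R. LINT \<zeta>|sphere_measure. K \<zeta> * (\<phi> (R *v \<zeta>) - \<phi> (R *v \<xi>))) \<in> borel_measurable \<mu>"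
proof -
  interpret S: prob_space "sphere_measure :: (real^'n) measure" by (rule prob_space_sphere_measure)
  have "(\<lambda>x. fst x *v snd x) \<in> borel_measurable (\<mu> \<Otimes>\<^sub>M sphere_measure)"
    by (rule matrix_vector_mult_measurable) measurable
  then have "(\<lambda>x. K (snd x) * (\<phi>0 (fst x *v snd x) - \<phi>0 (fst x *v \<xi>))) \<in> borel_measurable (\<mu> \<Otimes>\<^sub>M sphere_measure)"
    using matrix_vector_mult_measurable[of fst "\<mu> \<Otimes>\<^sub>M sphere_measure" "\<lambda>_. \<xi>"]
    by (intro borel_measurable_times borel_measurable_diff measurable_compose[OF _ \<phi>0_measurable]) auto
  then have "(\<lambda>R. LINT \<zeta>|sphere_measure. K \<zeta> * (\<phi>0 (R *v \<zeta>) - \<phi>0 (R *v \<xi>))) \<in> borel_measurable \<mu>"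
    by (intro S.borel_measurable_lebesgue_integral) (simp add: case_prod_beta)
  also have "?this \<longleftrightarrow> ?thesis"
  proof (rule measurable_cong)
    fix R :: "real^'n^'n" assume "R \<in> space \<mu>"
    then show "(LINT \<zeta>|sphere_measure. K \<zeta> * (\<phi>0 (R *v \<zeta>) - \<phi>0 (R *v \<xi>))) = (LINT \<zeta>|sphere_measure. K \<zeta> * (\<phi> (R *v \<zeta>) - \<phi> (R *v \<xi>)))"
      using \<xi> by (intro Bochner_Integration.integral_cong) (auto simp: space_\<mu> norm_rotation \<phi>0_eq)
  qed
  finally show ?thesis .
qed

text \<open>The constant c may depend on R and is \<phi>(R \<xi>) in the applications. It is left
  free so that the same value can be subtracted at two different points x.\<close>

lemma poisson_ext_rotation_split:
  assumes x: "norm x < 1" and R: "R \<in> SO"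
  shows "poisson_ext \<alpha> \<phi> (R *v x) = (LINT \<zeta>|sphere_measure. poisson_kernel \<alpha> x \<zeta> * (\<phi> (R *v \<zeta>) - c)) + c * poisson_mass \<alpha> x"
proof -
  have "poisson_ext \<alpha> \<phi> (R *v x) = (LINT \<zeta>|sphere_measure. poisson_kernel \<alpha> x \<zeta> * \<phi> (R *v \<zeta>))"
    by (rule poisson_ext_rotation[OF rotation_orthogonal_transformation[OF R] x \<phi>_measurable])
  also have "\<dots> = (LINT \<zeta>|sphere_measure. poisson_kernel \<alpha> x \<zeta> * (\<phi> (R *v \<zeta>) - c) + c * poisson_kernel \<alpha> x \<zeta>)"
    by (simp add: algebra_simps)
  also have "\<dots> = (LINT \<zeta>|sphere_measure. poisson_kernel \<alpha> x \<zeta> * (\<phi> (R *v \<zeta>) - c)) + (LINT \<zeta>|sphere_measure. c * poisson_kernel \<alpha> x \<zeta>)"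
  proof (rule Bochner_Integration.integral_add)
    have "integrable sphere_measure (\<lambda>\<zeta>. poisson_kernel \<alpha> x \<zeta> * \<phi> (R *v \<zeta>) - c * poisson_kernel \<alpha> x \<zeta>)"
      by (intro Bochner_Integration.integrable_diff integrable_kernel_rotation[OF x R] integrable_mult_right integrable_poisson_kernel[OF n \<alpha> x])
    then show "integrable sphere_measure (\<lambda>\<zeta>. poisson_kernel \<alpha> x \<zeta> * (\<phi> (R *v \<zeta>) - c))"
      by (simp add: algebra_simps)
  qed (intro integrable_mult_right integrable_poisson_kernel[OF n \<alpha> x])
  finally show ?thesis using poisson_mass_ball[OF n \<alpha> x] by simp
qed

lemma boundary_estimate:
  "\<exists>C>0. \<forall>\<xi>\<in>sphere 0 1. \<forall>r. 0 \<le> r \<longrightarrow> r \<le> 1 \<longrightarrow>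
    norm_le (\<lambda>R. poisson_ext \<alpha> \<phi> (R *v (r *\<^sub>R \<xi>)) - \<phi> (R *v \<xi>)) (C * \<omega> (1 - r))"
proof -
  obtain C1 where C1: "C1 > 0" and W: "\<And>\<xi> r. \<xi> \<in> sphere (0::real^'n) 1 \<Longrightarrow> 0 \<le> r \<Longrightarrow> r < 1 \<Longrightarrow>
    (\<integral>\<^sup>+\<zeta>. ennreal (poisson_kernel \<alpha> (r *\<^sub>R \<xi>) \<zeta> * \<omega> (norm (\<zeta> - \<xi>))) \<partial>sphere_measure) \<le> ennreal (C1 * \<omega> (1 - r))"
    using poisson_kernel_weighted[OF n] by blast
  obtain C2 where C2: "C2 > 0" and PM: "\<And>x1 x2. x1 \<in> cball (0::real^'n) 1 \<Longrightarrow> x2 \<in> cball 0 1 \<Longrightarrow>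
    \<bar>poisson_mass \<alpha> x1 - poisson_mass \<alpha> x2\<bar> \<le> C2 * \<omega> (norm (x1 - x2))"
    using poisson_mass_difference[OF n] by blast
  obtain b where b: "b > 0" "\<forall>\<zeta>\<in>sphere 0 1. \<bar>\<phi> \<zeta>\<bar> \<le> b" using \<phi>_bounded by blast
  define C where "C = 4 * (B * C1 + b * C2 * (1 + measure \<mu> SO))"
  have C: "C > 0" unfolding C_def using B C1 C2 b by (intro mult_pos_pos add_pos_nonneg) auto
  have "norm_le (\<lambda>R. poisson_ext \<alpha> \<phi> (R *v (r *\<^sub>R \<xi>)) - \<phi> (R *v \<xi>)) (C * \<omega> (1 - r))"
    if \<xi>: "norm \<xi> = 1" and r: "0 \<le> r" "r \<le> 1" for \<xi> r
  proof (cases "r = 1")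
    case True
    have "poisson_ext \<alpha> \<phi> (R *v \<xi>) - \<phi> (R *v \<xi>) = 0" if "R \<in> SO" for R
      using \<xi> that by (simp add: poisson_ext_def norm_rotation)
    then have "norm_le (\<lambda>R. poisson_ext \<alpha> \<phi> (R *v \<xi>) - \<phi> (R *v \<xi>)) (0 * (1 + measure \<mu> SO))"
      by (intro norm_le_const) auto
    then show ?thesis using True by simp
  next
    case False
    define x where "x = r *\<^sub>R \<xi>"
    have r1: "r < 1" using False r by simp
    have x: "norm x < 1" using r1 r \<xi> by (simp add: x_def)
    obtain bk where bk: "bk \<ge> 0" "\<forall>\<zeta>\<in>sphere (0::real^'n) 1. \<bar>poisson_kernel \<alpha> x \<zeta>\<bar> \<le> bk"
      using poisson_kernel_bounded[OF n \<alpha> x] by blast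
    have w: "\<omega> (1 - r) > 0" using r1 by (intro pos) auto
    have main: "norm_le (\<lambda>R. LINT \<zeta>|sphere_measure. poisson_kernel \<alpha> x \<zeta> * (\<phi> (R *v \<zeta>) - \<phi> (R *v \<xi>))) (B * (C1 * \<omega> (1 - r)))"
    proof (rule norm_le_kernel[OF _ _ bk(1) \<xi>])
      show "C1 * \<omega> (1 - r) > 0" using C1 w by simp
      show "(\<integral>\<^sup>+\<zeta>. ennreal (\<bar>poisson_kernel \<alpha> x \<zeta>\<bar> * \<omega> (norm (\<zeta> - \<xi>))) \<partial>sphere_measure) \<le> ennreal (C1 * \<omega> (1 - r))"
        using W[of \<xi> r] \<xi> r r1 poisson_kernel_nonneg[OF n \<alpha>] by (simp add: x_def)
    qed (use bk in auto)
    \<comment> \<open>The mass is 1 at \<xi>, so its defect at x is its variation between x and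
      \<xi>, which are at distance 1 - r.\<close>
    have mass: "\<bar>poisson_mass \<alpha> x - 1\<bar> \<le> C2 * \<omega> (1 - r)"
    proof -
      have "x - \<xi> = (r - 1) *\<^sub>R \<xi>" by (simp add: x_def scaleR_diff_left)
      then have "norm (x - \<xi>) = 1 - r" using \<xi> r by simp
      then show ?thesis using PM[of x \<xi>] x \<xi> poisson_mass_sphere(1)[OF n \<alpha> \<xi>] by simp
    qed
    have const: "norm_le (\<lambda>R. \<phi> (R *v \<xi>) * (poisson_mass \<alpha> x - 1)) (b * (C2 * \<omega> (1 - r)) * (1 + measure \<mu> SO))"
    proof (rule norm_le_const)
      show "\<bar>\<phi> (R *v \<xi>) * (poisson_mass \<alpha> x - 1)\<bar> \<le> b * (C2 * \<omega> (1 - r))" if "R \<in> SO" for R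
        unfolding abs_mult using b \<xi> mass norm_rotation[OF that] by (intro mult_mono) auto
    qed (use b C2 w in simp)
    have "norm_le (\<lambda>R. (LINT \<zeta>|sphere_measure. poisson_kernel \<alpha> x \<zeta> * (\<phi> (R *v \<zeta>) - \<phi> (R *v \<xi>))) + \<phi> (R *v \<xi>) * (poisson_mass \<alpha> x - 1))
       (4 * (B * (C1 * \<omega> (1 - r)) + b * (C2 * \<omega> (1 - r)) * (1 + measure \<mu> SO)))"
      using B C1 C2 b w
      by (intro norm_le_add main const integral_kernel_rotation_measurable \<xi> borel_measurable_times \<phi>_rotate_measurable
          measurable_sphere_measure_borel borel_measurable_poisson_kernel borel_measurable_const) auto
    also have "4 * (B * (C1 * \<omega> (1 - r)) + b * (C2 * \<omega> (1 - r)) * (1 + measure \<mu> SO)) = C * \<omega> (1 - r)"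
      by (simp add: C_def algebra_simps)
    finally show ?thesis
    proof (rule norm_le_cong[rotated])
      fix R :: "real^'n^'n" assume R: "R \<in> SO"
      show "\<bar>(LINT \<zeta>|sphere_measure. poisson_kernel \<alpha> x \<zeta> * (\<phi> (R *v \<zeta>) - \<phi> (R *v \<xi>))) + \<phi> (R *v \<xi>) * (poisson_mass \<alpha> x - 1)\<bar>
        = \<bar>poisson_ext \<alpha> \<phi> (R *v (r *\<^sub>R \<xi>)) - \<phi> (R *v \<xi>)\<bar>"
        unfolding x_def[symmetric] poisson_ext_rotation_split[OF x R, of "\<phi> (R *v \<xi>)"]
        by (simp add: right_diff_distrib add_diff_eq)
    qed
  qed
  then show ?thesis using C by (intro exI[of _ C]) auto
qed

text \<open>With h = |x1 - x2| and d = 1 - |x1|, the kernel difference contributes a factor h/d and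
  the weighted kernel integral a factor \<omega>(d). Since \<omega>(t)/t is non-increasing, (h/d)
  \<omega>(d) \<le> \<omega>(h). The projection \<xi> of x1 serves as reference point for both x1
  and x2.\<close>

lemma interior_estimate:
  "\<exists>C>0. \<forall>x1 x2. norm x1 < 1 \<longrightarrow> norm (x1 - x2) \<le> (1 - norm x1) / 4 \<longrightarrow> x1 \<noteq> x2 \<longrightarrow>
    norm_le (\<lambda>R. poisson_ext \<alpha> \<phi> (R *v x1) - poisson_ext \<alpha> \<phi> (R *v x2)) (C * \<omega> (norm (x1 - x2)))"
proof -
  obtain C1 where C1: "C1 > 0" and W: "\<And>\<xi> r. \<xi> \<in> sphere (0::real^'n) 1 \<Longrightarrow> 0 \<le> r \<Longrightarrow> r < 1 \<Longrightarrow>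
    (\<integral>\<^sup>+\<zeta>. ennreal (poisson_kernel \<alpha> (r *\<^sub>R \<xi>) \<zeta> * \<omega> (norm (\<zeta> - \<xi>))) \<partial>sphere_measure) \<le> ennreal (C1 * \<omega> (1 - r))"
    using poisson_kernel_weighted[OF n] by blast
  obtain C2 where C2: "C2 > 0" and PM: "\<And>x1 x2. x1 \<in> cball (0::real^'n) 1 \<Longrightarrow> x2 \<in> cball 0 1 \<Longrightarrow>
    \<bar>poisson_mass \<alpha> x1 - poisson_mass \<alpha> x2\<bar> \<le> C2 * \<omega> (norm (x1 - x2))"
    using poisson_mass_difference[OF n] by blast
  obtain b where b: "b > 0" "\<forall>\<zeta>\<in>sphere 0 1. \<bar>\<phi> \<zeta>\<bar> \<le> b" using \<phi>_bounded by blast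
  define m where "m = real CARD('n) + \<alpha>"
  define Cd where "Cd = 2 * ((1 + \<alpha>) * 2 powr \<bar>\<alpha>\<bar>) + 2 powr (1 + \<alpha>) * (m * 2 powr (m + 1))"
  have m: "m > 0" using n \<alpha> by (simp add: m_def)
  have Cd: "Cd > 0"
  proof -
    have "1 + \<alpha> > 0" using \<alpha> by simp
    then have "2 * ((1 + \<alpha>) * 2 powr \<bar>\<alpha>\<bar>) > 0" by simp
    moreover have "2 powr (1 + \<alpha>) * (m * 2 powr (m + 1)) > 0" using m by simp
    ultimately show ?thesis unfolding Cd_def by linarith
  qed
  define C where "C = 4 * (B * (Cd * C1) + b * C2 * (1 + measure \<mu> SO))"
  have C: "C > 0" unfolding C_def using B C1 C2 b Cd by (intro mult_pos_pos add_pos_nonneg) auto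
  have "norm_le (\<lambda>R. poisson_ext \<alpha> \<phi> (R *v x1) - poisson_ext \<alpha> \<phi> (R *v x2)) (C * \<omega> (norm (x1 - x2)))"
    if x1: "norm x1 < 1" and h4: "norm (x1 - x2) \<le> (1 - norm x1) / 4" and ne: "x1 \<noteq> x2" for x1 x2
  proof -
    obtain \<xi> :: "real^'n" where \<xi>: "norm \<xi> = 1" "x1 = norm x1 *\<^sub>R \<xi>" by (rule polar_decomposition)
    define h where "h = norm (x1 - x2)"
    define d where "d = 1 - norm x1"
    have h: "0 < h" "h \<le> d / 4" "h \<le> d" using ne h4 x1 by (auto simp: h_def d_def)
    have d: "d > 0" using x1 by (simp add: d_def)
    have w: "\<omega> h > 0" using h by (intro pos)
    have x2: "norm x2 < 1"
      using norm_triangle_ineq2[of x2 x1] h x1 by (simp add: h_def d_def norm_minus_commute)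
    define K where "K \<zeta> = poisson_kernel \<alpha> x1 \<zeta> - poisson_kernel \<alpha> x2 \<zeta>" for \<zeta>
    obtain b1 where b1: "b1 \<ge> 0" "\<forall>\<zeta>\<in>sphere (0::real^'n) 1. \<bar>poisson_kernel \<alpha> x1 \<zeta>\<bar> \<le> b1"
      using poisson_kernel_bounded[OF n \<alpha> x1] by blast
    obtain b2 where b2: "b2 \<ge> 0" "\<forall>\<zeta>\<in>sphere (0::real^'n) 1. \<bar>poisson_kernel \<alpha> x2 \<zeta>\<bar> \<le> b2"
      using poisson_kernel_bounded[OF n \<alpha> x2] by blast
    have Km: "K \<in> borel_measurable sphere_measure"
      unfolding K_def[abs_def] by (intro borel_measurable_diff measurable_sphere_measure_borel borel_measurable_poisson_kernel)
    have Kb: "\<bar>K \<zeta>\<bar> \<le> b1 + b2" if "\<zeta> \<in> sphere 0 1" for \<zeta>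
      unfolding K_def using b1 b2 that by (intro order_trans[OF abs_triangle_ineq4] add_mono) auto
    have total: "(\<integral>\<^sup>+\<zeta>. ennreal (\<bar>K \<zeta>\<bar> * \<omega> (norm (\<zeta> - \<xi>))) \<partial>sphere_measure) \<le> ennreal (Cd * C1 * \<omega> h)"
    proof -
      have "(\<integral>\<^sup>+\<zeta>. ennreal (\<bar>K \<zeta>\<bar> * \<omega> (norm (\<zeta> - \<xi>))) \<partial>sphere_measure)
        \<le> (\<integral>\<^sup>+\<zeta>. ennreal (Cd * (h / d)) * ennreal (poisson_kernel \<alpha> x1 \<zeta> * \<omega> (norm (\<zeta> - \<xi>))) \<partial>sphere_measure)"
      proof (rule nn_integral_mono)
        fix \<zeta> :: "real^'n" assume "\<zeta> \<in> space sphere_measure"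
        then have "\<bar>K \<zeta>\<bar> \<le> Cd * (h / d) * poisson_kernel \<alpha> x1 \<zeta>"
          unfolding K_def Cd_def m_def h_def d_def by (intro poisson_kernel_difference[OF n \<alpha> x1 h4]) auto
        then have "\<bar>K \<zeta>\<bar> * \<omega> (norm (\<zeta> - \<xi>)) \<le> Cd * (h / d) * poisson_kernel \<alpha> x1 \<zeta> * \<omega> (norm (\<zeta> - \<xi>))"
          by (intro mult_right_mono) (auto simp: nonneg)
        then show "ennreal (\<bar>K \<zeta>\<bar> * \<omega> (norm (\<zeta> - \<xi>))) \<le> ennreal (Cd * (h / d)) * ennreal (poisson_kernel \<alpha> x1 \<zeta> * \<omega> (norm (\<zeta> - \<xi>)))"
          using Cd h d by (subst ennreal_mult'[symmetric]) (auto intro!: ennreal_leI simp: mult.assoc)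
      qed
      also have "\<dots> = ennreal (Cd * (h / d)) * (\<integral>\<^sup>+\<zeta>. ennreal (poisson_kernel \<alpha> x1 \<zeta> * \<omega> (norm (\<zeta> - \<xi>))) \<partial>sphere_measure)"
        by (rule nn_integral_cmult)
          (intro measurable_compose[OF _ measurable_ennreal] borel_measurable_times measurable_sphere_measure_borel borel_measurable_poisson_kernel measurable_norm_diff)
      also have "\<dots> \<le> ennreal (Cd * (h / d)) * ennreal (C1 * \<omega> d)"
        using W[of \<xi> "norm x1"] \<xi> x1 by (intro mult_left_mono) (auto simp: d_def)
      also have "\<dots> = ennreal (Cd * C1 * (\<omega> d / d * h))"
        using Cd h d by (subst ennreal_mult'[symmetric]) (auto simp: mult_ac)
      also have "\<dots> \<le> ennreal (Cd * C1 * \<omega> h)"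
        using Cd C1 h by (intro ennreal_leI mult_left_mono linear_lower) auto
      finally show ?thesis .
    qed
    have main: "norm_le (\<lambda>R. LINT \<zeta>|sphere_measure. K \<zeta> * (\<phi> (R *v \<zeta>) - \<phi> (R *v \<xi>))) (B * (Cd * C1 * \<omega> h))"
      using b1 b2 Cd C1 w by (intro norm_le_kernel[OF Km Kb _ \<xi>(1) _ total]) auto
    have const: "norm_le (\<lambda>R. \<phi> (R *v \<xi>) * (poisson_mass \<alpha> x1 - poisson_mass \<alpha> x2)) (b * (C2 * \<omega> h) * (1 + measure \<mu> SO))"
    proof (rule norm_le_const)
      have "\<bar>poisson_mass \<alpha> x1 - poisson_mass \<alpha> x2\<bar> \<le> C2 * \<omega> h"
        using PM[of x1 x2] x1 x2 by (simp add: h_def)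
      then show "\<bar>\<phi> (R *v \<xi>) * (poisson_mass \<alpha> x1 - poisson_mass \<alpha> x2)\<bar> \<le> b * (C2 * \<omega> h)" if "R \<in> SO" for R
        unfolding abs_mult using b \<xi> norm_rotation[OF that] by (intro mult_mono) auto
    qed (use b C2 w in simp)
    have "norm_le (\<lambda>R. (LINT \<zeta>|sphere_measure. K \<zeta> * (\<phi> (R *v \<zeta>) - \<phi> (R *v \<xi>))) + \<phi> (R *v \<xi>) * (poisson_mass \<alpha> x1 - poisson_mass \<alpha> x2))
       (4 * (B * (Cd * C1 * \<omega> h) + b * (C2 * \<omega> h) * (1 + measure \<mu> SO)))"
      using B C1 C2 b w Cd
      by (intro norm_le_add main const integral_kernel_rotation_measurable \<xi> borel_measurable_times \<phi>_rotate_measurable Km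
          borel_measurable_const) auto
    also have "4 * (B * (Cd * C1 * \<omega> h) + b * (C2 * \<omega> h) * (1 + measure \<mu> SO)) = C * \<omega> h"
      by (simp add: C_def algebra_simps)
    finally show ?thesis
      unfolding h_def[symmetric]
    proof (rule norm_le_cong[rotated])
      fix R :: "real^'n^'n" assume R: "R \<in> SO"
      \<comment> \<open>The same constant is subtracted at x1 and at x2, so the two integral terms
        combine into one with the kernel difference K, and the masses enter only through their
        difference.\<close>
      define c where "c = \<phi> (R *v \<xi>)"
      have int: "integrable sphere_measure (\<lambda>\<zeta>. poisson_kernel \<alpha> x \<zeta> * (\<phi> (R *v \<zeta>) - c))" if "norm x < 1" for x
      proof -
        have "integrable sphere_measure (\<lambda>\<zeta>. poisson_kernel \<alpha> x \<zeta> * \<phi> (R *v \<zeta>) - c * poisson_kernel \<alpha> x \<zeta>)"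
          by (intro Bochner_Integration.integrable_diff integrable_kernel_rotation[OF that R] integrable_mult_right integrable_poisson_kernel[OF n \<alpha> that])
        then show ?thesis by (simp add: algebra_simps)
      qed
      have "(LINT \<zeta>|sphere_measure. K \<zeta> * (\<phi> (R *v \<zeta>) - c)) =
         (LINT \<zeta>|sphere_measure. poisson_kernel \<alpha> x1 \<zeta> * (\<phi> (R *v \<zeta>) - c)) - (LINT \<zeta>|sphere_measure. poisson_kernel \<alpha> x2 \<zeta> * (\<phi> (R *v \<zeta>) - c))"
        unfolding K_def left_diff_distrib by (rule Bochner_Integration.integral_diff[OF int[OF x1] int[OF x2]])
      then show "\<bar>(LINT \<zeta>|sphere_measure. K \<zeta> * (\<phi> (R *v \<zeta>) - \<phi> (R *v \<xi>))) + \<phi> (R *v \<xi>) * (poisson_mass \<alpha> x1 - poisson_mass \<alpha> x2)\<bar>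
         = \<bar>poisson_ext \<alpha> \<phi> (R *v x1) - poisson_ext \<alpha> \<phi> (R *v x2)\<bar>"
        unfolding poisson_ext_rotation_split[OF x1 R, of c] poisson_ext_rotation_split[OF x2 R, of c] c_def[symmetric]
        by (simp add: algebra_simps)
    qed
  qed
  then show ?thesis using C by (intro exI[of _ C]) auto
qed

text \<open>If h = |x1 - x2| is not small relative to the distance of either point from the sphere,
  then both distances are below 4 h and the path through the boundary points \<xi>1 and \<xi>2 is
  used. These are at most 4 h + h + 4 h = 9 h apart, and \<omega>(c h) \<le> c \<omega>(h) for c
  \<ge> 1 absorbs the factors.\<close>

lemma poisson_ext_modulus:
  "\<exists>C>0. \<forall>x1\<in>cball 0 1. \<forall>x2\<in>cball 0 1.
    norm_le (\<lambda>R. poisson_ext \<alpha> \<phi> (R *v x1) - poisson_ext \<alpha> \<phi> (R *v x2)) (C * \<omega> (norm (x1 - x2)))"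
proof -
  obtain C1 where C1: "C1 > 0" and bd: "\<And>\<xi> r. norm \<xi> = 1 \<Longrightarrow> 0 \<le> r \<Longrightarrow> r \<le> 1 \<Longrightarrow>
    norm_le (\<lambda>R. poisson_ext \<alpha> \<phi> (R *v (r *\<^sub>R \<xi>)) - \<phi> (R *v \<xi>)) (C1 * \<omega> (1 - r))"
    using boundary_estimate by auto
  obtain C2 where C2: "C2 > 0" and near: "\<And>x1 x2. norm x1 < 1 \<Longrightarrow> norm (x1 - x2) \<le> (1 - norm x1) / 4 \<Longrightarrow> x1 \<noteq> x2 \<Longrightarrow>
    norm_le (\<lambda>R. poisson_ext \<alpha> \<phi> (R *v x1) - poisson_ext \<alpha> \<phi> (R *v x2)) (C2 * \<omega> (norm (x1 - x2)))"
    using interior_estimate by auto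
  \<comment> \<open>The path has three pieces: two radial ones, each with C1 and the factor 4 from
    \<omega>(4 h), and one along the boundary with B and the factor 9. The outer factors 4 come from
    two uses of \<open>norm_le_add\<close>.\<close>
  define C3 where "C3 = 4 * (C1 * 4 + 4 * (B * 9 + C1 * 4))"
  define C where "C = C2 + C3"
  have C: "C2 \<le> C" "C3 \<le> C" "C > 0" using C1 C2 B by (auto simp: C_def C3_def)
  have "norm_le (\<lambda>R. poisson_ext \<alpha> \<phi> (R *v x1) - poisson_ext \<alpha> \<phi> (R *v x2)) (C * \<omega> (norm (x1 - x2)))"
    if x: "norm x1 \<le> 1" "norm x2 \<le> 1" for x1 x2
  proof -
    define h where "h = norm (x1 - x2)"
    have w: "\<omega> h \<ge> 0" by (simp add: h_def nonneg)
    consider "x1 = x2" | "x1 \<noteq> x2" "h \<le> (1 - norm x1) / 4" | "x1 \<noteq> x2" "h \<le> (1 - norm x2) / 4"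
      | "x1 \<noteq> x2" "1 - norm x1 < 4 * h" "1 - norm x2 < 4 * h" by fastforce
    then show ?thesis
    proof cases
      case 1
      then have "norm_le (\<lambda>R. poisson_ext \<alpha> \<phi> (R *v x1) - poisson_ext \<alpha> \<phi> (R *v x2)) (0 * (1 + measure \<mu> SO))"
        by (intro norm_le_const) auto
      then show ?thesis using 1 by simp
    next
      case 2
      then have "h > 0" by (simp add: h_def)
      then have "0 < (1 - norm x1) / 4" using 2(2) by (rule less_le_trans)
      then have "norm x1 < 1" by simp
      then have "norm_le (\<lambda>R. poisson_ext \<alpha> \<phi> (R *v x1) - poisson_ext \<alpha> \<phi> (R *v x2)) (C2 * \<omega> h)"
        unfolding h_def using 2 by (intro near) (auto simp: h_def)
      then show ?thesis
        unfolding h_def[symmetric] by (rule norm_le_mono) (use C C2 w in \<open>auto intro: mult_right_mono\<close>)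
    next
      case 3
      then have "h > 0" by (simp add: h_def)
      then have "0 < (1 - norm x2) / 4" using 3(2) by (rule less_le_trans)
      then have "norm x2 < 1" by simp
      then have "norm_le (\<lambda>R. poisson_ext \<alpha> \<phi> (R *v x2) - poisson_ext \<alpha> \<phi> (R *v x1)) (C2 * \<omega> h)"
        unfolding h_def norm_minus_commute[of x1] using 3 by (intro near) (auto simp: h_def norm_minus_commute)
      then have "norm_le (\<lambda>R. poisson_ext \<alpha> \<phi> (R *v x1) - poisson_ext \<alpha> \<phi> (R *v x2)) (C2 * \<omega> h)"
        by (rule norm_le_cong[rotated]) (rule abs_minus_commute)
      then show ?thesis
        unfolding h_def[symmetric] by (rule norm_le_mono) (use C C2 w in \<open>auto intro: mult_right_mono\<close>)
    next
      case 4
      obtain \<xi>1 :: "real^'n" where \<xi>1: "norm \<xi>1 = 1" "x1 = norm x1 *\<^sub>R \<xi>1" by (rule polar_decomposition)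
      obtain \<xi>2 :: "real^'n" where \<xi>2: "norm \<xi>2 = 1" "x2 = norm x2 *\<^sub>R \<xi>2" by (rule polar_decomposition)
      have h: "h > 0" using 4 by (simp add: h_def)
      have to_boundary: "norm (y - \<xi>) = 1 - norm y" if "norm \<xi> = 1" "y = norm y *\<^sub>R \<xi>" "norm y \<le> 1" for y \<xi> :: "real^'n"
      proof -
        have "y - \<xi> = (norm y - 1) *\<^sub>R \<xi>" by (subst that(2)) (simp add: scaleR_diff_left)
        then show ?thesis using that by simp
      qed
      have "norm (\<xi>1 - \<xi>2) \<le> norm (\<xi>1 - x1) + norm (x1 - x2) + norm (x2 - \<xi>2)"
        using norm_triangle_ineq[of "\<xi>1 - x1" "x1 - \<xi>2"] norm_triangle_ineq[of "x1 - x2" "x2 - \<xi>2"] by simp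
      then have \<xi>12: "norm (\<xi>1 - \<xi>2) \<le> 9 * h"
        using to_boundary[OF \<xi>1 x(1)] to_boundary[OF \<xi>2 x(2)] 4 by (simp add: h_def norm_minus_commute)
      have w4: "\<omega> (1 - norm y) \<le> 4 * \<omega> h" if "norm y \<le> 1" "1 - norm y < 4 * h" for y :: "real^'n"
        using mono[of "1 - norm y" "4 * h"] scale[of 4 h] that h by simp
      have w9: "\<omega> (norm (\<xi>1 - \<xi>2)) \<le> 9 * \<omega> h"
        using mono[OF _ \<xi>12] scale[of 9 h] h by simp
      have b1: "norm_le (\<lambda>R. poisson_ext \<alpha> \<phi> (R *v x1) - \<phi> (R *v \<xi>1)) (C1 * (4 * \<omega> h))"
      proof (rule norm_le_mono)
        show "norm_le (\<lambda>R. poisson_ext \<alpha> \<phi> (R *v x1) - \<phi> (R *v \<xi>1)) (C1 * \<omega> (1 - norm x1))"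
          using bd[OF \<xi>1(1), of "norm x1"] x \<xi>1(2) by simp
      qed (use C1 w4[of x1] x 4 in \<open>auto simp: nonneg\<close>)
      have "norm_le (\<lambda>R. poisson_ext \<alpha> \<phi> (R *v x2) - \<phi> (R *v \<xi>2)) (C1 * (4 * \<omega> h))"
      proof (rule norm_le_mono)
        show "norm_le (\<lambda>R. poisson_ext \<alpha> \<phi> (R *v x2) - \<phi> (R *v \<xi>2)) (C1 * \<omega> (1 - norm x2))"
          using bd[OF \<xi>2(1), of "norm x2"] x \<xi>2(2) by simp
      qed (use C1 w4[of x2] x 4 in \<open>auto simp: nonneg\<close>)
      then have b2: "norm_le (\<lambda>R. \<phi> (R *v \<xi>2) - poisson_ext \<alpha> \<phi> (R *v x2)) (C1 * (4 * \<omega> h))"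
        by (rule norm_le_cong[rotated]) (rule abs_minus_commute)
      have "norm_le (\<lambda>R. \<phi> (R *v \<xi>1) - \<phi> (R *v \<xi>2)) (B * \<omega> (norm (\<xi>1 - \<xi>2)))"
        unfolding norm_le_def by (rule modulus[OF \<xi>1(1) \<xi>2(1)])
      then have b3: "norm_le (\<lambda>R. \<phi> (R *v \<xi>1) - \<phi> (R *v \<xi>2)) (B * (9 * \<omega> h))"
        by (rule norm_le_mono) (use B w9 in \<open>auto simp: nonneg\<close>)
      have "norm_le (\<lambda>R. (poisson_ext \<alpha> \<phi> (R *v x1) - \<phi> (R *v \<xi>1)) + ((\<phi> (R *v \<xi>1) - \<phi> (R *v \<xi>2)) + (\<phi> (R *v \<xi>2) - poisson_ext \<alpha> \<phi> (R *v x2))))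
         (4 * (C1 * (4 * \<omega> h) + 4 * (B * (9 * \<omega> h) + C1 * (4 * \<omega> h))))"
        using C1 B w
        by (intro norm_le_add b1 b2 b3 borel_measurable_diff borel_measurable_add poisson_ext_measurable \<phi>_rotate_measurable \<xi>1 \<xi>2 x) auto
      also have "4 * (C1 * (4 * \<omega> h) + 4 * (B * (9 * \<omega> h) + C1 * (4 * \<omega> h))) = C3 * \<omega> h"
        by (simp add: C3_def algebra_simps)
      finally have "norm_le (\<lambda>R. poisson_ext \<alpha> \<phi> (R *v x1) - poisson_ext \<alpha> \<phi> (R *v x2)) (C3 * \<omega> h)"
        by (rule norm_le_cong[rotated]) simp
      then show ?thesis
        unfolding h_def[symmetric]
        by (rule norm_le_mono) (use C C1 B w in \<open>auto simp: C3_def intro: mult_right_mono\<close>)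
    qed
  qed
  then show ?thesis using C by (intro exI[of _ C]) auto
qed

end

section \<open>The two conditions\<close>

text \<open>Moves the root to the other side of a finite bound; an infinite integral satisfies
  neither inequality, because \<open>ennreal_root\<close> keeps it infinite.\<close>

lemma ennreal_root_le_iff:
  assumes "q \<ge> 1" "c \<ge> 0"
  shows "ennreal_root q a \<le> ennreal c \<longleftrightarrow> a \<le> ennreal (c powr q)"
proof (cases a)
  case (real x)
  have "x powr (1 / q) \<le> c \<longleftrightarrow> x \<le> c powr q"
  proof
    assume "x powr (1 / q) \<le> c"
    then have "(x powr (1 / q)) powr q \<le> c powr q" using assms by (intro powr_mono2) auto
    then show "x \<le> c powr q" using assms real by (simp add: powr_powr)
  next
    assume "x \<le> c powr q"
    then have "x powr (1 / q) \<le> (c powr q) powr (1 / q)" using assms real by (intro powr_mono2) auto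
    then show "x powr (1 / q) \<le> c" using assms by (simp add: powr_powr)
  qed
  then show ?thesis using real assms by (simp add: ennreal_root_def)
next
  case top
  then show ?thesis by (simp add: ennreal_root_def top_unique)
qed

lemma cond_C2_imp_cond_C1_finite:
  fixes \<alpha> :: real and \<omega> :: "real \<Rightarrow> real" and \<mu> :: "(real^'n^'n) measure"
  assumes n: "CARD('n) \<ge> 2" and "\<alpha> > -1" "majorant \<omega>" "cond_C2 \<alpha> \<omega>"
    and fin: "finite_measure \<mu>" and sets: "sets \<mu> = sets (restrict_space borel SO)"
    and q: "q \<ge> 1" and \<phi>: "continuous_on (sphere 0 1) \<phi>" and C: "C > 0"
    and le: "\<And>x1 x2. x1 \<in> sphere 0 1 \<Longrightarrow> x2 \<in> sphere 0 1 \<Longrightarrow>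
      (\<integral>\<^sup>+ R. ennreal (\<bar>\<phi> (R *v x1) - \<phi> (R *v x2)\<bar> powr q) \<partial>\<mu>) \<le> ennreal ((C * \<omega> (norm (x1 - x2))) powr q)"
  shows "\<exists>C>0. \<forall>x1\<in>cball 0 1. \<forall>x2\<in>cball 0 1.
      (\<integral>\<^sup>+ R. ennreal (\<bar>poisson_ext \<alpha> \<phi> (R *v x1) - poisson_ext \<alpha> \<phi> (R *v x2)\<bar> powr q) \<partial>\<mu>)
        \<le> ennreal ((C * \<omega> (norm (x1 - x2))) powr q)"
proof -
  interpret finite_measure \<mu> by fact
  interpret rotation_modulus \<omega> \<alpha> \<mu> q C \<phi>
    by unfold_locales (use assms in auto)
  show ?thesis using poisson_ext_modulus unfolding norm_le_def .
qed

lemma poisson_ext_borel: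
  assumes "continuous_on (sphere 0 1) \<phi>"
  shows "poisson_ext \<alpha> \<phi> \<in> borel_measurable (restrict_space borel (cball (0::real^'n) 1))"
proof -
  have "(\<lambda>x. poisson_ext \<alpha> \<phi> x * indicator (cball 0 1) x) \<in> borel_measurable (restrict_space borel (cball (0::real^'n) 1))"
    by (rule measurable_restrict_space1[OF borel_measurable_poisson_ext[OF assms]])
  also have "?this \<longleftrightarrow> ?thesis"
    by (rule measurable_cong) (simp add: space_restrict_space)
  finally show ?thesis .
qed

lemma cball_neq_sphere: "cball (0::real^'n) 1 \<noteq> sphere 0 1"
proof
  assume "cball (0::real^'n) 1 = sphere 0 1"
  then have "(0::real^'n) \<in> sphere 0 1" by (metis centre_in_cball zero_le_one)
  then show False by simp
qed

lemma mat_1_SO: "mat 1 \<in> (SO :: (real^'n^'n) set)"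
  by (simp add: SO_def rotation_matrix_def orthogonal_matrix_id)

text \<open>The exponent \<open>\<infinity>\<close> is the exponent 1 for the Dirac measure at the identity.\<close>

lemma cond_C2_imp_cond_C1_infinity:
  fixes \<alpha> :: real and \<omega> :: "real \<Rightarrow> real" and \<mu> :: "(real^'n^'n) measure"
  assumes n: "CARD('n) \<ge> 2" and \<alpha>: "\<alpha> > -1" and \<omega>: "majorant \<omega>" and C2: "cond_C2 \<alpha> \<omega>"
  shows "cond_C1 \<mu> \<alpha> \<omega> \<infinity>"
  unfolding cond_C1_def
proof (intro allI impI)
  interpret majorant_fun \<omega> by unfold_locales fact
  fix \<phi> :: "real^'n \<Rightarrow> real"
  assume "\<phi> \<in> Lambda_class \<mu> \<omega> \<infinity> (sphere 0 1) \<and> continuous_on (sphere 0 1) \<phi>"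
  then have \<phi>: "continuous_on (sphere 0 1) \<phi>" and L: "\<phi> \<in> Lambda_class \<mu> \<omega> \<infinity> (sphere 0 1)" by auto
  from L obtain C where C: "C > 0" and le: "\<And>x1 x2. x1 \<in> sphere 0 1 \<Longrightarrow> x2 \<in> sphere 0 1 \<Longrightarrow> \<bar>\<phi> x1 - \<phi> x2\<bar> \<le> C * \<omega> (norm (x1 - x2))"
    unfolding Lambda_class_def rot_diff_def by (auto simp: ennreal_le_iff nonneg)
  define I where "I = (mat 1 :: real^'n^'n)"
  define \<nu> where "\<nu> = return (restrict_space borel (SO :: (real^'n^'n) set)) I"
  have I: "I \<in> SO" unfolding I_def by (rule mat_1_SO)
  then have sp: "I \<in> space (restrict_space borel SO)" by (simp add: space_restrict_space)
  have I1: "I *v x = x" for x by (simp add: I_def)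
  interpret \<nu>: prob_space \<nu> unfolding \<nu>_def by (rule prob_space_return[OF sp])
  have pw: "f \<in> borel_measurable (restrict_space borel SO) \<Longrightarrow> (\<integral>\<^sup>+R. f R \<partial>\<nu>) = f I" for f
    unfolding \<nu>_def by (rule nn_integral_return[OF sp])
  have id: "(\<lambda>R. R *v x) \<in> borel_measurable (restrict_space borel (SO :: (real^'n^'n) set))" for x
  proof (rule measurable_restrict_space1, rule borel_measurable_continuous_onI)
    show "continuous_on UNIV (\<lambda>R::real^'n^'n. R *v x)"
      unfolding matrix_vector_mult_def by (intro continuous_intros)
  qed
  have comp: "(\<lambda>R. f (R *v x)) \<in> borel_measurable (restrict_space borel (SO :: (real^'n^'n) set))"
    if f: "(\<lambda>x. f x * indicator A x) \<in> borel_measurable borel" and A: "\<And>R. R \<in> SO \<Longrightarrow> R *v x \<in> A" for f :: "real^'n \<Rightarrow> real" and x A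
  proof -
    have "(\<lambda>R. f (R *v x) * indicator A (R *v x)) \<in> borel_measurable (restrict_space borel (SO :: (real^'n^'n) set))"
      by (rule measurable_compose[OF id f])
    also have "?this \<longleftrightarrow> ?thesis"
      by (rule measurable_cong) (simp add: space_restrict_space A)
    finally show ?thesis .
  qed
  have nR: "R \<in> SO \<Longrightarrow> norm (R *v x) = norm x" for R :: "real^'n^'n" and x
    using rotation_orthogonal_transformation by (rule orthogonal_transformation_norm)
  have m\<phi>: "(\<lambda>R. \<phi> (R *v x)) \<in> borel_measurable (restrict_space borel SO)" if "x \<in> sphere 0 1" for x
    by (rule comp[OF borel_measurable_restrict_sphere(1)[OF \<phi>]]) (use that in \<open>simp add: nR\<close>)
  have mP: "(\<lambda>R. poisson_ext \<alpha> \<phi> (R *v x)) \<in> borel_measurable (restrict_space borel SO)" if "x \<in> cball 0 1" for x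
    by (rule comp[OF borel_measurable_poisson_ext[OF \<phi>]]) (use that in \<open>simp add: nR\<close>)
  have "\<exists>C>0. \<forall>x1\<in>cball 0 1. \<forall>x2\<in>cball 0 1.
      (\<integral>\<^sup>+ R. ennreal (\<bar>poisson_ext \<alpha> \<phi> (R *v x1) - poisson_ext \<alpha> \<phi> (R *v x2)\<bar> powr 1) \<partial>\<nu>)
        \<le> ennreal ((C * \<omega> (norm (x1 - x2))) powr 1)"
  proof (rule cond_C2_imp_cond_C1_finite[OF n \<alpha> \<omega> C2 _ _ _ \<phi> C])
    show "finite_measure \<nu>" by unfold_locales
    show "sets \<nu> = sets (restrict_space borel SO)" by (simp add: \<nu>_def)
    fix x1 x2 :: "real^'n" assume x: "x1 \<in> sphere 0 1" "x2 \<in> sphere 0 1"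
    have "(\<integral>\<^sup>+ R. ennreal (\<bar>\<phi> (R *v x1) - \<phi> (R *v x2)\<bar> powr 1) \<partial>\<nu>) = ennreal (\<bar>\<phi> (I *v x1) - \<phi> (I *v x2)\<bar> powr 1)"
      using m\<phi>[OF x(1)] m\<phi>[OF x(2)] by (intro pw) measurable
    then show "(\<integral>\<^sup>+ R. ennreal (\<bar>\<phi> (R *v x1) - \<phi> (R *v x2)\<bar> powr 1) \<partial>\<nu>) \<le> ennreal ((C * \<omega> (norm (x1 - x2))) powr 1)"
      using le[OF x] C by (simp add: I1 nonneg ennreal_leI)
  qed simp
  then obtain C' where C': "C' > 0" and le': "\<And>x1 x2. x1 \<in> cball 0 1 \<Longrightarrow> x2 \<in> cball 0 1 \<Longrightarrow>
      (\<integral>\<^sup>+ R. ennreal (\<bar>poisson_ext \<alpha> \<phi> (R *v x1) - poisson_ext \<alpha> \<phi> (R *v x2)\<bar> powr 1) \<partial>\<nu>)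
        \<le> ennreal ((C' * \<omega> (norm (x1 - x2))) powr 1)" by blast
  have "ennreal \<bar>poisson_ext \<alpha> \<phi> x1 - poisson_ext \<alpha> \<phi> x2\<bar> \<le> ennreal (C' * \<omega> (norm (x1 - x2)))"
    if x: "x1 \<in> cball 0 1" "x2 \<in> cball 0 1" for x1 x2
  proof -
    have "(\<integral>\<^sup>+ R. ennreal (\<bar>poisson_ext \<alpha> \<phi> (R *v x1) - poisson_ext \<alpha> \<phi> (R *v x2)\<bar> powr 1) \<partial>\<nu>)
       = ennreal (\<bar>poisson_ext \<alpha> \<phi> (I *v x1) - poisson_ext \<alpha> \<phi> (I *v x2)\<bar> powr 1)"
      using mP[OF x(1)] mP[OF x(2)] by (intro pw) measurable
    then show ?thesis using le'[OF x] C' by (simp add: I1 nonneg)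
  qed
  then show "poisson_ext \<alpha> \<phi> \<in> Lambda_class \<mu> \<omega> \<infinity> (cball 0 1)"
    unfolding Lambda_class_def rot_diff_def using C' poisson_ext_borel[OF \<phi>] cball_neq_sphere by auto
qed

lemma cond_C2_imp_cond_C1:
  fixes \<alpha> :: real and \<omega> :: "real \<Rightarrow> real" and \<mu> :: "(real^'n^'n) measure"
  assumes n: "CARD('n) \<ge> 2" and \<alpha>: "\<alpha> > -1" and \<omega>: "majorant \<omega>" and \<mu>: "haar_measure_SO \<mu>"
    and C2: "cond_C2 \<alpha> \<omega>" and p: "p \<ge> 1"
  shows "cond_C1 \<mu> \<alpha> \<omega> p"
proof (cases "p = \<infinity>")
  case True
  then show ?thesis using cond_C2_imp_cond_C1_infinity[OF n \<alpha> \<omega> C2] by simp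
next
  case False
  interpret majorant_fun \<omega> by unfold_locales fact
  define q where "q = enn2real p"
  have pq: "p = ennreal q" using False by (simp add: q_def less_top)
  have q: "q \<ge> 1" using p unfolding pq by (simp add: ennreal_ge_1)
  have sets: "sets \<mu> = sets (restrict_space borel SO)" using \<mu> by (simp add: haar_measure_SO_def)
  have sp: "space \<mu> = SO" using sets_eq_imp_space_eq[OF sets] by (simp add: space_restrict_space)
  have fin: "finite_measure \<mu>"
    by (rule finite_measureI) (use \<mu> in \<open>simp add: sp haar_measure_SO_def\<close>)
  have rd: "rot_diff \<mu> p f x1 x2 \<le> ennreal (C * \<omega> (norm (x1 - x2))) \<longleftrightarrow>
    (\<integral>\<^sup>+ R. ennreal (\<bar>f (R *v x1) - f (R *v x2)\<bar> powr q) \<partial>\<mu>) \<le> ennreal ((C * \<omega> (norm (x1 - x2))) powr q)"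
    if "C > 0" for f x1 x2 C
    unfolding rot_diff_def using False q that
    by (simp add: q_def[symmetric] ennreal_root_le_iff nonneg)
  show ?thesis
    unfolding cond_C1_def
  proof (intro allI impI)
    fix \<phi> :: "real^'n \<Rightarrow> real"
    assume "\<phi> \<in> Lambda_class \<mu> \<omega> p (sphere 0 1) \<and> continuous_on (sphere 0 1) \<phi>"
    then have \<phi>: "continuous_on (sphere 0 1) \<phi>" and L: "\<phi> \<in> Lambda_class \<mu> \<omega> p (sphere 0 1)" by auto
    from L obtain C where C: "C > 0" and le: "\<And>x1 x2. x1 \<in> sphere 0 1 \<Longrightarrow> x2 \<in> sphere 0 1 \<Longrightarrow>
        rot_diff \<mu> p \<phi> x1 x2 \<le> ennreal (C * \<omega> (norm (x1 - x2)))"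
      unfolding Lambda_class_def by auto
    obtain C' where "C' > 0" "\<forall>x1\<in>cball 0 1. \<forall>x2\<in>cball 0 1.
      (\<integral>\<^sup>+ R. ennreal (\<bar>poisson_ext \<alpha> \<phi> (R *v x1) - poisson_ext \<alpha> \<phi> (R *v x2)\<bar> powr q) \<partial>\<mu>)
        \<le> ennreal ((C' * \<omega> (norm (x1 - x2))) powr q)"
      using cond_C2_imp_cond_C1_finite[OF n \<alpha> \<omega> C2 fin sets q \<phi> C] le unfolding rd[OF C] by blast
    then have "\<exists>C>0. \<forall>x1\<in>cball 0 1. \<forall>x2\<in>cball 0 1. rot_diff \<mu> p (poisson_ext \<alpha> \<phi>) x1 x2 \<le> ennreal (C * \<omega> (norm (x1 - x2)))"
      using rd by blast
    then show "poisson_ext \<alpha> \<phi> \<in> Lambda_class \<mu> \<omega> p (cball 0 1)"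
      unfolding Lambda_class_def using poisson_ext_borel[OF \<phi>] cball_neq_sphere by auto
  qed
qed

text \<open>The kernel estimate sees chord lengths up to 1, whereas (C2) integrates up to pi. For
  \<delta> \<le> 1/2 the missing integral over [1, pi] is a fixed multiple of the one over [1/2, 1],
  which is part of the integral already controlled. For \<delta> > 1/2 the left side is bounded
  above and \<omega>(\<delta>) \<ge> \<omega>(1/2) > 0, so nothing has to be estimated.\<close>

lemma (in majorant_fun) cond_C2_from_unit_interval:
  assumes \<alpha>: "\<alpha> > -1" and C: "C > 0"
    and le: "\<And>\<delta>. 0 < \<delta> \<Longrightarrow> \<delta> \<le> 1 \<Longrightarrow> \<delta> powr (1 + \<alpha>) * integral {\<delta>..1} (\<lambda>t. \<omega> t / t powr (2 + \<alpha>)) \<le> C * \<omega> \<delta>"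
  shows "cond_C2 \<alpha> \<omega>"
proof -
  define f where "f t = \<omega> t / t powr (2 + \<alpha>)" for t
  define I0 where "I0 = integral {1..pi} f"
  define I1 where "I1 = integral {1/2..1} f"
  define I2 where "I2 = integral {1/2..pi} f"
  have I: "I0 > 0" "I1 > 0" "I2 > 0"
    unfolding I0_def I1_def I2_def f_def using \<alpha> pi_gt3 by (intro integral_pos; simp)+
  define C' where "C' = C + I0 / I1 * C"
  define C'' where "C'' = pi powr (1 + \<alpha>) * I2 / \<omega> (1/2)"
  have w: "\<omega> (1/2) > 0" by (simp add: pos)
  have pos': "C' > 0" "C'' > 0" using I C w by (auto simp: C'_def C''_def intro!: add_pos_pos)
  have "\<delta> powr (1 + \<alpha>) * integral {\<delta>..pi} f \<le> (C' + C'') * \<omega> \<delta>" if \<delta>: "0 < \<delta>" "\<delta> \<le> pi" for \<delta>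
  proof (cases "\<delta> \<le> 1/2")
    case True
    have w\<delta>: "\<omega> \<delta> \<ge> 0" using \<delta> by (simp add: nonneg)
    have "f integrable_on {\<delta>..pi}"
      unfolding f_def using \<delta> by (intro integrable_continuous_real integrand_continuous)
    then have split: "integral {\<delta>..pi} f = integral {\<delta>..1} f + I0"
      unfolding I0_def using True pi_gt3 by (intro Henstock_Kurzweil_Integration.integral_combine[symmetric]) auto
    have d1: "\<delta> powr (1 + \<alpha>) * integral {\<delta>..1} f \<le> C * \<omega> \<delta>"
      unfolding f_def using \<delta> True by (intro le) auto
    have "\<delta> powr (1 + \<alpha>) * I1 \<le> \<delta> powr (1 + \<alpha>) * integral {\<delta>..1} f"
      unfolding I1_def f_def using \<delta> True by (intro mult_left_mono integral_mono_interval) auto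
    then have "\<delta> powr (1 + \<alpha>) * I1 \<le> C * \<omega> \<delta>" using d1 by linarith
    then have "\<delta> powr (1 + \<alpha>) * I0 \<le> I0 / I1 * C * \<omega> \<delta>"
      using I by (simp add: field_simps mult_left_mono)
    then have "\<delta> powr (1 + \<alpha>) * integral {\<delta>..pi} f \<le> C' * \<omega> \<delta>"
      using d1 unfolding split C'_def by (simp add: algebra_simps)
    also have "\<dots> \<le> (C' + C'') * \<omega> \<delta>" using pos' w\<delta> by (intro mult_right_mono) auto
    finally show ?thesis .
  next
    case False
    have "\<delta> powr (1 + \<alpha>) * integral {\<delta>..pi} f \<le> pi powr (1 + \<alpha>) * I2"
      unfolding I2_def f_def using \<delta> False \<alpha>
      by (intro mult_mono powr_mono2 integral_mono_interval integral_nonneg integrable_continuous_real integrand_continuous)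
        (auto intro: integrand_nonneg)
    also have "\<dots> = C'' * \<omega> (1/2)" using w by (simp add: C''_def)
    also have "\<dots> \<le> (C' + C'') * \<omega> \<delta>"
      using pos' False w by (intro mult_mono mono) auto
    finally show ?thesis .
  qed
  then show ?thesis
    unfolding cond_C2_def f_def using pos' by (intro exI[of _ "C' + C''"]) auto
qed

text \<open>The test function is in the class by subadditivity of \<omega>. It vanishes at \<xi>, so
  the increment of its extension from \<xi> to (1 - \<delta>) \<xi> is the Poisson integral itself,
  with no contribution from the mass defect. The class bounds this increment by a multiple of
  \<omega>(\<delta>), and the pointwise lower bound of the kernel bounds it from below by a multiple
  of the left side of (C2), up to the upper limit 1.\<close>

lemma cond_C1_infinity_imp_cond_C2:
  fixes \<alpha> :: real and \<omega> :: "real \<Rightarrow> real" and \<mu> :: "(real^'n^'n) measure"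
  assumes n: "CARD('n) \<ge> 2" and \<alpha>: "\<alpha> > -1" and \<omega>: "majorant \<omega>" and C1: "cond_C1 \<mu> \<alpha> \<omega> \<infinity>"
  shows "cond_C2 \<alpha> \<omega>"
proof -
  interpret majorant_fun \<omega> by unfold_locales fact
  interpret S: prob_space "sphere_measure :: (real^'n) measure" by (rule prob_space_sphere_measure)
  obtain \<xi> :: "real^'n" where \<xi>: "norm \<xi> = 1"
    using polar_decomposition[of "0::real^'n"] by blast
  define m where "m = real CARD('n) + \<alpha>"
  define k where "k = poisson_const CARD('n) \<alpha>"
  have k: "k > 0" unfolding k_def by (rule poisson_const_pos[OF \<alpha> n])
  define \<phi> where "\<phi> \<zeta> = \<omega> (norm (\<zeta> - \<xi>))" for \<zeta>
  have cont: "continuous_on UNIV \<phi>"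
  proof -
    have "continuous_on UNIV (\<lambda>\<zeta>. \<omega> \<bar>norm (\<zeta> - \<xi>)\<bar>)"
      by (rule continuous_on_compose2[OF continuous_abs]) (auto intro!: continuous_intros)
    then show ?thesis by (simp add: \<phi>_def[abs_def])
  qed
  then have m\<phi>: "\<phi> \<in> borel_measurable borel" by (rule borel_measurable_continuous_onI)
  have \<phi>b: "0 \<le> \<phi> \<zeta>" "\<zeta> \<in> sphere 0 1 \<Longrightarrow> \<bar>\<phi> \<zeta>\<bar> \<le> \<omega> 2" for \<zeta>
  proof -
    show "0 \<le> \<phi> \<zeta>" by (simp add: \<phi>_def nonneg)
    assume "\<zeta> \<in> sphere 0 1"
    then have "norm (\<zeta> - \<xi>) \<le> 2" using norm_triangle_ineq4[of \<zeta> \<xi>] \<xi> by simp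
    then show "\<bar>\<phi> \<zeta>\<bar> \<le> \<omega> 2" using \<open>0 \<le> \<phi> \<zeta>\<close> by (simp add: \<phi>_def mono)
  qed
  have "\<phi> \<in> Lambda_class \<mu> \<omega> \<infinity> (sphere 0 1)"
  proof -
    have "in_Lp sphere_measure \<infinity> \<phi>"
      unfolding in_Lp_def using measurable_sphere_measure_borel[OF m\<phi>] \<phi>b(2)
      by (auto intro!: exI[of _ "\<omega> 2"])
    moreover have "\<bar>\<phi> x1 - \<phi> x2\<bar> \<le> 1 * \<omega> (norm (x1 - x2))" for x1 x2
    proof -
      have "\<bar>\<phi> x1 - \<phi> x2\<bar> \<le> \<omega> \<bar>norm (x1 - \<xi>) - norm (x2 - \<xi>)\<bar>"
        unfolding \<phi>_def by (rule abs_diff) auto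
      also have "\<dots> \<le> \<omega> (norm (x1 - x2))"
        using norm_triangle_ineq3[of "x1 - \<xi>" "x2 - \<xi>"] by (intro mono) auto
      finally show ?thesis by simp
    qed
    ultimately show ?thesis
      unfolding Lambda_class_def rot_diff_def
      by (auto intro!: exI[of _ 1] ennreal_leI)
  qed
  then have "poisson_ext \<alpha> \<phi> \<in> Lambda_class \<mu> \<omega> \<infinity> (cball 0 1)"
    using C1 continuous_on_subset[OF cont, of "sphere 0 1"] unfolding cond_C1_def by auto
  then obtain C where C: "C > 0" and le: "\<And>x1 x2. x1 \<in> cball 0 1 \<Longrightarrow> x2 \<in> cball 0 1 \<Longrightarrow>
      \<bar>poisson_ext \<alpha> \<phi> x1 - poisson_ext \<alpha> \<phi> x2\<bar> \<le> C * \<omega> (norm (x1 - x2))"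
    unfolding Lambda_class_def rot_diff_def by (auto simp: nonneg)
  obtain c where c: "c > 0" and lower: "\<And>\<xi> \<delta>. \<xi> \<in> sphere (0::real^'n) 1 \<Longrightarrow> \<delta> \<in> {0<..1} \<Longrightarrow>
    ennreal (c * \<delta> powr (1 + \<alpha>)) * (\<integral>\<^sup>+t. ennreal (\<omega> \<bar>t\<bar> / t powr (2 + \<alpha>)) * indicator {\<delta>..1} t \<partial>lborel)
    \<le> (\<integral>\<^sup>+\<zeta>. ennreal (\<delta> powr (1 + \<alpha>) * \<omega> (norm (\<zeta> - \<xi>)) / (\<delta> + norm (\<zeta> - \<xi>)) powr m) \<partial>sphere_measure)"
    using weighted_kernel_lower_bound[OF n \<alpha>] unfolding m_def by blast
  have "\<delta> powr (1 + \<alpha>) * integral {\<delta>..1} (\<lambda>t. \<omega> t / t powr (2 + \<alpha>)) \<le> C / (k * c) * \<omega> \<delta>" if \<delta>: "0 < \<delta>" "\<delta> \<le> 1" for \<delta>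
  proof -
    define r where "r = 1 - \<delta>"
    define x where "x = r *\<^sub>R \<xi>"
    have r: "0 \<le> r" "r < 1" "1 - r = \<delta>" using \<delta> by (auto simp: r_def)
    have x: "norm x < 1" using r \<xi> by (simp add: x_def)
    define J where "J = integral {\<delta>..1} (\<lambda>t. \<omega> t / t powr (2 + \<alpha>))"
    have J: "J \<ge> 0" unfolding J_def using \<delta>
      by (intro integral_nonneg integrable_continuous_real integrand_continuous) (auto intro: integrand_nonneg)
    obtain b where b: "b \<ge> 0" "\<forall>\<zeta>\<in>sphere (0::real^'n) 1. \<bar>poisson_kernel \<alpha> x \<zeta>\<bar> \<le> b"
      using poisson_kernel_bounded[OF n \<alpha> x] by blast
    have mP: "(\<lambda>\<zeta>. poisson_kernel \<alpha> x \<zeta> * \<phi> \<zeta>) \<in> borel_measurable sphere_measure"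
      by (intro borel_measurable_times measurable_sphere_measure_borel m\<phi> borel_measurable_poisson_kernel)
    have int: "integrable sphere_measure (\<lambda>\<zeta>. poisson_kernel \<alpha> x \<zeta> * \<phi> \<zeta>)"
    proof (rule integrable_sphere_bounded[OF mP])
      show "\<bar>poisson_kernel \<alpha> x \<zeta> * \<phi> \<zeta>\<bar> \<le> b * \<omega> 2" if "\<zeta> \<in> sphere 0 1" for \<zeta>
        unfolding abs_mult using b \<phi>b(2)[OF that] that by (intro mult_mono) auto
    qed
    have "ennreal (k * c * \<delta> powr (1 + \<alpha>) * J) = ennreal k * (ennreal (c * \<delta> powr (1 + \<alpha>)) * ennreal J)"
      using k c J by (simp add: mult.assoc flip: ennreal_mult)
    also have "\<dots> = ennreal k * (ennreal (c * \<delta> powr (1 + \<alpha>)) * (\<integral>\<^sup>+t. ennreal (\<omega> \<bar>t\<bar> / t powr (2 + \<alpha>)) * indicator {\<delta>..1} t \<partial>lborel))"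
      unfolding J_def nn_integral_eq_integral[OF \<delta>(1)] ..
    also have "\<dots> \<le> ennreal k * (\<integral>\<^sup>+\<zeta>. ennreal (\<delta> powr (1 + \<alpha>) * \<omega> (norm (\<zeta> - \<xi>)) / (\<delta> + norm (\<zeta> - \<xi>)) powr m) \<partial>sphere_measure)"
      using \<delta> \<xi> by (intro mult_left_mono lower) auto
    also have "\<dots> = (\<integral>\<^sup>+\<zeta>. ennreal k * ennreal (\<delta> powr (1 + \<alpha>) * \<omega> (norm (\<zeta> - \<xi>)) / (\<delta> + norm (\<zeta> - \<xi>)) powr m) \<partial>sphere_measure)"
    proof (rule nn_integral_cmult[symmetric])
      show "(\<lambda>\<zeta>. ennreal (\<delta> powr (1 + \<alpha>) * \<omega> (norm (\<zeta> - \<xi>)) / (\<delta> + norm (\<zeta> - \<xi>)) powr m)) \<in> borel_measurable sphere_measure"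
        by (rule measurable_sphere_measure_borel) measurable
    qed
    also have "\<dots> \<le> (\<integral>\<^sup>+\<zeta>. ennreal (poisson_kernel \<alpha> x \<zeta> * \<phi> \<zeta>) \<partial>sphere_measure)"
    proof (rule nn_integral_mono)
      fix \<zeta> :: "real^'n" assume "\<zeta> \<in> space sphere_measure"
      then have "k * (\<delta> powr (1 + \<alpha>) / (\<delta> + norm (\<zeta> - \<xi>)) powr m) \<le> poisson_kernel \<alpha> x \<zeta>"
        using poisson_kernel_bounds(1)[OF n \<alpha> r(1,2) \<xi>, of \<zeta>] by (simp add: k_def m_def x_def r(3))
      then have "k * (\<delta> powr (1 + \<alpha>) / (\<delta> + norm (\<zeta> - \<xi>)) powr m) * \<phi> \<zeta> \<le> poisson_kernel \<alpha> x \<zeta> * \<phi> \<zeta>"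
        by (rule mult_right_mono) (rule \<phi>b(1))
      then have "ennreal (k * (\<delta> powr (1 + \<alpha>) * \<omega> (norm (\<zeta> - \<xi>)) / (\<delta> + norm (\<zeta> - \<xi>)) powr m)) \<le> ennreal (poisson_kernel \<alpha> x \<zeta> * \<phi> \<zeta>)"
        by (intro ennreal_leI) (simp add: \<phi>_def)
      then show "ennreal k * ennreal (\<delta> powr (1 + \<alpha>) * \<omega> (norm (\<zeta> - \<xi>)) / (\<delta> + norm (\<zeta> - \<xi>)) powr m) \<le> ennreal (poisson_kernel \<alpha> x \<zeta> * \<phi> \<zeta>)"
        using k by (simp only: ennreal_mult'[OF less_imp_le])
    qed
    also have "\<dots> = ennreal (poisson_ext \<alpha> \<phi> x)"
    proof -
      have "0 \<le> poisson_kernel \<alpha> x \<zeta> * \<phi> \<zeta>" for \<zeta>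
        by (intro mult_nonneg_nonneg poisson_kernel_nonneg[OF n \<alpha>] \<phi>b(1))
      then show ?thesis
        using x by (subst Bochner_Integration.nn_integral_eq_integral[OF int]) (auto simp: poisson_ext_def)
    qed
    also have "\<dots> \<le> ennreal (C * \<omega> \<delta>)"
    proof (rule ennreal_leI)
      have "x - \<xi> = (r - 1) *\<^sub>R \<xi>" by (simp add: x_def scaleR_diff_left)
      then have nx: "norm (x - \<xi>) = \<delta>" using \<xi> r by simp
      have "poisson_ext \<alpha> \<phi> \<xi> = 0" using \<xi> by (simp add: poisson_ext_def \<phi>_def)
      then show "poisson_ext \<alpha> \<phi> x \<le> C * \<omega> \<delta>"
        using le[of x \<xi>] x \<xi> nx by simp
    qed
    finally have "k * c * \<delta> powr (1 + \<alpha>) * J \<le> C * \<omega> \<delta>"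
      using C \<delta> by (simp add: nonneg)
    then show ?thesis using k c unfolding J_def[symmetric] by (simp add: field_simps)
  qed
  then show ?thesis
    by (intro cond_C2_from_unit_interval[OF \<alpha>, of "C / (k * c)"]) (use C k c in auto)
qed

theorem theorem1p2:
  fixes \<alpha> :: real and \<omega> :: "real \<Rightarrow> real" and \<mu> :: "(real^'n^'n) measure"
  assumes "CARD('n) \<ge> 2"
    and "\<alpha> > -1"
    and "majorant \<omega>"
    and "haar_measure_SO \<mu>"
  shows "(\<forall>p\<ge>1. cond_C2 \<alpha> \<omega> \<longrightarrow> cond_C1 \<mu> \<alpha> \<omega> p) \<and>
         (cond_C2 \<alpha> \<omega> \<longleftrightarrow> cond_C1 \<mu> \<alpha> \<omega> \<infinity>)"
  using cond_C2_imp_cond_C1[OF assms] cond_C2_imp_cond_C1_infinity[OF assms(1-3)]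
    cond_C1_infinity_imp_cond_C2[OF assms(1-3)] by blast

end
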